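(* Let $\Omega\subset\mathbb{R}^n$ be a domain, $f\in C(\Omega)\cap L^\infty(\Omega)$, $p\in C^1(\Omega)$ with $1<p_{\min}\le p(x)\le p_{\max}<\infty$ and $\nabla p\in L^\infty(\Omega)$. If $u\in W^{1,p(\cdot)}(\Omega)\cap C(\Omega)$ is a weak solution of $\Delta_{p(x)}u=f$ in $\Omega$, then $u$ is a viscosity solution of $\Delta_{p(x)}u=f$ in $\Omega$.
   Context: $\Delta_{p(x)}u=\mathrm{div}(|\nabla u|^{p(x)-2}\nabla u)$. $W^{1,p(\cdot)}(\Omega)$ is the variable-exponent Sobolev space of $u$ with $u,|\nabla u|\in L^{p(\cdot)}(\Omega)$, where $L^{p(\cdot)}$ consists of measurable $u$ with $\int_\Omega|u|^{p(x)}dx<\infty$ (Luxemburg norm). Weak solution: $u\in W^{1,p(\cdot)}(\Omega)$ with $-\int_\Omega|\nabla u|^{p(x)-2}\nabla u\cdot\nabla\varphi\,dx=\int_\Omega\varphi f\,dx$ for all $\varphi\in C_0^\infty(\Omega)$. Viscosity solution: $u$ is continuous and for every $\varphi\in C^2$ and $x_0\in\Omega$ with $\nabla\varphi(x_0)\ne0$, if $\varphi$ touches $u$ from above (resp. below) at $x_0$ then $\Delta_{p(x)}\varphi(x_0)\ge f(x_0)$ (resp. $\le f(x_0)$), where for $C^2$ $\varphi$ with nonvanishing gradient $\Delta_{p(x)}\varphi$ is computed pointwise as $|\nabla\varphi|^{p(x)-2}\big(\Delta\varphi+(p(x)-2)\langle D^2\varphi\frac{\nabla\varphi}{|\nabla\varphi|},\frac{\nabla\varphi}{|\nabla\varphi|}\rangle+\log|\nabla\varphi|\,\nabla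 p\cdot\nabla\varphi\big)$. *)

theory Defs
  imports "HOL-Analysis.Analysis"
begin

text \<open>Smooth (C-infinity) real functions on a Euclidean space: a family D of
  iterated partial derivatives (indexed by lists of directions) with D [] = phi,
  each member being Frechet differentiable everywhere with partial derivatives
  given by the family.\<close>
definition smooth_fun :: "('a::euclidean_space \<Rightarrow> real) \<Rightarrow> bool" where
  "smooth_fun \<phi> \<longleftrightarrow>
     (\<exists>D :: 'a list \<Rightarrow> 'a \<Rightarrow> real. D [] = \<phi> \<and>
        (\<forall>vs x. (D vs has_derivative (\<lambda>h. \<Sum>i\<in>Basis. (h \<bullet> i) * D (i # vs) x)) (at x)))"

definition tsupport :: "('a::euclidean_space \<Rightarrow> real) \<Rightarrow> 'a set" where
  "tsupport \<phi> = closure {x. \<phi> x \<noteq> 0}"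

definition test_fun :: "'a::euclidean_space set \<Rightarrow> ('a \<Rightarrow> real) \<Rightarrow> bool" where
  "test_fun \<Omega> \<phi> \<longleftrightarrow> smooth_fun \<phi> \<and> compact (tsupport \<phi>) \<and> tsupport \<phi> \<subseteq> \<Omega>"

definition in_Lpx :: "'a::euclidean_space set \<Rightarrow> ('a \<Rightarrow> real) \<Rightarrow> ('a \<Rightarrow> 'b::euclidean_space) \<Rightarrow> bool" where
  "in_Lpx \<Omega> p u \<longleftrightarrow> u \<in> borel_measurable (lebesgue_on \<Omega>) \<and>
      integrable (lebesgue_on \<Omega>) (\<lambda>x. norm (u x) powr p x)"

definition weak_gradient :: "'a::euclidean_space set \<Rightarrow> ('a \<Rightarrow> real) \<Rightarrow> ('a \<Rightarrow> 'a) \<Rightarrow> bool" where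
  "weak_gradient \<Omega> u g \<longleftrightarrow>
     (\<forall>\<phi>. test_fun \<Omega> \<phi> \<longrightarrow> (\<forall>i\<in>Basis.
        integral\<^sup>L (lebesgue_on \<Omega>) (\<lambda>x. u x * frechet_derivative \<phi> (at x) i)
        = - integral\<^sup>L (lebesgue_on \<Omega>) (\<lambda>x. (g x \<bullet> i) * \<phi> x)))"

definition W1px_grad :: "'a::euclidean_space set \<Rightarrow> ('a \<Rightarrow> real) \<Rightarrow> ('a \<Rightarrow> real) \<Rightarrow> ('a \<Rightarrow> 'a) \<Rightarrow> bool" where
  "W1px_grad \<Omega> p u g \<longleftrightarrow> in_Lpx \<Omega> p u \<and> weak_gradient \<Omega> u g \<and> in_Lpx \<Omega> p g"

definition in_W1px :: "'a::euclidean_space set \<Rightarrow> ('a \<Rightarrow> real) \<Rightarrow> ('a \<Rightarrow> real) \<Rightarrow> bool" where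
  "in_W1px \<Omega> p u \<longleftrightarrow> (\<exists>g. W1px_grad \<Omega> p u g)"

definition weak_solution :: "'a::euclidean_space set \<Rightarrow> ('a \<Rightarrow> real) \<Rightarrow> ('a \<Rightarrow> real) \<Rightarrow> ('a \<Rightarrow> real) \<Rightarrow> bool" where
  "weak_solution \<Omega> p f u \<longleftrightarrow>
     (\<exists>g. W1px_grad \<Omega> p u g \<and>
        (\<forall>\<phi>. test_fun \<Omega> \<phi> \<longrightarrow>
           - integral\<^sup>L (lebesgue_on \<Omega>)
               (\<lambda>x. norm (g x) powr (p x - 2) * frechet_derivative \<phi> (at x) (g x))
           = integral\<^sup>L (lebesgue_on \<Omega>) (\<lambda>x. \<phi> x * f x)))"

definition C2_on :: "'a::euclidean_space set \<Rightarrow> ('a \<Rightarrow> real) \<Rightarrow> ('a \<Rightarrow> 'a) \<Rightarrow> ('a \<Rightarrow> 'a \<Rightarrow> 'a) \<Rightarrow> bool" where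
  "C2_on \<Omega> \<phi> G H \<longleftrightarrow>
     (\<forall>x\<in>\<Omega>. (\<phi> has_derivative (\<lambda>h. G x \<bullet> h)) (at x) \<and> (G has_derivative H x) (at x)) \<and>
     (\<forall>v. continuous_on \<Omega> (\<lambda>x. H x v))"

text \<open>Pointwise p(x)-Laplacian of a C^2 function with nonvanishing gradient
  (gp is the gradient of p).\<close>
definition plap_pt :: "('a::euclidean_space \<Rightarrow> real) \<Rightarrow> ('a \<Rightarrow> 'a) \<Rightarrow> ('a \<Rightarrow> 'a) \<Rightarrow> ('a \<Rightarrow> 'a \<Rightarrow> 'a) \<Rightarrow> 'a \<Rightarrow> real" where
  "plap_pt p gp G H x =
     (let \<nu> = G x /\<^sub>R norm (G x) in
      norm (G x) powr (p x - 2) *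
        ((\<Sum>i\<in>Basis. H x i \<bullet> i) + (p x - 2) * (H x \<nu> \<bullet> \<nu>) + ln (norm (G x)) * (gp x \<bullet> G x)))"

definition viscosity_solution :: "'a::euclidean_space set \<Rightarrow> ('a \<Rightarrow> real) \<Rightarrow> ('a \<Rightarrow> 'a) \<Rightarrow> ('a \<Rightarrow> real) \<Rightarrow> ('a \<Rightarrow> real) \<Rightarrow> bool" where
  "viscosity_solution \<Omega> p gp f u \<longleftrightarrow>
     continuous_on \<Omega> u \<and>
     (\<forall>\<phi> G H x0. C2_on \<Omega> \<phi> G H \<and> x0 \<in> \<Omega> \<and> G x0 \<noteq> 0 \<longrightarrow>
        ((\<phi> x0 = u x0 \<and> (\<exists>r>0. \<forall>x\<in>ball x0 r \<inter> \<Omega>. u x \<le> \<phi> x)) \<longrightarrow> plap_pt p gp G H x0 \<ge> f x0) \<and>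
        ((\<phi> x0 = u x0 \<and> (\<exists>r>0. \<forall>x\<in>ball x0 r \<inter> \<Omega>. \<phi> x \<le> u x)) \<longrightarrow> plap_pt p gp G H x0 \<le> f x0))"

end

theory Submission
  imports Defs
begin

text \<open>
  If \<open>\<phi>\<close> touched \<open>u\<close> from above at \<open>x\<^sub>0\<close> with too small a \<open>p(x)\<close>-Laplacian, then a shift \<open>\<psi>\<close> of
  \<open>\<phi> + \<kappa> * \<bar>x - x\<^sub>0\<bar>\<^sup>2\<close> would be a strict classical supersolution in a small ball, lying above \<open>u\<close> near
  the boundary but below \<open>u\<close> at the centre. Testing both equations with \<open>(max 0 (u - \<psi>))\<^sup>2\<close>, a choice
  that makes the chain rule \<open>C\<^sup>1\<close>, contradicts the monotonicity of \<open>a \<mapsto> \<bar>a\<bar> powr (p - 2) * a\<close>.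

  This test function is not smooth, and smooth functions need not be dense in \<open>W\<close> for a general
  variable exponent. One therefore tests with the \<open>C\<^sup>1\<close> function \<open>(max 0 (\<eta>\<^sub>n * u - \<psi>))\<^sup>2\<close> for mollifiers
  \<open>\<eta>\<^sub>n\<close>. As \<open>p\<close> is locally Lipschitz, \<open>\<bar>\<eta>\<^sub>n * g\<bar> powr p \<le> C * (\<eta>\<^sub>n * (\<bar>g\<bar> powr p) + 1)\<close>, where the right-hand side
  converges in \<open>L\<^sup>1\<close>; this domination allows the limit to be taken under the integral.
\<close>

section \<open>Mollifiers\<close>

text \<open>The obstacle is that monotonicity applies only in the limit. At stage \<open>n\<close>
  the pairing is \<open>(A - V') \<bullet> (gn n - G')\<close>, with \<open>g\<close> in the flux
  but its mollification in the test function, and this has no sign. The product of the flux with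
  \<open>gn n\<close> must therefore be passed to the limit first, and L^1 convergence of
  \<open>gn n\<close> alone does not give that; hence the domination by mollified energies. In the
  limit the left side is nonnegative, while the right side is the integral of
  \<open>(max 0 (u - \<psi>))\<^sup>2 * (Q - f)\<close>, where \<open>Q\<close> is the classical
  divergence of the flux of \<open>\<psi>\<close>. Strictness of \<open>Q < f\<close>, rather than
  strict monotonicity, then forces \<open>u \<le> \<psi>\<close>. Only integrals converge; no weak
  derivative of the limiting test function is ever formed. The comparison takes place in a ball
  where the gradient of \<open>\<psi>\<close> does not vanish, so that the flux of
  \<open>\<psi>\<close> is C^1 and integration by parts is classical. The data live on the
  concentric ball of twice the radius, so that averages of radius at most \<open>R\<close> around
  points of the small ball see only true values.\<close>

lemma smooth_fun_coinduct:
  fixes S :: "('a::euclidean_space \<Rightarrow> real) set"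
  assumes "\<phi> \<in> S"
    and step: "\<And>\<psi>. \<psi> \<in> S \<Longrightarrow> \<exists>P. (\<forall>i\<in>Basis. P i \<in> S) \<and>
      (\<forall>x. (\<psi> has_derivative (\<lambda>h. \<Sum>i\<in>Basis. (h \<bullet> i) * P i x)) (at x))"
  shows "smooth_fun \<phi>"
proof -
  have "\<exists>P. \<forall>\<psi>\<in>S. (\<forall>i\<in>Basis. P \<psi> i \<in> S) \<and>
      (\<forall>x. (\<psi> has_derivative (\<lambda>h. \<Sum>i\<in>Basis. (h \<bullet> i) * P \<psi> i x)) (at x))"
    by (intro bchoice ballI step)
  then obtain P where P: "\<And>\<psi> i. \<psi> \<in> S \<Longrightarrow> i \<in> Basis \<Longrightarrow> P \<psi> i \<in> S"
      "\<And>\<psi> x. \<psi> \<in> S \<Longrightarrow> (\<psi> has_derivative (\<lambda>h. \<Sum>i\<in>Basis. (h \<bullet> i) * P \<psi> i x)) (at x)"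
    by blast
  \<comment> \<open>\<open>P\<close> stays in \<open>S\<close> only for directions in
    \<open>Basis\<close>. Other list entries are skipped, which is harmless because the derivative
    sums over \<open>Basis\<close>.\<close>
  define D where "D vs = foldr (\<lambda>i \<psi>. if i \<in> Basis then P \<psi> i else \<psi>) vs \<phi>" for vs
  have D: "D vs \<in> S" for vs
    by (induction vs) (auto simp: D_def assms P)
  have "(D vs has_derivative (\<lambda>h. \<Sum>i\<in>Basis. (h \<bullet> i) * D (i # vs) x)) (at x)" for vs x
  proof -
    have "(\<lambda>h. \<Sum>i\<in>Basis. (h \<bullet> i) * D (i # vs) x) = (\<lambda>h. \<Sum>i\<in>Basis. (h \<bullet> i) * P (D vs) i x)"
      by (intro ext sum.cong) (auto simp: D_def)
    then show ?thesis using P(2)[OF D, of vs x] by simp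
  qed
  moreover have "D [] = \<phi>" by (simp add: D_def)
  ultimately show ?thesis unfolding smooth_fun_def by blast
qed

lemma power_le_fact_exp:
  fixes y :: real
  assumes "0 \<le> y"
  shows "y ^ m \<le> fact m * exp y"
proof -
  have s: "(\<lambda>n. y ^ n /\<^sub>R fact n) sums exp y" by (rule exp_converges)
  have "(\<Sum>n\<in>{m}. y ^ n /\<^sub>R fact n) \<le> suminf (\<lambda>n. y ^ n /\<^sub>R fact n)"
    by (rule sum_le_suminf) (use assms s in \<open>auto simp: sums_iff\<close>)
  then have "y ^ m / fact m \<le> exp y"
    using s by (simp add: sums_iff divide_inverse mult.commute)
  then show ?thesis by (simp add: field_simps)
qed

text \<open>For \<open>k = 0\<close> this is the classical flat function. The factors
  \<open>1 / t ^ k\<close> make the family closed under differentiation up to linear combinations,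
  so one first-order formula yields all derivatives.\<close>

definition flat_exp :: "real \<Rightarrow> nat \<Rightarrow> real \<Rightarrow> real" where
  "flat_exp s k t = (if t > 0 then exp (- s / t) / t ^ k else 0)"

lemma flat_exp_has_derivative:
  assumes "0 < s"
  shows "(flat_exp s k has_field_derivative
    (s * flat_exp s (k + 2) t - real k * flat_exp s (k + 1) t)) (at t)"
proof (cases t "0::real" rule: linorder_cases)
  case less
  have "(flat_exp s k has_field_derivative 0) (at t)"
  proof (rule DERIV_cong_ev[THEN iffD2, OF refl _ refl])
    show "\<forall>\<^sub>F x in nhds t. flat_exp s k x = 0"
      using eventually_nhds_in_open[of "{..<0}" t] less
      by (auto elim!: eventually_mono simp: flat_exp_def)
  qed auto
  then show ?thesis using less by (simp add: flat_exp_def)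
next
  case greater
  have "((\<lambda>t. exp (- s / t) / t ^ k) has_field_derivative
    (s * flat_exp s (k + 2) t - real k * flat_exp s (k + 1) t)) (at t)"
    using greater
    by (auto intro!: derivative_eq_intros simp: flat_exp_def divide_simps power2_eq_square)
       (cases k; simp add: algebra_simps power_add)+
  then show ?thesis
  proof (rule DERIV_cong_ev[THEN iffD2, OF refl _ refl, rotated])
    show "\<forall>\<^sub>F x in nhds t. flat_exp s k x = exp (- s / x) / x ^ k"
      using eventually_nhds_in_open[of "{0<..}" t] greater
      by (auto elim!: eventually_mono simp: flat_exp_def)
  qed
next
  case equal
  \<comment> \<open>From \<open>y ^ m \<le> fact m * exp y\<close> with \<open>y = s / t\<close> and
    \<open>m = k + 2\<close>: two powers beyond those cancelling \<open>t ^ k\<close>, so that the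
    difference quotient at 0 still tends to 0.\<close>
  define C where "C = fact (k + 2) / s ^ (k + 2)"
  have bound: "norm (flat_exp s k y) \<le> C * y\<^sup>2" for y
  proof (cases "y > 0")
    case True
    have "(s / y) ^ (k + 2) \<le> fact (k + 2) * exp (s / y)"
      using True assms by (intro power_le_fact_exp) auto
    then have "s ^ (k + 2) * exp (- s / y) \<le> fact (k + 2) * y ^ (k + 2)"
      using True by (simp add: exp_minus power_divide field_simps)
    then have "exp (- s / y) \<le> C * y ^ (k + 2)"
      using assms by (simp add: C_def field_simps)
    then have "exp (- s / y) \<le> C * y\<^sup>2 * y ^ k"
      by (simp add: power_add mult_ac power2_eq_square)
    then show ?thesis using True by (simp add: flat_exp_def divide_le_eq)
  next
    case False
    then show ?thesis using assms by (simp add: flat_exp_def C_def)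
  qed
  have "((\<lambda>y. flat_exp s k y / y) \<longlongrightarrow> 0) (at 0)"
  proof (rule Lim_null_comparison)
    show "\<forall>\<^sub>F y in at 0. norm (flat_exp s k y / y) \<le> C * \<bar>y\<bar>"
    proof (intro always_eventually allI)
      fix y :: real
      have "norm (flat_exp s k y / y) \<le> C * y\<^sup>2 / \<bar>y\<bar>"
        unfolding norm_divide using bound[of y] by (auto intro: divide_right_mono)
      then show "norm (flat_exp s k y / y) \<le> C * \<bar>y\<bar>"
        by (cases "y = 0") (auto simp: power2_eq_square field_simps abs_if split: if_splits)
    qed
    show "((\<lambda>y. C * \<bar>y\<bar>) \<longlongrightarrow> 0) (at 0)"
      by (auto intro!: tendsto_eq_intros)
  qed
  then have "(flat_exp s k has_field_derivative 0) (at 0)"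
    by (simp add: DERIV_def flat_exp_def)
  then show ?thesis using equal by (simp add: flat_exp_def)
qed

text \<open>Differentiating a bump produces bumps of higher index times coordinates, so the algebra
  generated by bumps, constants and coordinates is closed under partial derivatives, as
  \<open>smooth_fun_coinduct\<close> requires. Taking \<open>r\<^sup>2\<close> also as the scale in
  \<open>flat_exp\<close> makes the bump a function of \<open>x / r\<close> when
  \<open>k = 0\<close>.\<close>

inductive_set bump_algebra :: "real \<Rightarrow> ('a::euclidean_space \<Rightarrow> real) set" for r where
  bump: "(\<lambda>x. flat_exp (r\<^sup>2) k (r\<^sup>2 - x \<bullet> x)) \<in> bump_algebra r"
| const: "(\<lambda>x. c) \<in> bump_algebra r"
| coord: "(\<lambda>x. x \<bullet> i) \<in> bump_algebra r"
| add: "\<phi> \<in> bump_algebra r \<Longrightarrow> \<psi> \<in> bump_algebra r \<Longrightarrow> (\<lambda>x. \<phi> x + \<psi> x) \<in> bump_algebra r"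
| mult: "\<phi> \<in> bump_algebra r \<Longrightarrow> \<psi> \<in> bump_algebra r \<Longrightarrow> (\<lambda>x. \<phi> x * \<psi> x) \<in> bump_algebra r"

lemma bump_algebra_smooth:
  fixes \<phi> :: "'a::euclidean_space \<Rightarrow> real"
  assumes "\<phi> \<in> bump_algebra r" and r: "r > 0"
  shows "smooth_fun \<phi>"
  using assms(1)
proof (rule smooth_fun_coinduct)
  fix \<psi> :: "'a \<Rightarrow> real"
  assume "\<psi> \<in> bump_algebra r"
  then show "\<exists>P. (\<forall>i\<in>Basis. P i \<in> bump_algebra r) \<and>
      (\<forall>x. (\<psi> has_derivative (\<lambda>h. \<Sum>i\<in>Basis. (h \<bullet> i) * P i x)) (at x))"
  proof induction
    case (bump k)
    define E where "E = (\<lambda>k (x::'a). flat_exp (r\<^sup>2) k (r\<^sup>2 - x \<bullet> x))"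
    define P where "P = (\<lambda>i x. (r\<^sup>2 * E (k + 2) x + (- real k) * E (k + 1) x) * ((-2) * (x \<bullet> i)))"
    have "P i \<in> bump_algebra r" for i
      unfolding P_def E_def by (intro bump_algebra.intros)
    moreover have "((\<lambda>x. flat_exp (r\<^sup>2) k (r\<^sup>2 - x \<bullet> x)) has_derivative
        (\<lambda>h. \<Sum>i\<in>Basis. (h \<bullet> i) * P i x)) (at x)" for x
    proof -
      have 1: "(flat_exp (r\<^sup>2) k has_derivative (*) (r\<^sup>2 * E (k + 2) x + (- real k) * E (k + 1) x))
          (at (r\<^sup>2 - x \<bullet> x))"
        using flat_exp_has_derivative[of "r\<^sup>2" k "r\<^sup>2 - x \<bullet> x"] r
        by (simp add: has_field_derivative_def E_def)
      have 2: "((\<lambda>x. r\<^sup>2 - x \<bullet> x) has_derivative (\<lambda>h. - 2 * (x \<bullet> h))) (at x)"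
        by (auto intro!: derivative_eq_intros simp: inner_commute)
      have 3: "(\<Sum>i\<in>Basis. (h \<bullet> i) * P i x) = (r\<^sup>2 * E (k + 2) x + (- real k) * E (k + 1) x) * (- 2 * (x \<bullet> h))" for h
        unfolding P_def euclidean_inner[of x h] sum_distrib_left
        by (intro sum.cong refl) (simp add: algebra_simps)
      show ?thesis unfolding 3 using has_derivative_compose[OF 2 1] by simp
    qed
    ultimately show ?case by blast
  next
    case (const c)
    show ?case by (intro exI[of _ "\<lambda>i x. 0"]) (auto intro: bump_algebra.intros)
  next
    case (coord j)
    have "((\<lambda>x::'a. x \<bullet> j) has_derivative (\<lambda>h. \<Sum>i\<in>Basis. (h \<bullet> i) * (j \<bullet> i))) (at x)" for x
      unfolding euclidean_inner[of _ j, symmetric] by (auto intro!: derivative_eq_intros)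
    then show ?case by (intro exI[of _ "\<lambda>i x. j \<bullet> i"]) (auto intro: bump_algebra.intros)
  next
    case (add \<phi> \<psi>)
    then obtain P Q where "(\<forall>i\<in>Basis. P i \<in> bump_algebra r) \<and>
      (\<forall>x. (\<phi> has_derivative (\<lambda>h. \<Sum>i\<in>Basis. (h \<bullet> i) * P i x)) (at x))"
      "(\<forall>i\<in>Basis. Q i \<in> bump_algebra r) \<and>
      (\<forall>x. (\<psi> has_derivative (\<lambda>h. \<Sum>i\<in>Basis. (h \<bullet> i) * Q i x)) (at x))"
      by blast
    then show ?case
      by (intro exI[of _ "\<lambda>i x. P i x + Q i x"])
         (auto intro!: bump_algebra.add has_derivative_add simp: distrib_left sum.distrib)
  next
    case (mult \<phi> \<psi>)
    then obtain P Q where PQ: "(\<forall>i\<in>Basis. P i \<in> bump_algebra r) \<and>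
      (\<forall>x. (\<phi> has_derivative (\<lambda>h. \<Sum>i\<in>Basis. (h \<bullet> i) * P i x)) (at x))"
      "(\<forall>i\<in>Basis. Q i \<in> bump_algebra r) \<and>
      (\<forall>x. (\<psi> has_derivative (\<lambda>h. \<Sum>i\<in>Basis. (h \<bullet> i) * Q i x)) (at x))"
      by blast
    have "((\<lambda>x. \<phi> x * \<psi> x) has_derivative (\<lambda>h. \<Sum>i\<in>Basis. (h \<bullet> i) * (\<phi> x * Q i x + P i x * \<psi> x))) (at x)" for x
    proof -
      have "(\<lambda>h. \<Sum>i\<in>Basis. (h \<bullet> i) * (\<phi> x * Q i x + P i x * \<psi> x)) =
          (\<lambda>h. \<phi> x * (\<Sum>i\<in>Basis. (h \<bullet> i) * Q i x) + (\<Sum>i\<in>Basis. (h \<bullet> i) * P i x) * \<psi> x)"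
        unfolding sum_distrib_left sum_distrib_right sum.distrib[symmetric]
        by (intro ext sum.cong refl) (simp add: algebra_simps)
      moreover have "(\<phi> has_derivative (\<lambda>h. \<Sum>i\<in>Basis. (h \<bullet> i) * P i x)) (at x)"
        "(\<psi> has_derivative (\<lambda>h. \<Sum>i\<in>Basis. (h \<bullet> i) * Q i x)) (at x)"
        using PQ by auto
      ultimately show ?thesis using has_derivative_mult by (simp only:)
    qed
    then show ?case using PQ mult.hyps
      by (intro exI[of _ "\<lambda>i x. \<phi> x * Q i x + P i x * \<psi> x"])
         (auto intro!: bump_algebra.add bump_algebra.mult)
  qed
qed

lemma smooth_fun_shift:
  assumes "smooth_fun \<phi>"
  shows "smooth_fun (\<lambda>y. \<phi> (y - x))"
proof -
  obtain D where D: "D [] = \<phi>"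
    "\<And>vs x. (D vs has_derivative (\<lambda>h. \<Sum>i\<in>Basis. (h \<bullet> i) * D (i # vs) x)) (at x)"
    using assms unfolding smooth_fun_def by blast
  have "((\<lambda>y. D vs (y - x)) has_derivative (\<lambda>h. \<Sum>i\<in>Basis. (h \<bullet> i) * D (i # vs) (y - x))) (at y)" for vs y
    by (rule has_derivative_compose[OF _ D(2), of "\<lambda>y. y - x", simplified])
       (auto intro!: derivative_eq_intros)
  then show ?thesis unfolding smooth_fun_def
    by (intro exI[of _ "\<lambda>vs y. D vs (y - x)"]) (auto simp: D)
qed

lemma smooth_fun_gradient:
  assumes "smooth_fun \<phi>"
  obtains N where "\<And>x. (\<phi> has_derivative (\<lambda>h. N x \<bullet> h)) (at x)" "continuous_on UNIV N"
proof -
  obtain D where D: "D [] = \<phi>"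
    "\<And>vs x. (D vs has_derivative (\<lambda>h. \<Sum>i\<in>Basis. (h \<bullet> i) * D (i # vs) x)) (at x)"
    using assms unfolding smooth_fun_def by blast
  have cont: "continuous_on UNIV (D vs)" for vs
    using D(2) by (auto simp: continuous_on_eq_continuous_at intro: has_derivative_continuous)
  show thesis
  proof
    show "(\<phi> has_derivative (\<lambda>h. (\<Sum>i\<in>Basis. D [i] x *\<^sub>R i) \<bullet> h)) (at x)" for x
    proof -
      have "(\<Sum>i\<in>Basis. D [i] x *\<^sub>R i) \<bullet> h = (\<Sum>i\<in>Basis. (h \<bullet> i) * D [i] x)" for h
        unfolding inner_sum_left by (intro sum.cong refl) (simp add: inner_commute)
      then show ?thesis using D(2)[of "[]" x] by (simp add: D(1))
    qed
    show "continuous_on UNIV (\<lambda>x. \<Sum>i\<in>Basis. D [i] x *\<^sub>R i)"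
      by (intro continuous_intros cont)
  qed
qed

text \<open>Strictly outside the ball \<open>\<phi>\<close> is locally zero. Points of the sphere
  are limits along the outward ray, where continuity of \<open>N\<close> helps. The ray degenerates
  only at \<open>x = a\<close>, but then \<open>r \<le> 0\<close> and \<open>\<phi>\<close> vanishes
  identically.\<close>

lemma gradient_zero_outside:
  fixes \<phi> :: "'a::euclidean_space \<Rightarrow> real"
  assumes "\<And>x. (\<phi> has_derivative (\<lambda>h. N x \<bullet> h)) (at x)" "continuous_on UNIV N"
    and "\<And>x. r \<le> norm (x - a) \<Longrightarrow> \<phi> x = 0" and x: "r \<le> norm (x - a)"
  shows "N x = 0"
proof -
  have out: "N y = 0" if "r < norm (y - a)" for y
  proof -
    have "open {z. r < norm (z - a)}"
      by (intro open_Collect_less continuous_intros)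
    then have "((\<lambda>_. 0) has_derivative (\<lambda>h. N y \<bullet> h)) (at y)"
      using has_derivative_transform_within_open[OF assms(1)[of y], of "{z. r < norm (z - a)}" "\<lambda>_. 0"]
        that assms(3) by simp
    then have "(\<lambda>h. N y \<bullet> h) = (\<lambda>h. 0)"
      by (rule has_derivative_unique[OF _ has_derivative_const])
    then show ?thesis by (metis inner_eq_zero_iff)
  qed
  show ?thesis
  proof (cases "x = a")
    case True
    have "r \<le> 0" using x True by simp
    then have "\<phi> = (\<lambda>_. 0)" using assms(3) order_trans[OF _ norm_ge_zero] by blast
    then have "((\<lambda>_. 0) has_derivative (\<lambda>h. N x \<bullet> h)) (at x)" using assms(1)[of x] by simp
    then have "(\<lambda>h. N x \<bullet> h) = (\<lambda>h. 0)"
      by (rule has_derivative_unique[OF _ has_derivative_const])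
    then show ?thesis by (metis inner_eq_zero_iff)
  next
    case False
    have lim: "(\<lambda>n. x + (1 / real (Suc n)) *\<^sub>R (x - a)) \<longlonglongrightarrow> x + 0 *\<^sub>R (x - a)"
      by (intro tendsto_intros lim_1_over_n[THEN LIMSEQ_Suc])
    have "(\<lambda>n. N (x + (1 / real (Suc n)) *\<^sub>R (x - a))) \<longlonglongrightarrow> N (x + 0 *\<^sub>R (x - a))"
      using assms(2) lim by (intro continuous_on_tendsto_compose[OF assms(2)]) auto
    moreover have "N (x + (1 / real (Suc n)) *\<^sub>R (x - a)) = 0" for n
    proof (rule out)
      have eq: "x + (1 / real (Suc n)) *\<^sub>R (x - a) - a = (1 + 1 / real (Suc n)) *\<^sub>R (x - a)"
        by (simp add: algebra_simps)
      have "norm (x - a) < (1 + 1 / real (Suc n)) * norm (x - a)"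
        using False by (simp add: algebra_simps)
      also have "\<dots> = norm (x + (1 / real (Suc n)) *\<^sub>R (x - a) - a)"
        unfolding eq norm_scaleR by simp
      finally show "r < norm (x + (1 / real (Suc n)) *\<^sub>R (x - a) - a)" using x by linarith
    qed
    ultimately show ?thesis by (simp add: LIMSEQ_const_iff)
  qed
qed

text \<open>Evenness is included so that the kernel \<open>\<eta> (x - y)\<close> is the translate
  \<open>\<eta> (y - x)\<close>, which can serve as a test function in \<open>y\<close>.\<close>

definition mollifier :: "('a::euclidean_space \<Rightarrow> real) \<Rightarrow> real \<Rightarrow> bool" where
  "mollifier \<eta> r \<longleftrightarrow> 0 < r \<and> smooth_fun \<eta> \<and> (\<forall>x. 0 \<le> \<eta> x) \<and> (\<forall>x. r \<le> norm x \<longrightarrow> \<eta> x = 0) \<and>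
     (\<forall>x. \<eta> (- x) = \<eta> x) \<and> (\<integral>x. \<eta> x \<partial>lborel) = 1"

lemma continuous_compact_support_integrable:
  fixes w :: "'a::euclidean_space \<Rightarrow> 'b::euclidean_space"
  assumes "continuous_on UNIV w" "\<And>x. x \<notin> cball a r \<Longrightarrow> w x = 0"
  shows "integrable lborel w"
proof -
  have "(\<lambda>x. indicator (cball a r) x *\<^sub>R w x) = w"
    using assms(2) by (auto simp: indicator_def fun_eq_iff)
  then show ?thesis
    using borel_integrable_compact[of "cball a r" w] assms(1)
    by (auto simp: continuous_on_subset)
qed

text \<open>The unnormalised bump is at most 1, and at least \<open>exp (-2)\<close> on the ball of
  half the radius, whose volume scales like \<open>r ^ DIM('a)\<close>. Hence the normalising factor
  is controlled by one constant for all radii, which the variable exponent estimate needs.\<close>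

lemma mollifier_exists:
  "\<exists>C>0. \<forall>r>0. \<exists>\<eta>. mollifier (\<eta> :: 'a::euclidean_space \<Rightarrow> real) r \<and> (\<forall>x. \<eta> x \<le> C / r ^ DIM('a))"
proof -
  define C where "C = exp 2 * 2 ^ DIM('a) / unit_ball_vol (real DIM('a))"
  have vol: "unit_ball_vol (real DIM('a)) > 0" by simp
  have "\<exists>\<eta>. mollifier (\<eta> :: 'a \<Rightarrow> real) r \<and> (\<forall>x. \<eta> x \<le> C / r ^ DIM('a))" if r: "r > 0" for r
  proof -
    define E where "E = (\<lambda>x::'a. flat_exp (r\<^sup>2) 0 (r\<^sup>2 - x \<bullet> x))"
    have E: "smooth_fun E"
      unfolding E_def by (rule bump_algebra_smooth[OF bump_algebra.bump r])
    have E_nonneg: "E x \<ge> 0" and E_le: "E x \<le> 1" for x by (auto simp: E_def flat_exp_def)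
    have E_zero: "E x = 0" if "r \<le> norm x" for x
    proof -
      have "r\<^sup>2 \<le> (norm x)\<^sup>2" using that r by (intro power_mono) auto
      then show ?thesis by (simp add: E_def flat_exp_def power2_norm_eq_inner)
    qed
    have E_cont: "continuous_on UNIV E"
      using smooth_fun_gradient[OF E]
      by (metis continuous_at_imp_continuous_on has_derivative_continuous)
    have E_int: "integrable lborel E"
      by (rule continuous_compact_support_integrable[OF E_cont, of 0 r]) (auto intro!: E_zero)
    define c where "c = (\<integral>x. E x \<partial>lborel)"
    have "exp (-2) * measure lborel (ball (0::'a) (r/2)) = (\<integral>x. exp (-2) * indicator (ball (0::'a) (r/2)) x \<partial>lborel)"
      by simp
    also have "\<dots> \<le> c"
    proof -
      have ind: "integrable lborel (indicator (ball (0::'a) (r/2)) :: 'a \<Rightarrow> real)"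
        using emeasure_lborel_ball_finite[of "0::'a" "r/2"] by (intro integrable_real_indicator) auto
      have le: "exp (- 2) * indicator (ball 0 (r / 2)) x \<le> E x" for x :: 'a
      proof (cases "x \<in> ball 0 (r/2)")
        case True
        then have "norm x \<le> r / 2" by simp
        then have "(norm x)\<^sup>2 \<le> (r/2)\<^sup>2" by (rule power_mono) simp
        then have le: "x \<bullet> x \<le> r\<^sup>2 / 4" by (simp add: power2_norm_eq_inner power_divide)
        have r2: "r\<^sup>2 > 0" using r by simp
        have pos: "r\<^sup>2 - x \<bullet> x > 0" using le r2 by linarith
        have "b \<le> a / 4 \<Longrightarrow> 0 < a \<Longrightarrow> a \<le> 2 * (a - b)" for a b :: real by (simp add: field_simps)
        from this[OF le r2] have "r\<^sup>2 \<le> 2 * (r\<^sup>2 - x \<bullet> x)" .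
        then have "r\<^sup>2 / (r\<^sup>2 - x \<bullet> x) \<le> 2" using pos by (simp add: divide_le_eq)
        then show ?thesis using True pos by (simp add: E_def flat_exp_def)
      next
        case False
        then show ?thesis using E_nonneg[of x] by simp
      qed
      show ?thesis unfolding c_def
        by (rule integral_mono[OF integrable_mult_right[OF ind] E_int le])
    qed
    finally have c_ge: "exp (-2) * (unit_ball_vol (real DIM('a)) * (r/2) ^ DIM('a)) \<le> c"
      using r by (simp add: content_ball)
    have m_pos: "0 < exp (-2) * (unit_ball_vol (real DIM('a)) * (r/2) ^ DIM('a))"
      using r vol by simp
    then have c_pos: "c > 0" using c_ge by linarith
    have c_inv: "1 / c \<le> C / r ^ DIM('a)"
    proof -
      have "1 / c \<le> 1 / (exp (-2) * (unit_ball_vol (real DIM('a)) * (r/2) ^ DIM('a)))"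
        using divide_left_mono[OF c_ge, of 1] mult_pos_pos[OF c_pos m_pos] by simp
      also have "\<dots> = C / r ^ DIM('a)"
      proof -
        have "1 / (inverse e * (v * (a / t))) = e * t / v / a" for e v a t :: real
          by (simp add: divide_inverse mult_ac)
        then show ?thesis unfolding C_def exp_minus power_divide .
      qed
      finally show ?thesis .
    qed
    have "mollifier (\<lambda>x. (1 / c) * E x) r"
      unfolding mollifier_def
    proof (intro conjI allI impI)
      show "smooth_fun (\<lambda>x. (1 / c) * E x)"
        unfolding E_def
        by (rule bump_algebra_smooth[OF bump_algebra.mult[OF bump_algebra.const bump_algebra.bump] r])
      show "(\<integral>x. 1 / c * E x \<partial>lborel) = 1"
        using c_pos by (subst integral_mult_right_zero) (simp add: c_def[symmetric])
    qed (use r c_pos E_nonneg E_zero in \<open>auto simp: E_def\<close>)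
    moreover have "(1 / c) * E x \<le> C / r ^ DIM('a)" for x
      using mult_left_mono[OF E_le[of x], of "1 / c"] c_pos c_inv by auto
    ultimately show ?thesis by blast
  qed
  moreover have "C > 0" using vol by (simp add: C_def)
  ultimately show ?thesis by blast
qed

section \<open>Convolution\<close>

lemma smooth_fun_partials:
  assumes "smooth_fun \<phi>"
  obtains P where "\<And>i. smooth_fun (P i)"
    "\<And>x. (\<phi> has_derivative (\<lambda>h. \<Sum>i\<in>Basis. (h \<bullet> i) * P i x)) (at x)"
proof -
  obtain D where D: "D [] = \<phi>"
    "\<And>vs x. (D vs has_derivative (\<lambda>h. \<Sum>i\<in>Basis. (h \<bullet> i) * D (i # vs) x)) (at x)"
    using assms unfolding smooth_fun_def by blast
  show thesis
  proof
    \<comment> \<open>The newest direction stands at the front of the list, so the derivatives of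
      \<open>D [i]\<close> are found by appending \<open>i\<close> at the end.\<close>
    show "smooth_fun (D [i])" for i
      unfolding smooth_fun_def using D(2)[of "_ @ [i]"]
      by (intro exI[of _ "\<lambda>vs. D (vs @ [i])"]) auto
    show "(\<phi> has_derivative (\<lambda>h. \<Sum>i\<in>Basis. (h \<bullet> i) * D [i] x)) (at x)" for x
      using D(2)[of "[]" x] by (simp add: D(1))
  qed
qed

lemma smooth_fun_continuous:
  assumes "smooth_fun \<phi>"
  shows "continuous_on UNIV \<phi>"
  using smooth_fun_gradient[OF assms]
  by (metis continuous_at_imp_continuous_on has_derivative_continuous)

lemma inner_sum_scaleR_eq: "(\<Sum>i\<in>Basis. c i *\<^sub>R i) \<bullet> h = (\<Sum>i\<in>Basis. (h \<bullet> i) * c i)"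
  for h :: "'a::euclidean_space"
  unfolding inner_sum_left by (intro sum.cong refl) (simp add: inner_commute)

lemma lborel_distr_reflect: "distr lborel borel (\<lambda>y. x - y) = (lborel :: 'a::euclidean_space measure)"
  using lborel_affine[of "-1" x] by (simp add: density_1)

lemma lborel_integral_reflect:
  fixes F :: "'a::euclidean_space \<Rightarrow> 'b::{banach,second_countable_topology}"
  assumes "F \<in> borel_measurable borel"
  shows "(\<integral>y. F (x - y) \<partial>lborel) = (\<integral>y. F y \<partial>lborel)"
proof -
  have "(\<integral>y. F y \<partial>lborel) = (\<integral>y. F y \<partial>distr lborel borel (\<lambda>y. x - y))"
    by (simp add: lborel_distr_reflect)
  also have "\<dots> = (\<integral>y. F (x - y) \<partial>lborel)"
    using assms by (intro integral_distr) auto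
  finally show ?thesis by simp
qed

lemma lborel_integral_translate:
  fixes F :: "'a::euclidean_space \<Rightarrow> 'b::{banach,second_countable_topology}"
  assumes "F \<in> borel_measurable borel"
  shows "(\<integral>x. F (x - y) \<partial>lborel) = (\<integral>x. F x \<partial>lborel)"
proof -
  have "(\<integral>x. F x \<partial>lborel) = (\<integral>x. F x \<partial>distr lborel borel ((+) (- y)))"
    by (simp add: lborel_distr_plus)
  also have "\<dots> = (\<integral>x. F (x - y) \<partial>lborel)"
    using assms by (subst integral_distr) auto
  finally show ?thesis by simp
qed

definition conv :: "('a::euclidean_space \<Rightarrow> real) \<Rightarrow> ('a \<Rightarrow> 'b::euclidean_space) \<Rightarrow> 'a \<Rightarrow> 'b" where
  "conv \<eta> k x = (\<integral>y. \<eta> (x - y) *\<^sub>R k y \<partial>lborel)"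

lemma compact_support_bounded:
  fixes F :: "'a::euclidean_space \<Rightarrow> 'b::euclidean_space"
  assumes "continuous_on UNIV F" "\<And>x. r \<le> norm (x - a) \<Longrightarrow> F x = 0"
  obtains B where "0 < B" "\<And>x. norm (F x) \<le> B"
proof -
  have "compact (F ` cball a r)"
    by (intro compact_continuous_image continuous_on_subset[OF assms(1)]) auto
  then obtain B where B: "B > 0" "\<And>x. x \<in> cball a r \<Longrightarrow> norm (F x) \<le> B"
    by (auto simp: bounded_pos dest!: compact_imp_bounded)
  show thesis
  proof
    show "norm (F x) \<le> B" for x
      using B(1) B(2)[of x] assms(2)[of x] by (cases "r \<le> norm (x - a)") (auto simp: dist_norm norm_minus_commute)
  qed fact
qed

lemma compact_support_uniformly_continuous:
  fixes F :: "'a::euclidean_space \<Rightarrow> 'b::euclidean_space"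
  assumes "continuous_on UNIV F" "\<And>x. r \<le> norm (x - a) \<Longrightarrow> F x = 0" "0 < e"
  obtains d where "0 < d" "\<And>x y. norm (x - y) < d \<Longrightarrow> norm (F x - F y) < e"
proof -
  \<comment> \<open>With the margin 1, two points at distance below 1 either both lie in the larger
    ball or both lie where \<open>F\<close> vanishes.\<close>
  have "uniformly_continuous_on (cball a (r + 1)) F"
    by (intro compact_uniformly_continuous continuous_on_subset[OF assms(1)]) auto
  then obtain d where d: "d > 0"
    "\<And>x y. x \<in> cball a (r + 1) \<Longrightarrow> y \<in> cball a (r + 1) \<Longrightarrow> dist y x < d \<Longrightarrow> dist (F y) (F x) < e"
    unfolding uniformly_continuous_on_def using assms(3) by metis
  show thesis
  proof
    show "0 < min d 1" using d by simp
    fix x y :: 'a assume xy: "norm (x - y) < min d 1"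
    show "norm (F x - F y) < e"
    proof (cases "norm (x - a) \<le> r + 1 \<and> norm (y - a) \<le> r + 1")
      case True
      then show ?thesis using d(2)[of y x] xy by (simp add: dist_norm norm_minus_commute)
    next
      case False
      have "norm (x - a) \<le> norm (x - y) + norm (y - a)" "norm (y - a) \<le> norm (x - y) + norm (x - a)"
        using norm_triangle_ineq[of "x - y" "y - a"] norm_triangle_ineq[of "y - x" "x - a"]
        by (auto simp: norm_minus_commute)
      then have "r \<le> norm (x - a)" "r \<le> norm (y - a)" using False xy by linarith+
      then show ?thesis using assms(2)[of x] assms(2)[of y] assms(3) by simp
    qed
  qed
qed

lemma integrable_scaleR_bounded:
  fixes F :: "'a::euclidean_space \<Rightarrow> 'b::euclidean_space"
  assumes "integrable lborel k" "F \<in> borel_measurable borel" "\<And>x. norm (F x) \<le> B"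
  shows "integrable lborel (\<lambda>y. k y *\<^sub>R F (x - y))"
proof (rule Bochner_Integration.integrable_bound)
  show "integrable lborel (\<lambda>y. B * norm (k y))" using assms(1) by simp
  have [measurable]: "k \<in> borel_measurable borel" "F \<in> borel_measurable borel"
    using assms by (auto dest: borel_measurable_integrable)
  show "(\<lambda>y. k y *\<^sub>R F (x - y)) \<in> borel_measurable lborel" by measurable
  have "0 \<le> B" using assms(3)[of 0] norm_ge_zero order_trans by blast
  then show "AE y in lborel. norm (k y *\<^sub>R F (x - y)) \<le> norm (B * norm (k y))"
    using mult_left_mono[OF assms(3) abs_ge_zero]
    by (intro always_eventually allI) (simp add: abs_mult mult.commute[of B])
qed

lemma integrable_bounded_scaleR:
  fixes k :: "'a::euclidean_space \<Rightarrow> 'b::euclidean_space"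
  assumes "integrable lborel k" "F \<in> borel_measurable borel" "\<And>x. \<bar>F x\<bar> \<le> B"
  shows "integrable lborel (\<lambda>y. F (x - y) *\<^sub>R k y)"
proof (rule Bochner_Integration.integrable_bound)
  show "integrable lborel (\<lambda>y. B * norm (k y))" using assms(1) by simp
  have [measurable]: "k \<in> borel_measurable borel" "F \<in> borel_measurable borel"
    using assms by (auto dest: borel_measurable_integrable)
  show "(\<lambda>y. F (x - y) *\<^sub>R k y) \<in> borel_measurable lborel" by measurable
  have "0 \<le> B" using assms(3)[of 0] abs_ge_zero order_trans by blast
  then show "AE y in lborel. norm (F (x - y) *\<^sub>R k y) \<le> norm (B * norm (k y))"
    using assms(3) by (intro always_eventually allI) (simp add: abs_mult mult_right_mono)
qed

lemma continuous_integral_translate: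
  fixes F :: "'a::euclidean_space \<Rightarrow> 'b::euclidean_space"
  assumes k: "integrable lborel k" and F: "continuous_on UNIV F" "\<And>x. r \<le> norm (x - a) \<Longrightarrow> F x = 0"
  shows "continuous_on UNIV (\<lambda>x. \<integral>y. k y *\<^sub>R F (x - y) \<partial>lborel)"
  unfolding continuous_on_iff
proof (intro ballI allI impI)
  fix x :: 'a and e :: real assume e: "0 < e"
  obtain B where B: "0 < B" "\<And>x. norm (F x) \<le> B" using compact_support_bounded[OF F] by blast
  have F_meas: "F \<in> borel_measurable borel" using F(1) by (rule borel_measurable_continuous_onI)
  note int = integrable_scaleR_bounded[OF k F_meas B(2)]
  \<comment> \<open>The summand 1 keeps \<open>J\<close> positive even if \<open>k\<close> vanishes
    almost everywhere.\<close>
  define J where "J = (\<integral>y. norm (k y) \<partial>lborel) + 1"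
  have J: "J > 0" unfolding J_def by (intro add_nonneg_pos integral_nonneg_AE) auto
  obtain d where d: "0 < d" "\<And>x y. norm (x - y) < d \<Longrightarrow> norm (F x - F y) < e / J"
    using compact_support_uniformly_continuous[OF F, where e = "e / J"] e J by (metis divide_pos_pos)
  have "dist (\<integral>y. k y *\<^sub>R F (z - y) \<partial>lborel) (\<integral>y. k y *\<^sub>R F (x - y) \<partial>lborel) < e" if "dist z x < d" for z
  proof -
    have "norm ((\<integral>y. k y *\<^sub>R F (z - y) \<partial>lborel) - (\<integral>y. k y *\<^sub>R F (x - y) \<partial>lborel)) =
        norm (\<integral>y. k y *\<^sub>R F (z - y) - k y *\<^sub>R F (x - y) \<partial>lborel)"
      by (subst Bochner_Integration.integral_diff[OF int int]) simp
    also have "\<dots> \<le> (\<integral>y. e / J * norm (k y) \<partial>lborel)"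
    proof (rule Bochner_Integration.integral_norm_bound_integral)
      show "integrable lborel (\<lambda>y. k y *\<^sub>R F (z - y) - k y *\<^sub>R F (x - y))"
        using int by auto
      fix y
      have "norm (F (z - y) - F (x - y)) \<le> e / J"
        using d(2)[of "z - y" "x - y"] that by (simp add: dist_norm)
      then show "norm (k y *\<^sub>R F (z - y) - k y *\<^sub>R F (x - y)) \<le> e / J * norm (k y)"
        unfolding scaleR_diff_right[symmetric] norm_scaleR real_norm_def
        by (subst mult.commute) (intro mult_right_mono, auto)
    qed (use k in auto)
    also have "\<dots> = e / J * (J - 1)" by (simp add: J_def)
    also have "\<dots> < e" using e J by (simp add: field_simps)
    finally show ?thesis by (simp add: dist_norm)
  qed
  then show "\<exists>d>0. \<forall>z\<in>UNIV. dist z x < d \<longrightarrow>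
      dist (\<integral>y. k y *\<^sub>R F (z - y) \<partial>lborel) (\<integral>y. k y *\<^sub>R F (x - y) \<partial>lborel) < e"
    using d(1) by blast
qed

lemma gradient_linearization_bound:
  fixes \<theta> :: "'a::euclidean_space \<Rightarrow> real"
  assumes "\<And>x. (\<theta> has_derivative (\<lambda>h. \<Theta> x \<bullet> h)) (at x)"
    and "\<And>x y. norm (x - y) < d \<Longrightarrow> norm (\<Theta> x - \<Theta> y) \<le> e" and "norm h < d" and "0 \<le> e"
  shows "\<bar>\<theta> (z + h) - \<theta> z - \<Theta> z \<bullet> h\<bar> \<le> e * norm h"
proof -
  have "norm (\<theta> (z + h) - \<theta> z - (\<lambda>h. \<Theta> z \<bullet> h) (z + h - z)) \<le> norm (z + h - z) * e"
  proof (rule differentiable_bound_linearization[where S = "ball z d" and f' = "\<lambda>x h. \<Theta> x \<bullet> h"])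
    fix t :: real assume t: "t \<in> {0..1}"
    have "norm (t *\<^sub>R h) \<le> norm h" using t by (auto intro!: mult_left_le_one_le)
    then show "z + t *\<^sub>R (z + h - z) \<in> ball z d" using assms(3) by (simp add: dist_norm)
  next
    fix x assume x: "x \<in> ball z d"
    show "(\<theta> has_derivative (\<lambda>h. \<Theta> x \<bullet> h)) (at x within ball z d)"
      using assms(1) has_derivative_at_withinI by blast
    have "norm (\<Theta> x - \<Theta> z) \<le> e" using x by (intro assms(2)) (simp add: dist_norm norm_minus_commute)
    then show "onorm ((\<lambda>h. \<Theta> x \<bullet> h) - (\<lambda>h. \<Theta> z \<bullet> h)) \<le> e"
      by (intro onorm_le)
         (auto simp: inner_diff_left[symmetric] intro!: order_trans[OF Cauchy_Schwarz_ineq2] mult_right_mono)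
  next
    show "z \<in> ball z d" using assms(3) norm_ge_zero[of h] by (simp del: norm_ge_zero)
  qed
  then show ?thesis by (simp add: mult.commute)
qed

text \<open>Uniform continuity of \<open>\<Theta>\<close> makes the first-order error of
  \<open>\<theta>\<close> small uniformly in the base point, so it can be integrated against a
  merely integrable \<open>k\<close>.\<close>

lemma integral_translate_has_gradient:
  fixes \<theta> :: "'a::euclidean_space \<Rightarrow> real"
  assumes \<theta>: "\<And>x. (\<theta> has_derivative (\<lambda>h. \<Theta> x \<bullet> h)) (at x)" "continuous_on UNIV \<Theta>"
      "\<And>x. r \<le> norm (x - a) \<Longrightarrow> \<theta> x = 0"
    and k: "integrable lborel k"
  shows "((\<lambda>x. \<integral>y. k y * \<theta> (x - y) \<partial>lborel) has_derivative
    (\<lambda>h. (\<integral>y. k y *\<^sub>R \<Theta> (x - y) \<partial>lborel) \<bullet> h)) (at x)"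
  unfolding has_derivative_at_alt
proof (intro conjI allI impI bounded_linear_inner_right)
  fix e :: real assume e: "0 < e"
  have \<Theta>0: "\<Theta> x = 0" if "r \<le> norm (x - a)" for x
    using gradient_zero_outside[OF \<theta>] that by blast
  have \<theta>c: "continuous_on UNIV \<theta>"
    using \<theta>(1) by (auto simp: continuous_on_eq_continuous_at intro: has_derivative_continuous)
  obtain B where B: "\<And>x. norm (\<theta> x) \<le> B" using compact_support_bounded[OF \<theta>c \<theta>(3)] by blast
  obtain B' where B': "\<And>x. norm (\<Theta> x) \<le> B'" using compact_support_bounded[OF \<theta>(2) \<Theta>0] by blast
  have int: "integrable lborel (\<lambda>y. k y * \<theta> (z - y))" for z
    using integrable_scaleR_bounded[OF k borel_measurable_continuous_onI[OF \<theta>c] B] by simp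
  have int': "integrable lborel (\<lambda>y. k y *\<^sub>R \<Theta> (z - y))" for z
    using integrable_scaleR_bounded[OF k borel_measurable_continuous_onI[OF \<theta>(2)] B'] .
  define J where "J = (\<integral>y. norm (k y) \<partial>lborel) + 1"
  have J: "J > 0" unfolding J_def by (intro add_nonneg_pos integral_nonneg_AE) auto
  obtain d where d: "0 < d" "\<And>x y. norm (x - y) < d \<Longrightarrow> norm (\<Theta> x - \<Theta> y) < e / J"
    using compact_support_uniformly_continuous[OF \<theta>(2) \<Theta>0, where e = "e / J"] e J by (metis divide_pos_pos)
  have "norm ((\<integral>y. k y * \<theta> (z - y) \<partial>lborel) - (\<integral>y. k y * \<theta> (x - y) \<partial>lborel) -
      (\<integral>y. k y *\<^sub>R \<Theta> (x - y) \<partial>lborel) \<bullet> (z - x)) \<le> e * norm (z - x)" if z: "norm (z - x) < d" for z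
  proof -
    have "(\<integral>y. k y * \<theta> (z - y) \<partial>lborel) - (\<integral>y. k y * \<theta> (x - y) \<partial>lborel) -
      (\<integral>y. k y *\<^sub>R \<Theta> (x - y) \<partial>lborel) \<bullet> (z - x) =
      (\<integral>y. k y * \<theta> (z - y) - k y * \<theta> (x - y) - (k y *\<^sub>R \<Theta> (x - y)) \<bullet> (z - x) \<partial>lborel)"
      by (subst integral_inner_left[OF int', symmetric], subst Bochner_Integration.integral_diff[OF int int, symmetric],
          rule Bochner_Integration.integral_diff[symmetric])
         (intro Bochner_Integration.integrable_diff int integrable_inner_left int')+
    also have "norm \<dots> \<le> (\<integral>y. (e / J * norm (z - x)) * norm (k y) \<partial>lborel)"
    proof (rule Bochner_Integration.integral_norm_bound_integral)
      show "integrable lborel (\<lambda>y. k y * \<theta> (z - y) - k y * \<theta> (x - y) - (k y *\<^sub>R \<Theta> (x - y)) \<bullet> (z - x))"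
        by (intro Bochner_Integration.integrable_diff int integrable_inner_left int')
      fix y
      have "\<bar>\<theta> ((x - y) + (z - x)) - \<theta> (x - y) - \<Theta> (x - y) \<bullet> (z - x)\<bar> \<le> e / J * norm (z - x)"
        using d(2) e J z by (intro gradient_linearization_bound[OF \<theta>(1), of d]) (auto intro: less_imp_le)
      then have "\<bar>k y\<bar> * \<bar>\<theta> (z - y) - \<theta> (x - y) - \<Theta> (x - y) \<bullet> (z - x)\<bar> \<le> \<bar>k y\<bar> * (e / J * norm (z - x))"
        by (intro mult_left_mono) (auto simp: algebra_simps)
      then show "norm (k y * \<theta> (z - y) - k y * \<theta> (x - y) - (k y *\<^sub>R \<Theta> (x - y)) \<bullet> (z - x)) \<le>
          (e / J * norm (z - x)) * norm (k y)"
        by (simp add: abs_mult[symmetric] algebra_simps)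
    qed (use k in auto)
    also have "\<dots> = (e * norm (z - x)) * ((J - 1) / J)" by (simp add: J_def)
    also have "\<dots> \<le> (e * norm (z - x)) * 1" using e J by (intro mult_left_mono) auto
    finally show ?thesis by simp
  qed
  then show "\<exists>d>0. \<forall>z. norm (z - x) < d \<longrightarrow>
    norm ((\<integral>y. k y * \<theta> (z - y) \<partial>lborel) - (\<integral>y. k y * \<theta> (x - y) \<partial>lborel) -
      (\<integral>y. k y *\<^sub>R \<Theta> (x - y) \<partial>lborel) \<bullet> (z - x)) \<le> e * norm (z - x)"
    using d(1) by blast
qed

text \<open>The derivative falls on the smooth factor, whose partial derivatives are again smooth
  and vanish outside the same ball. The convolutions of the fixed \<open>k\<close> with such
  functions therefore form a set closed under partial derivatives.\<close>

lemma smooth_fun_conv: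
  fixes k :: "'a::euclidean_space \<Rightarrow> real"
  assumes "smooth_fun \<eta>" "\<And>x. r \<le> norm x \<Longrightarrow> \<eta> x = 0" "integrable lborel k"
  shows "smooth_fun (conv \<eta> k)"
proof -
  define S where "S = {conv \<theta> k |\<theta>. smooth_fun \<theta> \<and> (\<forall>x. r \<le> norm (x - 0) \<longrightarrow> \<theta> x = 0)}"
  show ?thesis
  proof (rule smooth_fun_coinduct)
    show "conv \<eta> k \<in> S" unfolding S_def using assms by force
  next
    fix \<psi> assume "\<psi> \<in> S"
    then obtain \<theta> where \<theta>: "\<psi> = conv \<theta> k" "smooth_fun \<theta>" "\<And>x. r \<le> norm (x - 0) \<Longrightarrow> \<theta> x = 0"
      unfolding S_def by blast
    obtain P where P: "\<And>i. smooth_fun (P i)"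
      "\<And>x. (\<theta> has_derivative (\<lambda>h. \<Sum>i\<in>Basis. (h \<bullet> i) * P i x)) (at x)"
      using smooth_fun_partials[OF \<theta>(2)] by blast
    define N where "N x = (\<Sum>i\<in>Basis. P i x *\<^sub>R i)" for x
    have N: "(\<theta> has_derivative (\<lambda>h. N x \<bullet> h)) (at x)" for x
      unfolding N_def inner_sum_scaleR_eq by (rule P)
    have N_cont: "continuous_on UNIV N"
      unfolding N_def by (intro continuous_intros smooth_fun_continuous P)
    have N_zero: "N x = 0" if "r \<le> norm (x - 0)" for x
      using gradient_zero_outside[OF N N_cont \<theta>(3) that] .
    have NP: "N x \<bullet> i = P i x" if "i \<in> Basis" for x i
      unfolding N_def using that by (simp add: inner_sum_left_Basis)
    obtain B where B: "\<And>x. norm (N x) \<le> B" using compact_support_bounded[OF N_cont N_zero] by blast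
    have int: "integrable lborel (\<lambda>y. k y *\<^sub>R N (x - y))" for x
      by (rule integrable_scaleR_bounded[OF assms(3) borel_measurable_continuous_onI[OF N_cont] B])
    have "conv (P i) k \<in> S" if "i \<in> Basis" for i
    proof -
      have "\<forall>x. r \<le> norm (x - 0) \<longrightarrow> P i x = 0" using N_zero NP[OF that] by (metis inner_zero_left)
      then show ?thesis unfolding S_def using P by blast
    qed
    moreover have "(\<psi> has_derivative (\<lambda>h. \<Sum>i\<in>Basis. (h \<bullet> i) * conv (P i) k x)) (at x)" for x
    proof -
      have 1: "\<psi> = (\<lambda>x. \<integral>y. k y * \<theta> (x - y) \<partial>lborel)"
        unfolding \<theta>(1) conv_def by (simp add: mult.commute)
      have "(\<integral>y. k y *\<^sub>R N (x - y) \<partial>lborel) \<bullet> i = conv (P i) k x" if "i \<in> Basis" for i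
        using int[of x] that
        by (simp add: integral_inner_left[symmetric] NP conv_def mult.commute)
      then have "(\<Sum>i\<in>Basis. (h \<bullet> i) * conv (P i) k x) = (\<integral>y. k y *\<^sub>R N (x - y) \<partial>lborel) \<bullet> h" for h
        unfolding euclidean_inner[of _ h] by (intro sum.cong) (auto simp: mult.commute)
      then show ?thesis
        using integral_translate_has_gradient[OF N N_cont \<theta>(3) assms(3), where x = x and r = r and a = 0]
        by (simp add: 1)
    qed
    ultimately show "\<exists>P. (\<forall>i\<in>Basis. P i \<in> S) \<and>
        (\<forall>x. (\<psi> has_derivative (\<lambda>h. \<Sum>i\<in>Basis. (h \<bullet> i) * P i x)) (at x))"
      by (intro exI[of _ "\<lambda>i. conv (P i) k"]) auto
  qed
qed

text \<open>The integral over a fixed large ball does not change under small translations; differentiate in the translation.\<close>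

lemma integral_gradient_zero:
  fixes \<theta> :: "'a::euclidean_space \<Rightarrow> real"
  assumes \<theta>: "\<And>x. (\<theta> has_derivative (\<lambda>h. \<Theta> x \<bullet> h)) (at x)" "continuous_on UNIV \<Theta>"
      "\<And>x. r \<le> norm (x - a) \<Longrightarrow> \<theta> x = 0"
  shows "(\<integral>x. \<Theta> x \<partial>lborel) = 0"
proof -
  \<comment> \<open>As \<open>x - y\<close> must come close to \<open>a\<close>, the variable
    \<open>y\<close> stays near \<open>- a\<close>; the extra 1 leaves room for \<open>x\<close> to
    move in the unit ball.\<close>
  define k :: "'a \<Rightarrow> real" where "k = indicator (ball (- a) (r + 1))"
  have k: "integrable lborel k"
    unfolding k_def using emeasure_lborel_ball_finite[of "-a" "r + 1"] by (intro integrable_real_indicator) auto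
  have \<Theta>0: "\<Theta> x = 0" if "r \<le> norm (x - a)" for x
    using gradient_zero_outside[OF \<theta>] that by blast
  have \<theta>c: "continuous_on UNIV \<theta>"
    using \<theta>(1) by (auto simp: continuous_on_eq_continuous_at intro: has_derivative_continuous)
  have k1: "k y = 1" if "norm (x - y - a) < r" "norm x < 1" for x y
  proof -
    have "norm (- a - y) \<le> norm (x - y - a) + norm x"
      using norm_triangle_ineq4[of "x - y - a" x] by (simp add: algebra_simps)
    then show ?thesis using that by (simp add: k_def dist_norm)
  qed
  have const: "(\<integral>y. k y * \<theta> (x - y) \<partial>lborel) = (\<integral>y. \<theta> y \<partial>lborel)" if "x \<in> ball 0 1" for x
  proof -
    have "k y * \<theta> (x - y) = \<theta> (x - y)" for y
      using k1[of x y] \<theta>(3)[of "x - y"] that by (cases "norm (x - y - a) < r") auto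
    then show ?thesis
      by (simp only: lborel_integral_reflect[OF borel_measurable_continuous_onI[OF \<theta>c]])
  qed
  have "((\<lambda>x. \<integral>y. \<theta> y \<partial>lborel) has_derivative (\<lambda>h. (\<integral>y. k y *\<^sub>R \<Theta> (0 - y) \<partial>lborel) \<bullet> h)) (at 0)"
    by (rule has_derivative_transform_within_open[where s = "ball 0 1",
          OF integral_translate_has_gradient[OF \<theta> k]]) (auto simp: const[unfolded mem_ball_0])
  then have "(\<lambda>h. (\<integral>y. k y *\<^sub>R \<Theta> (0 - y) \<partial>lborel) \<bullet> h) = (\<lambda>h. 0)"
    by (rule has_derivative_unique[OF _ has_derivative_const])
  then have "(\<integral>y. k y *\<^sub>R \<Theta> (0 - y) \<partial>lborel) = 0"
    by (metis inner_eq_zero_iff)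
  moreover have "k y *\<^sub>R \<Theta> (0 - y) = \<Theta> (0 - y)" for y
    using k1[of 0 y] \<Theta>0[of "0 - y"] by (cases "norm (0 - y - a) < r") auto
  ultimately have "(\<integral>y. \<Theta> (0 - y) \<partial>lborel) = 0" by (simp only:)
  then show ?thesis
    using lborel_integral_reflect[OF borel_measurable_continuous_onI[OF \<theta>(2)], of 0] by simp
qed

lemma mollifierD:
  assumes "mollifier \<eta> r"
  shows "0 < r" "smooth_fun \<eta>" "0 \<le> \<eta> x" "r \<le> norm x \<Longrightarrow> \<eta> x = 0" "\<eta> (- x) = \<eta> x"
    "(\<integral>x. \<eta> x \<partial>lborel) = 1" "continuous_on UNIV \<eta>" "\<eta> \<in> borel_measurable borel"
    "integrable lborel \<eta>" "integrable lborel (\<lambda>y. \<eta> (x - y))" "(\<integral>y. \<eta> (x - y) \<partial>lborel) = 1"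
proof -
  show *: "0 < r" "smooth_fun \<eta>" "0 \<le> \<eta> x" "\<eta> (- x) = \<eta> x" "(\<integral>x. \<eta> x \<partial>lborel) = 1"
    and zero: "\<And>x. r \<le> norm x \<Longrightarrow> \<eta> x = 0"
    using assms unfolding mollifier_def by auto
  show cont: "continuous_on UNIV \<eta>" by (rule smooth_fun_continuous) fact
  show meas: "\<eta> \<in> borel_measurable borel" using cont by (rule borel_measurable_continuous_onI)
  show "integrable lborel \<eta>"
    by (rule continuous_compact_support_integrable[OF cont, of 0 r]) (auto intro: zero)
  show "(\<integral>y. \<eta> (x - y) \<partial>lborel) = 1"
    using * by (simp add: lborel_integral_reflect[OF meas])
  \<comment> \<open>A nonintegrable function has integral 0 by convention, so the value 1 already
    proves integrability.\<close>
  then show "integrable lborel (\<lambda>y. \<eta> (x - y))"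
    using not_integrable_integral_eq by fastforce
qed

lemma mollifier_bounded:
  fixes \<eta> :: "'a::euclidean_space \<Rightarrow> real"
  assumes "mollifier \<eta> r"
  obtains B where "\<And>x. \<bar>\<eta> x\<bar> \<le> B"
proof -
  have "\<eta> x = 0" if "r \<le> norm (x - 0)" for x
    using mollifierD(4)[OF assms, of x] that by simp
  from compact_support_bounded[OF mollifierD(7)[OF assms] this]
  obtain B where B: "\<And>x. norm (\<eta> x) \<le> B" by blast
  show thesis
  proof (rule that)
    show "\<bar>\<eta> x\<bar> \<le> B" for x using B[of x] by simp
  qed
qed

lemma conv_integrable:
  fixes k :: "'a::euclidean_space \<Rightarrow> 'b::euclidean_space"
  assumes "mollifier \<eta> r" "integrable lborel k"
  shows "integrable lborel (\<lambda>y. \<eta> (x - y) *\<^sub>R k y)"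
proof -
  obtain B where "\<And>x. \<bar>\<eta> x\<bar> \<le> B" using mollifier_bounded[OF assms(1)] by blast
  then show ?thesis by (intro integrable_bounded_scaleR[OF assms(2) mollifierD(8)[OF assms(1)]])
qed

text \<open>\<open>conv\<close> is an average over the ball of radius \<open>r\<close>. With
  \<open>c = 0\<close> this serves as a uniform bound, with \<open>c\<close> a value of the function
  as a modulus of continuity.\<close>

lemma conv_close:
  fixes k :: "'a::euclidean_space \<Rightarrow> 'b::euclidean_space"
  assumes \<eta>: "mollifier \<eta> r" and k: "integrable lborel k"
    and close: "\<And>y. norm (x - y) < r \<Longrightarrow> norm (k y - c) \<le> e"
  shows "norm (conv \<eta> k x - c) \<le> e"
proof -
  have 1: "conv \<eta> k x - c = (\<integral>y. \<eta> (x - y) *\<^sub>R k y - \<eta> (x - y) *\<^sub>R c \<partial>lborel)"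
    unfolding conv_def using conv_integrable[OF \<eta> k, of x] mollifierD(10,11)[OF \<eta>, of x]
    by (subst Bochner_Integration.integral_diff) auto
  have "norm (conv \<eta> k x - c) \<le> (\<integral>y. \<eta> (x - y) * e \<partial>lborel)"
    unfolding 1
  proof (rule Bochner_Integration.integral_norm_bound_integral)
    show "integrable lborel (\<lambda>y. \<eta> (x - y) *\<^sub>R k y - \<eta> (x - y) *\<^sub>R c)"
      using conv_integrable[OF \<eta> k, of x] mollifierD(10)[OF \<eta>, of x] by auto
    show "integrable lborel (\<lambda>y. \<eta> (x - y) * e)"
      using mollifierD(10)[OF \<eta>, of x] by auto
    fix y
    show "norm (\<eta> (x - y) *\<^sub>R k y - \<eta> (x - y) *\<^sub>R c) \<le> \<eta> (x - y) * e"
    proof (cases "norm (x - y) < r")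
      case True
      then show ?thesis using close[of y] mollifierD(3)[OF \<eta>, of "x - y"]
        by (simp add: scaleR_diff_right[symmetric] mult_left_mono)
    qed (simp add: mollifierD(4)[OF \<eta>])
  qed
  also have "\<dots> = e" using mollifierD(11)[OF \<eta>, of x] by simp
  finally show ?thesis .
qed

lemma conv_zero:
  assumes "mollifier \<eta> r" "\<And>y. norm (x - y) < r \<Longrightarrow> k y = 0"
  shows "conv \<eta> k x = 0"
proof -
  have "\<eta> (x - y) *\<^sub>R k y = 0" for y
    using assms(2)[of y] mollifierD(4)[OF assms(1), of "x - y"] by (cases "norm (x - y) < r") auto
  then show ?thesis by (simp only: conv_def integral_zero)
qed

lemma conv_tendsto:
  fixes k :: "'a::euclidean_space \<Rightarrow> 'b::euclidean_space"
  assumes \<eta>: "\<And>n. mollifier (\<eta> n) (r n)" "r \<longlonglongrightarrow> 0" and k: "integrable lborel k"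
    and cont: "isCont k x"
  shows "(\<lambda>n. conv (\<eta> n) k x) \<longlonglongrightarrow> k x"
proof (rule LIMSEQ_I)
  fix e :: real assume e: "0 < e"
  obtain d where d: "d > 0" "\<And>y. dist y x < d \<Longrightarrow> dist (k y) (k x) < e / 2"
    using cont e unfolding continuous_at_eps_delta by (metis half_gt_zero)
  obtain N where N: "\<And>n. n \<ge> N \<Longrightarrow> r n < d"
    using order_tendstoD(2)[OF \<eta>(2) d(1)] unfolding eventually_sequentially by blast
  have "norm (conv (\<eta> n) k x - k x) < e" if "n \<ge> N" for n
  proof -
    have "norm (conv (\<eta> n) k x - k x) \<le> e / 2"
      using d(2) N[OF that]
      by (intro conv_close[OF \<eta>(1) k]) (auto simp: dist_norm norm_minus_commute intro: less_imp_le)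
    then show ?thesis using e by simp
  qed
  then show "\<exists>N. \<forall>n\<ge>N. norm (conv (\<eta> n) k x - k x) < e" by blast
qed

text \<open>After a reflection the mollifier is the integrable kernel and the derivative falls on
  \<open>w\<close>, so the gradient is the mollified \<open>W\<close>.\<close>

lemma conv_has_gradient:
  fixes w :: "'a::euclidean_space \<Rightarrow> real"
  assumes \<eta>: "mollifier \<eta> s"
    and w: "\<And>x. (w has_derivative (\<lambda>h. W x \<bullet> h)) (at x)" "continuous_on UNIV W"
      "\<And>x. r \<le> norm (x - a) \<Longrightarrow> w x = 0"
  shows "(conv \<eta> w has_derivative (\<lambda>h. conv \<eta> W x \<bullet> h)) (at x)"
proof -
  note [measurable] = mollifierD(8)[OF \<eta>]
  have w_cont: "continuous_on UNIV w"
    using w(1) by (auto simp: continuous_on_eq_continuous_at intro: has_derivative_continuous)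
  note [measurable] = borel_measurable_continuous_onI[OF w_cont] borel_measurable_continuous_onI[OF w(2)]
  have 1: "conv \<eta> w = (\<lambda>x. \<integral>y. \<eta> y * w (x - y) \<partial>lborel)"
  proof
    fix x
    have "conv \<eta> w x = (\<integral>y. (\<lambda>z. \<eta> z * w (x - z)) (x - y) \<partial>lborel)"
      by (simp add: conv_def)
    also have "\<dots> = (\<integral>y. \<eta> y * w (x - y) \<partial>lborel)" by (rule lborel_integral_reflect) measurable
    finally show "conv \<eta> w x = (\<integral>y. \<eta> y * w (x - y) \<partial>lborel)" .
  qed
  have 2: "conv \<eta> W x = (\<integral>y. \<eta> y *\<^sub>R W (x - y) \<partial>lborel)"
  proof -
    have "conv \<eta> W x = (\<integral>y. (\<lambda>z. \<eta> z *\<^sub>R W (x - z)) (x - y) \<partial>lborel)"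
      by (simp add: conv_def)
    also have "\<dots> = (\<integral>y. \<eta> y *\<^sub>R W (x - y) \<partial>lborel)" by (rule lborel_integral_reflect) measurable
    finally show ?thesis .
  qed
  show ?thesis unfolding 1 2
    by (rule integral_translate_has_gradient[OF w mollifierD(9)[OF \<eta>]])
qed

section \<open>\<open>L\<^sup>1\<close> convergence of mollifications\<close>

lemma conv_borel_measurable:
  fixes k :: "'a::euclidean_space \<Rightarrow> 'b::euclidean_space"
  assumes \<eta>: "mollifier \<eta> r" and [measurable]: "k \<in> borel_measurable borel"
  shows "conv \<eta> k \<in> borel_measurable borel"
proof -
  note [measurable] = mollifierD(8)[OF \<eta>]
  have "(\<lambda>x. \<integral>y. \<eta> (x - y) *\<^sub>R k y \<partial>lborel) \<in> borel_measurable borel"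
    by (rule lborel.borel_measurable_lebesgue_integral) (simp add: split_beta', measurable)
  then show ?thesis by (simp add: conv_def[abs_def])
qed

text \<open>By Tonelli, integrate first in \<open>x\<close>: each translate of the mollifier has
  mass 1.\<close>

lemma conv_L1_contraction:
  fixes k :: "'a::euclidean_space \<Rightarrow> 'b::euclidean_space"
  assumes \<eta>: "mollifier \<eta> r" and k: "integrable lborel k"
  shows "integrable lborel (conv \<eta> k)" "(\<integral>x. norm (conv \<eta> k x) \<partial>lborel) \<le> (\<integral>x. norm (k x) \<partial>lborel)"
proof -
  note [measurable] = mollifierD(8)[OF \<eta>]
  have km[measurable]: "k \<in> borel_measurable borel" using k by auto
  have "(\<integral>\<^sup>+x. norm (conv \<eta> k x) \<partial>lborel) \<le> (\<integral>\<^sup>+x. (\<integral>\<^sup>+y. ennreal (\<eta> (x - y) * norm (k y)) \<partial>lborel) \<partial>lborel)"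
  proof (rule nn_integral_mono)
    fix x
    show "ennreal (norm (conv \<eta> k x)) \<le> (\<integral>\<^sup>+y. ennreal (\<eta> (x - y) * norm (k y)) \<partial>lborel)"
      using integral_norm_bound_ennreal[OF conv_integrable[OF \<eta> k, of x]] mollifierD(3)[OF \<eta>]
      by (simp add: conv_def)
  qed
  also have "\<dots> = (\<integral>\<^sup>+y. (\<integral>\<^sup>+x. ennreal (\<eta> (x - y) * norm (k y)) \<partial>lborel) \<partial>lborel)"
    by (rule lborel_pair.Fubini') measurable
  also have "\<dots> = (\<integral>\<^sup>+y. ennreal (norm (k y)) \<partial>lborel)"
  proof (rule nn_integral_cong)
    fix y
    have tr: "(\<integral>x. \<eta> (x - y) \<partial>lborel) = 1"
      using mollifierD(6)[OF \<eta>] by (simp add: lborel_integral_translate)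
    then have "integrable lborel (\<lambda>x. \<eta> (x - y))"
      using not_integrable_integral_eq by fastforce
    then have 1: "(\<integral>\<^sup>+x. ennreal (\<eta> (x - y)) \<partial>lborel) = 1"
      using tr mollifierD(3)[OF \<eta>] by (subst nn_integral_eq_integral) auto
    have "(\<integral>\<^sup>+x. ennreal (\<eta> (x - y) * norm (k y)) \<partial>lborel) = (\<integral>\<^sup>+x. ennreal (\<eta> (x - y)) * ennreal (norm (k y)) \<partial>lborel)"
      using mollifierD(3)[OF \<eta>] by (simp add: ennreal_mult)
    also have "\<dots> = ennreal (norm (k y))"
      by (subst nn_integral_multc) (simp_all add: 1)
    finally show "(\<integral>\<^sup>+x. ennreal (\<eta> (x - y) * norm (k y)) \<partial>lborel) = ennreal (norm (k y))" .
  qed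
  also have "\<dots> = ennreal (\<integral>y. norm (k y) \<partial>lborel)"
    using k by (intro nn_integral_eq_integral) auto
  finally have le: "(\<integral>\<^sup>+x. norm (conv \<eta> k x) \<partial>lborel) \<le> ennreal (\<integral>y. norm (k y) \<partial>lborel)" .
  note [measurable] = conv_borel_measurable[OF \<eta> km]
  show int: "integrable lborel (conv \<eta> k)"
    by (rule integrableI_bounded) (use le in \<open>auto simp: le_less_trans\<close>)
  have "ennreal (\<integral>x. norm (conv \<eta> k x) \<partial>lborel) \<le> ennreal (\<integral>y. norm (k y) \<partial>lborel)"
    using le int by (subst nn_integral_eq_integral[symmetric]) auto
  then show "(\<integral>x. norm (conv \<eta> k x) \<partial>lborel) \<le> (\<integral>x. norm (k x) \<partial>lborel)"
    by (subst (asm) ennreal_le_iff) (auto intro: integral_nonneg_AE)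
qed

lemma conv_add:
  fixes k :: "'a::euclidean_space \<Rightarrow> 'b::euclidean_space"
  assumes "mollifier \<eta> r" "integrable lborel k" "integrable lborel l"
  shows "conv \<eta> (\<lambda>x. k x + l x) x = conv \<eta> k x + conv \<eta> l x"
  unfolding conv_def scaleR_add_right
  by (intro Bochner_Integration.integral_add conv_integrable[OF assms(1)] assms)

lemma conv_L1_error_add:
  fixes k :: "'a::euclidean_space \<Rightarrow> 'b::euclidean_space"
  assumes \<eta>: "mollifier \<eta> r" and k: "integrable lborel k" and l: "integrable lborel l"
  shows "(\<integral>x. norm (conv \<eta> (\<lambda>x. k x + l x) x - (k x + l x)) \<partial>lborel) \<le>
    (\<integral>x. norm (conv \<eta> k x - k x) \<partial>lborel) + (\<integral>x. norm (conv \<eta> l x - l x) \<partial>lborel)"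
proof -
  note ck = conv_L1_contraction(1)[OF \<eta> k] and cl = conv_L1_contraction(1)[OF \<eta> l]
  have "(\<integral>x. norm (conv \<eta> (\<lambda>x. k x + l x) x - (k x + l x)) \<partial>lborel) \<le>
      (\<integral>x. norm (conv \<eta> k x - k x) + norm (conv \<eta> l x - l x) \<partial>lborel)"
  proof (rule integral_mono)
    show "integrable lborel (\<lambda>x. norm (conv \<eta> (\<lambda>x. k x + l x) x - (k x + l x)))"
      unfolding conv_add[OF \<eta> k l] using ck cl k l by auto
    show "integrable lborel (\<lambda>x. norm (conv \<eta> k x - k x) + norm (conv \<eta> l x - l x))"
      using ck cl k l by auto
    show "norm (conv \<eta> (\<lambda>x. k x + l x) x - (k x + l x)) \<le> norm (conv \<eta> k x - k x) + norm (conv \<eta> l x - l x)" for x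
      unfolding conv_add[OF \<eta> k l] add_diff_add by (rule norm_triangle_ineq)
  qed
  also have "\<dots> = (\<integral>x. norm (conv \<eta> k x - k x) \<partial>lborel) + (\<integral>x. norm (conv \<eta> l x - l x) \<partial>lborel)"
    using ck cl k l by (intro Bochner_Integration.integral_add) auto
  finally show ?thesis .
qed

lemma conv_L1_error_le:
  fixes k :: "'a::euclidean_space \<Rightarrow> 'b::euclidean_space"
  assumes \<eta>: "mollifier \<eta> r" and k: "integrable lborel k"
  shows "(\<integral>x. norm (conv \<eta> k x - k x) \<partial>lborel) \<le> 2 * (\<integral>x. norm (k x) \<partial>lborel)"
proof -
  note ck = conv_L1_contraction[OF \<eta> k]
  have "(\<integral>x. norm (conv \<eta> k x - k x) \<partial>lborel) \<le> (\<integral>x. norm (conv \<eta> k x) + norm (k x) \<partial>lborel)"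
    using ck k by (intro integral_mono) (auto intro: norm_triangle_ineq4)
  also have "\<dots> = (\<integral>x. norm (conv \<eta> k x) \<partial>lborel) + (\<integral>x. norm (k x) \<partial>lborel)"
    using ck k by (intro Bochner_Integration.integral_add) auto
  finally show ?thesis using ck by simp
qed

text \<open>The error functional is subadditive and at most twice the L^1 norm, hence convergence is
  stable under L^1 approximation.\<close>

lemma conv_L1_tendsto_approx:
  fixes k :: "'a::euclidean_space \<Rightarrow> 'b::euclidean_space"
  assumes \<eta>: "\<And>n. mollifier (\<eta> n) (r n)" and k: "integrable lborel k"
    and approx: "\<And>e. 0 < e \<Longrightarrow> \<exists>l. integrable lborel l \<and> (\<integral>x. norm (k x - l x) \<partial>lborel) \<le> e \<and>
      (\<lambda>n. \<integral>x. norm (conv (\<eta> n) l x - l x) \<partial>lborel) \<longlonglongrightarrow> 0"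
  shows "(\<lambda>n. \<integral>x. norm (conv (\<eta> n) k x - k x) \<partial>lborel) \<longlonglongrightarrow> 0"
proof (rule LIMSEQ_I)
  fix e :: real assume e: "0 < e"
  obtain l where l: "integrable lborel l" "(\<integral>x. norm (k x - l x) \<partial>lborel) \<le> e / 4"
    and lim: "(\<lambda>n. \<integral>x. norm (conv (\<eta> n) l x - l x) \<partial>lborel) \<longlonglongrightarrow> 0"
    using approx[of "e / 4"] e by auto
  obtain N where N: "\<And>n. n \<ge> N \<Longrightarrow> (\<integral>x. norm (conv (\<eta> n) l x - l x) \<partial>lborel) < e / 2"
    using order_tendstoD(2)[OF lim, of "e / 2"] e unfolding eventually_sequentially by auto
  have "norm ((\<integral>x. norm (conv (\<eta> n) k x - k x) \<partial>lborel) - 0) < e" if "n \<ge> N" for n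
  proof -
    have kl: "integrable lborel (\<lambda>x. k x - l x)" using k l by auto
    have "(\<integral>x. norm (conv (\<eta> n) (\<lambda>x. l x + (k x - l x)) x - (l x + (k x - l x))) \<partial>lborel) \<le>
      (\<integral>x. norm (conv (\<eta> n) l x - l x) \<partial>lborel) + (\<integral>x. norm (conv (\<eta> n) (\<lambda>x. k x - l x) x - (k x - l x)) \<partial>lborel)"
      by (rule conv_L1_error_add[OF \<eta> l(1) kl])
    also have "\<dots> < e / 2 + 2 * (e / 4)"
      using N[OF that] conv_L1_error_le[OF \<eta>[of n] kl] l(2) by linarith
    finally show ?thesis by (simp add: integral_nonneg_AE)
  qed
  then show "\<exists>N. \<forall>n\<ge>N. norm ((\<integral>x. norm (conv (\<eta> n) k x - k x) \<partial>lborel) - 0) < e" by blast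
qed

text \<open>As convolution does not increase the mass, the error outside \<open>U\<close> is at most the error inside \<open>U\<close>,
  where pointwise convergence is clear.\<close>

lemma conv_L1_tendsto_indicator_open:
  fixes U :: "'a::euclidean_space set"
  assumes \<eta>: "\<And>n. mollifier (\<eta> n) (r n)" "r \<longlonglongrightarrow> 0"
    and U: "open U" "emeasure lborel U < \<infinity>"
  shows "(\<lambda>n. \<integral>x. norm (conv (\<eta> n) (indicator U) x - indicator U x :: real) \<partial>lborel) \<longlonglongrightarrow> 0"
proof -
  define k :: "'a \<Rightarrow> real" where "k = indicator U"
  have [measurable]: "U \<in> sets borel" using U by auto
  have k: "integrable lborel k" unfolding k_def using U by (intro integrable_real_indicator) auto
  note ck = conv_L1_contraction[OF \<eta>(1) k]
  have c0: "conv (\<eta> n) k x \<ge> 0" for n x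
    unfolding conv_def k_def by (intro integral_nonneg_AE) (auto simp: mollifierD(3)[OF \<eta>(1)])
  have c1: "conv (\<eta> n) k x \<le> 1" for n x
  proof -
    have "norm (conv (\<eta> n) k x - 0) \<le> 1"
      by (rule conv_close[OF \<eta>(1) k]) (auto simp: k_def indicator_def)
    then show ?thesis by simp
  qed
  have lim: "(\<lambda>n. \<integral>x. k x * (1 - conv (\<eta> n) k x) \<partial>lborel) \<longlonglongrightarrow> (\<integral>x. 0 \<partial>(lborel::'a measure))"
  proof (rule integral_dominated_convergence)
    show "(\<lambda>x. k x * (1 - conv (\<eta> n) k x)) \<in> borel_measurable lborel" for n
      using ck(1)[of n] k by (auto dest!: borel_measurable_integrable)
    show "integrable lborel k" by fact
    show "AE x in lborel. norm (k x * (1 - conv (\<eta> n) k x)) \<le> k x" for n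
      using c0 c1 by (intro always_eventually allI) (auto simp: k_def indicator_def)
    show "AE x in lborel. (\<lambda>n. k x * (1 - conv (\<eta> n) k x)) \<longlonglongrightarrow> 0"
    proof (intro always_eventually allI)
      fix x
      show "(\<lambda>n. k x * (1 - conv (\<eta> n) k x)) \<longlonglongrightarrow> 0"
      proof (cases "x \<in> U")
        case True
        have "isCont k x"
        proof -
          have "continuous_on U k"
            unfolding k_def by (rule continuous_on_eq[OF continuous_on_const[of _ 1]]) auto
          then show ?thesis using True U(1) continuous_on_eq_continuous_at by blast
        qed
        then have "(\<lambda>n. conv (\<eta> n) k x) \<longlonglongrightarrow> k x" by (rule conv_tendsto[OF \<eta> k])
        then have "(\<lambda>n. k x * (1 - conv (\<eta> n) k x)) \<longlonglongrightarrow> k x * (1 - k x)"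
          by (intro tendsto_intros)
        then show ?thesis using True by (simp add: k_def)
      qed (simp add: k_def)
    qed
  qed auto
  have int2: "integrable lborel (\<lambda>x. k x * (1 - conv (\<eta> n) k x))" for n
    by (rule Bochner_Integration.integrable_bound[OF k])
       (use ck(1)[of n] k c0 c1 in \<open>auto dest!: borel_measurable_integrable simp: k_def indicator_def intro!: always_eventually\<close>)
  have le: "(\<integral>x. norm (conv (\<eta> n) k x - k x) \<partial>lborel) \<le> 2 * (\<integral>x. k x * (1 - conv (\<eta> n) k x) \<partial>lborel)" for n
  proof -
    have "norm (conv (\<eta> n) k x - k x) = conv (\<eta> n) k x - k x + 2 * (k x * (1 - conv (\<eta> n) k x))" for x
      using c0[of n x] c1[of n x] by (auto simp: k_def indicator_def)
    then have "(\<integral>x. norm (conv (\<eta> n) k x - k x) \<partial>lborel) =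
        (\<integral>x. conv (\<eta> n) k x - k x + 2 * (k x * (1 - conv (\<eta> n) k x)) \<partial>lborel)" by simp
    also have "\<dots> = (\<integral>x. conv (\<eta> n) k x \<partial>lborel) - (\<integral>x. k x \<partial>lborel) + 2 * (\<integral>x. k x * (1 - conv (\<eta> n) k x) \<partial>lborel)"
      using ck(1)[of n] k int2[of n] by simp
    also have "(\<integral>x. conv (\<eta> n) k x \<partial>lborel) \<le> (\<integral>x. k x \<partial>lborel)"
      using ck(2)[of n] c0 by (simp add: k_def)
    finally show ?thesis by simp
  qed
  have "(\<lambda>n. \<integral>x. norm (conv (\<eta> n) k x - k x) \<partial>lborel) \<longlonglongrightarrow> 0"
  proof (rule real_tendsto_sandwich[OF _ _ tendsto_const])
    show "\<forall>\<^sub>F n in sequentially. (\<integral>x. norm (conv (\<eta> n) k x - k x) \<partial>lborel) \<le>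
        2 * (\<integral>x. k x * (1 - conv (\<eta> n) k x) \<partial>lborel)"
      using le by simp
    show "(\<lambda>n. 2 * (\<integral>x. k x * (1 - conv (\<eta> n) k x) \<partial>lborel)) \<longlonglongrightarrow> 0"
      using tendsto_mult_left[OF lim, of 2] by simp
  qed (auto intro: integral_nonneg_AE)
  then show ?thesis unfolding k_def .
qed

text \<open>Induction over integrable functions. Indicators of Borel sets reduce to open sets by
  outer regularity, because continuity of the indicator at the points of the set is what the direct
  argument uses.\<close>

lemma conv_L1_tendsto:
  fixes k :: "'a::euclidean_space \<Rightarrow> 'b::euclidean_space"
  assumes \<eta>: "\<And>n. mollifier (\<eta> n) (r n)" "r \<longlonglongrightarrow> 0" and k: "integrable lborel k"
  shows "(\<lambda>n. \<integral>x. norm (conv (\<eta> n) k x - k x) \<partial>lborel) \<longlonglongrightarrow> 0"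
  using k
proof induction
  case (base A c)
  then have [measurable]: "A \<in> sets borel" by simp
  have iA: "integrable lborel (\<lambda>x. indicator A x *\<^sub>R c)"
    using base by (intro integrable_scaleR_left) (auto intro: integrable_real_indicator)
  show ?case
  proof (rule conv_L1_tendsto_approx[OF \<eta>(1) iA])
    fix e :: real assume e: "0 < e"
    define d where "d = e / (norm c + 1)"
    have d: "d > 0" using e by (simp add: d_def add_nonneg_pos)
    obtain U where U: "open U" "A \<subseteq> U" "emeasure lborel (U - A) < ennreal d"
      using outer_regular_lborel[of A d] d by auto
    have UA: "emeasure lborel (U - A) < \<infinity>" using U(3) by (simp add: less_trans)
    have "emeasure lborel U \<le> emeasure lborel (A \<union> (U - A))"
      using U by (intro emeasure_mono) auto
    also have "\<dots> \<le> emeasure lborel A + emeasure lborel (U - A)"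
      using U by (intro emeasure_subadditive) auto
    also have "\<dots> < \<infinity>" using base UA by simp
    finally have fU: "emeasure lborel U < \<infinity>" .
    have iU: "integrable lborel (\<lambda>x. indicator U x *\<^sub>R c)"
      using fU U by (intro integrable_scaleR_left) (auto intro: integrable_real_indicator)
    have "(\<integral>x. norm (indicator A x *\<^sub>R c - indicator U x *\<^sub>R c) \<partial>lborel) = (\<integral>x. norm c * indicator (U - A) x \<partial>lborel)"
      using U(2) by (intro Bochner_Integration.integral_cong) (auto simp: indicator_def)
    also have "\<dots> = norm c * measure lborel (U - A)" by simp
    also have "\<dots> \<le> norm c * d"
      using U(3) UA d by (intro mult_left_mono) (auto simp: measure_def intro: enn2real_leI less_imp_le)
    also have "norm c * d = e * (norm c / (norm c + 1))" by (simp add: d_def)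
    also have "\<dots> \<le> e * 1" using e by (intro mult_left_mono) (auto simp: divide_le_eq add_nonneg_pos)
    also have "e * 1 = e" by simp
    finally have le: "(\<integral>x. norm (indicator A x *\<^sub>R c - indicator U x *\<^sub>R c) \<partial>lborel) \<le> e" .
    have "conv (\<eta> n) (\<lambda>x. indicator U x *\<^sub>R c) x = conv (\<eta> n) (indicator U :: 'a \<Rightarrow> real) x *\<^sub>R c" for n x
    proof -
      have "integrable lborel (indicator U :: 'a \<Rightarrow> real)"
        using fU U by (intro integrable_real_indicator) auto
      from conv_integrable[OF \<eta>(1) this, of n x] show ?thesis
        unfolding conv_def by (subst integral_scaleR_left[symmetric]) auto
    qed
    then have "norm (conv (\<eta> n) (\<lambda>x. indicator U x *\<^sub>R c) x - indicator U x *\<^sub>R c) =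
        norm (conv (\<eta> n) (indicator U) x - indicator U x :: real) * norm c" for n x
      by (simp only: scaleR_diff_left[symmetric] norm_scaleR real_norm_def)
    then have "(\<lambda>n. \<integral>x. norm (conv (\<eta> n) (\<lambda>x. indicator U x *\<^sub>R c) x - indicator U x *\<^sub>R c) \<partial>lborel) \<longlonglongrightarrow> 0"
      using tendsto_mult_left_zero[OF conv_L1_tendsto_indicator_open[OF \<eta> U(1) fU], of "norm c"] by simp
    then show "\<exists>l. integrable lborel l \<and> (\<integral>x. norm (indicator A x *\<^sub>R c - l x) \<partial>lborel) \<le> e \<and>
      (\<lambda>n. \<integral>x. norm (conv (\<eta> n) l x - l x) \<partial>lborel) \<longlonglongrightarrow> 0"
      using iU le by blast
  qed
next
  case (add k l)
  show ?case
  proof (rule real_tendsto_sandwich[OF _ _ tendsto_const])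
    show "\<forall>\<^sub>F n in sequentially. (\<integral>x. norm (conv (\<eta> n) (\<lambda>x. k x + l x) x - (k x + l x)) \<partial>lborel) \<le>
      (\<integral>x. norm (conv (\<eta> n) k x - k x) \<partial>lborel) + (\<integral>x. norm (conv (\<eta> n) l x - l x) \<partial>lborel)"
      using conv_L1_error_add[OF \<eta>(1) add(1,2)] by simp
    show "(\<lambda>n. (\<integral>x. norm (conv (\<eta> n) k x - k x) \<partial>lborel) + (\<integral>x. norm (conv (\<eta> n) l x - l x) \<partial>lborel)) \<longlonglongrightarrow> 0"
      using tendsto_add[OF add(3,4)] by simp
  qed (auto intro: integral_nonneg_AE)
next
  case (lim k s)
  show ?case
  proof (rule conv_L1_tendsto_approx[OF \<eta>(1) lim(4)])
    fix e :: real assume e: "0 < e"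
    have "(\<lambda>i. \<integral>x. norm (k x - s i x) \<partial>lborel) \<longlonglongrightarrow> (\<integral>x. 0 \<partial>(lborel::'a measure))"
    proof (rule integral_dominated_convergence)
      \<comment> \<open>The simple functions of the induction rule satisfy
        \<open>norm (s i x) \<le> 2 * norm (k x)\<close>; one more \<open>norm (k x)\<close> comes
        from the difference.\<close>
      show "integrable lborel (\<lambda>x. 3 * norm (k x))" using lim(4) by auto
      show "(\<lambda>x. norm (k x - s i x)) \<in> borel_measurable lborel" for i
        using lim(1)[of i] lim(4) by (auto dest!: borel_measurable_integrable)
      show "AE x in lborel. (\<lambda>i. norm (k x - s i x)) \<longlonglongrightarrow> 0"
        using lim(2) by (intro always_eventually allI tendsto_norm_zero)
          (auto intro!: tendsto_eq_intros)
      show "AE x in lborel. norm (norm (k x - s i x)) \<le> 3 * norm (k x)" for i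
      proof (intro always_eventually allI)
        fix x
        have "norm (k x - s i x) \<le> norm (k x) + norm (s i x)" by (rule norm_triangle_ineq4)
        then show "norm (norm (k x - s i x)) \<le> 3 * norm (k x)" using lim(3)[of x i] by simp
      qed
    qed auto
    then have "\<forall>\<^sub>F i in sequentially. (\<integral>x. norm (k x - s i x) \<partial>lborel) < e"
      using e by (intro order_tendstoD(2)) auto
    then obtain i where "(\<integral>x. norm (k x - s i x) \<partial>lborel) < e"
      unfolding eventually_sequentially by blast
    then show "\<exists>l. integrable lborel l \<and> (\<integral>x. norm (k x - l x) \<partial>lborel) \<le> e \<and>
      (\<lambda>n. \<integral>x. norm (conv (\<eta> n) l x - l x) \<partial>lborel) \<longlonglongrightarrow> 0"
      using lim(1,5) by (intro exI[of _ "s i"]) auto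
  qed
qed

section \<open>Variable exponents and \<open>C\<^sup>1\<close> test functions\<close>

lemma powr_le_one_plus_powr:
  fixes t a b :: real
  assumes "0 \<le> t" "0 \<le> a" "a \<le> b"
  shows "t powr a \<le> 1 + t powr b"
proof (cases "t \<le> 1")
  case True
  then have "t powr a \<le> 1" using assms powr_le1[of a t] by simp
  then show ?thesis by (simp add: add_increasing2)
next
  case False
  then have "t powr a \<le> t powr b" using assms by (intro powr_mono) auto
  then show ?thesis by simp
qed

text \<open>A crude Young inequality: replace the smaller of \<open>s\<close> and \<open>t\<close>
  by the larger. Its constant does not depend on \<open>q\<close>, so it is uniform over a variable
  exponent.\<close>

lemma powr_minus_one_mult_le:
  fixes s t q :: real
  assumes "0 \<le> s" "0 \<le> t" "1 \<le> q"
  shows "s powr (q - 1) * t \<le> s powr q + t powr q"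
proof (cases "s \<le> t")
  case True
  have "s powr (q - 1) * t \<le> t powr (q - 1) * t"
    using assms True by (intro mult_right_mono powr_mono2) auto
  also have "\<dots> = t powr q" using assms(2) by (cases "t = 0") (auto simp: powr_diff)
  finally show ?thesis by (simp add: add_increasing)
next
  case False
  have "s powr (q - 1) * t \<le> s powr (q - 1) * s"
    using assms False by (intro mult_left_mono) auto
  also have "\<dots> = s powr q" using assms(1) by (cases "s = 0") (auto simp: powr_diff)
  finally show ?thesis by (simp add: add_increasing2)
qed

text \<open>At \<open>a = 0\<close> both sides are 0, since \<open>0 powr\<close> any exponent is 0.
  The flux thus vanishes where the gradient does, also for exponents below 2.\<close>

lemma norm_powr_scaleR: "norm (norm a powr (q - 2) *\<^sub>R a) = norm a powr (q - 1)"
  by (cases "a = 0") (auto simp: powr_diff power2_eq_square powr_numeral)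

text \<open>Cauchy-Schwarz on the mixed terms reduces the claim to the scalar fact that
  \<open>t powr (q - 1)\<close> is nondecreasing in \<open>t\<close>.\<close>

lemma powr_monotone_operator:
  fixes a b :: "'a::real_inner"
  assumes "1 \<le> q"
  shows "0 \<le> (norm a powr (q - 2) *\<^sub>R a - norm b powr (q - 2) *\<^sub>R b) \<bullet> (a - b)"
proof -
  have 1: "norm c powr (q - 2) * norm c = norm c powr (q - 1)" for c :: 'a
    using norm_powr_scaleR[of c q] by simp
  have 2: "norm a powr (q - 2) * (a \<bullet> b) \<le> norm a powr (q - 1) * norm b"
    unfolding 1[symmetric] mult.assoc
    by (intro mult_left_mono norm_cauchy_schwarz) auto
  have 3: "norm b powr (q - 2) * (a \<bullet> b) \<le> norm b powr (q - 1) * norm a"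
    unfolding 1[symmetric] mult.assoc using norm_cauchy_schwarz[of a b]
    by (intro mult_left_mono) (auto simp: mult.commute)
  have 4: "norm c powr (q - 2) * (c \<bullet> c) = norm c powr (q - 1) * norm c" for c :: 'a
    by (simp add: 1[symmetric] power2_norm_eq_inner[symmetric] power2_eq_square)
  have "0 \<le> (norm a powr (q - 1) - norm b powr (q - 1)) * (norm a - norm b)"
  proof (cases "norm a \<le> norm b")
    case True
    then have "norm a powr (q - 1) \<le> norm b powr (q - 1)" using assms by (intro powr_mono2) auto
    then show ?thesis using True by (simp add: mult_nonpos_nonpos)
  next
    case False
    then have "norm b powr (q - 1) \<le> norm a powr (q - 1)" using assms by (intro powr_mono2) auto
    then show ?thesis using False by simp
  qed
  also have "\<dots> = norm a powr (q - 1) * norm a + norm b powr (q - 1) * norm b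
      - norm a powr (q - 1) * norm b - norm b powr (q - 1) * norm a"
    by (simp add: algebra_simps)
  also have "\<dots> \<le> norm a powr (q - 2) * (a \<bullet> a) + norm b powr (q - 2) * (b \<bullet> b)
      - norm a powr (q - 2) * (a \<bullet> b) - norm b powr (q - 2) * (a \<bullet> b)"
    using 2 3 by (simp add: 4)
  also have "\<dots> = (norm a powr (q - 2) *\<^sub>R a - norm b powr (q - 2) *\<^sub>R b) \<bullet> (a - b)"
    by (simp add: inner_diff_left inner_diff_right inner_commute[of b a] algebra_simps)
  finally show ?thesis .
qed

text \<open>Split at the level \<open>M = I powr (1 / p x)\<close>, where \<open>I\<close> is the mean of \<open>\<bar>g\<bar> powr p\<close> plus one: since
  \<open>t \<le> M + t powr p y * M powr (1 - p y)\<close>, averaging costs only a factor \<open>M powr (L * r)\<close>. This stays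
  bounded as \<open>r \<rightarrow> 0\<close>, because \<open>I\<close> grows at most like a power of \<open>1 / r\<close>.\<close>

lemma conv_variable_powr_bound:
  fixes g :: "'a::euclidean_space \<Rightarrow> 'a" and p :: "'a \<Rightarrow> real"
  assumes \<eta>: "mollifier \<eta> r" "\<And>z. \<eta> z \<le> C / r ^ DIM('a)" and r: "r \<le> 1" and C: "0 \<le> C"
    and g: "integrable lborel g" and h: "integrable lborel (\<lambda>y. norm (g y) powr p y)"
    and H: "(\<integral>y. norm (g y) powr p y \<partial>lborel) \<le> H"
    and p: "\<And>y. norm (x - y) < r \<Longrightarrow> p x - L * r \<le> p y" "\<And>y. norm (x - y) < r \<Longrightarrow> 1 \<le> p y"
      "1 \<le> p x" "p x \<le> P" and L: "0 \<le> L"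
  shows "norm (conv \<eta> g x) powr p x \<le>
    (1 + exp (L * (ln (C * H + 1) + DIM('a)))) powr P * (conv \<eta> (\<lambda>y. norm (g y) powr p y) x + 1)"
proof -
  define I where "I = conv \<eta> (\<lambda>y. norm (g y) powr p y) x + 1"
  define M where "M = I powr (1 / p x)"
  \<comment> \<open>An upper bound for \<open>M powr (1 - p y)\<close> that is uniform over the
    averaging ball: there \<open>p y\<close> is at least \<open>p x - L * r\<close>, and
    \<open>M\<close> is at least 1 thanks to the summand 1 in \<open>I\<close>.\<close>
  define T where "T = M powr (1 - p x + L * r)"
  define E where "E = exp (L * (ln (C * H + 1) + DIM('a)))"
  note r0 = mollifierD(1)[OF \<eta>(1)]
  note \<eta>0 = mollifierD(3)[OF \<eta>(1)]
  have ih: "integrable lborel (\<lambda>y. \<eta> (x - y) * (norm (g y) powr p y))"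
    using conv_integrable[OF \<eta>(1) h, of x] by simp
  have I1: "1 \<le> I" unfolding I_def conv_def by (auto intro!: integral_nonneg_AE simp: \<eta>0)
  have M1: "1 \<le> M" unfolding M_def using I1 p(3) by (intro ge_one_powr_ge_zero) auto
  have Mp: "M powr p x = I" unfolding M_def using I1 p(3) by (simp add: powr_powr)
  have pt: "\<eta> (x - y) * norm (g y) \<le> \<eta> (x - y) * M + T * (\<eta> (x - y) * (norm (g y) powr p y))" for y
  proof (cases "norm (x - y) < r")
    case True
    have "norm (g y) \<le> M + T * (norm (g y) powr p y)"
    proof (cases "norm (g y) \<le> M")
      case True
      have "0 \<le> T * (norm (g y) powr p y)" unfolding T_def by simp
      then show ?thesis using True by linarith
    next
      case False
      then have t: "M < norm (g y)" by simp
      then have t1: "0 < norm (g y)" using M1 by linarith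
      have "norm (g y) = norm (g y) powr (p y + (1 - p y))" using t1 by simp
      also have "\<dots> = norm (g y) powr p y * norm (g y) powr (1 - p y)" by (rule powr_add)
      also have "\<dots> \<le> norm (g y) powr p y * M powr (1 - p y)"
        using t M1 p(2)[OF True] by (intro mult_left_mono powr_mono2') auto
      also have "\<dots> \<le> norm (g y) powr p y * T"
        unfolding T_def using M1 p(1)[OF True] by (intro mult_left_mono powr_mono) auto
      finally show ?thesis using M1 by (simp add: mult.commute)
    qed
    from mult_left_mono[OF this \<eta>0[of "x - y"]] show ?thesis by (simp add: algebra_simps)
  qed (simp add: mollifierD(4)[OF \<eta>(1)])
  have "norm (conv \<eta> g x) \<le> (\<integral>y. \<eta> (x - y) * M + T * (\<eta> (x - y) * (norm (g y) powr p y)) \<partial>lborel)"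
    unfolding conv_def
  proof (rule Bochner_Integration.integral_norm_bound_integral)
    show "integrable lborel (\<lambda>y. \<eta> (x - y) *\<^sub>R g y)" by (rule conv_integrable[OF \<eta>(1) g])
    show "integrable lborel (\<lambda>y. \<eta> (x - y) * M + T * (\<eta> (x - y) * (norm (g y) powr p y)))"
      using ih mollifierD(10)[OF \<eta>(1), of x] by auto
    show "norm (\<eta> (x - y) *\<^sub>R g y) \<le> \<eta> (x - y) * M + T * (\<eta> (x - y) * (norm (g y) powr p y))" for y
      using pt[of y] \<eta>0[of "x - y"] by simp
  qed
  also have "\<dots> = M + T * (I - 1)"
    using ih mollifierD(10,11)[OF \<eta>(1), of x] by (simp add: I_def conv_def)
  also have "\<dots> \<le> M + T * I" unfolding T_def by (simp add: mult_left_mono)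
  also have "T * I = M powr (1 + L * r)" unfolding T_def Mp[symmetric] by (simp add: powr_add[symmetric])
  also have "\<dots> = M * M powr (L * r)" using M1 by (simp add: powr_add)
  finally have le: "norm (conv \<eta> g x) \<le> M * (1 + M powr (L * r))" by (simp add: algebra_simps)
  have "M powr (L * r) \<le> E"
  proof -
    have Lr: "0 \<le> L * r" using L r0 by simp
    have "0 \<le> (\<integral>y. norm (g y) powr p y \<partial>lborel)" by (intro integral_nonneg_AE) auto
    then have H0: "0 \<le> H" using H by linarith
    have rD: "0 < r ^ DIM('a)" "r ^ DIM('a) \<le> 1" using r0 r by (auto simp: power_le_one)
    have "M \<le> I powr 1" unfolding M_def using I1 p(3) by (intro powr_mono) auto
    then have MI: "M \<le> I" using I1 by simp
    have "conv \<eta> (\<lambda>y. norm (g y) powr p y) x \<le> (\<integral>y. C / r ^ DIM('a) * (norm (g y) powr p y) \<partial>lborel)"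
      unfolding conv_def real_scaleR_def using ih h \<eta>(2) by (intro integral_mono mult_right_mono) auto
    also have "\<dots> = C / r ^ DIM('a) * (\<integral>y. norm (g y) powr p y \<partial>lborel)" by simp
    also have "\<dots> \<le> C / r ^ DIM('a) * H" using H C rD by (intro mult_left_mono) auto
    finally have "I \<le> C * H / r ^ DIM('a) + 1" unfolding I_def by simp
    also have "\<dots> \<le> (C * H + 1) / r ^ DIM('a)" using rD by (simp add: add_divide_distrib)
    finally have Ile: "I \<le> (C * H + 1) / r ^ DIM('a)" .
    have CH: "1 \<le> C * H + 1" using C H0 by simp
    have "M powr (L * r) \<le> ((C * H + 1) / r ^ DIM('a)) powr (L * r)"
      using MI Ile M1 Lr by (intro powr_mono2) auto
    also have "\<dots> = exp (L * r * ln ((C * H + 1) / r ^ DIM('a)))"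
      using CH rD r0 by (simp add: powr_def)
    also have "ln ((C * H + 1) / r ^ DIM('a)) = ln (C * H + 1) + DIM('a) * ln (1 / r)"
      using CH rD r0 by (simp add: ln_div ln_realpow)
    also have "exp (L * r * (ln (C * H + 1) + DIM('a) * ln (1 / r))) \<le> E"
    proof -
      \<comment> \<open>Here the exponent beats the size: \<open>I\<close> may grow like
        \<open>1 / r ^ DIM('a)\<close>, but its logarithm is multiplied by \<open>L * r\<close>, and
        \<open>r * ln (1 / r)\<close> stays bounded.\<close>
      have "ln (1 / r) \<le> 1 / r" using r0 ln_le_minus_one[of "1 / r"] by simp
      then have 1: "r * ln (1 / r) \<le> 1" using r0 mult_left_mono[of "ln (1/r)" "1/r" r] by simp
      have "r * (ln (C * H + 1) + DIM('a) * ln (1 / r)) = r * ln (C * H + 1) + DIM('a) * (r * ln (1 / r))"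
        by (simp add: algebra_simps)
      also have "\<dots> \<le> 1 * ln (C * H + 1) + DIM('a) * 1"
        using r r0 CH 1 by (intro add_mono mult_right_mono mult_left_mono ln_ge_zero) auto
      finally have "L * (r * (ln (C * H + 1) + DIM('a) * ln (1 / r))) \<le> L * (ln (C * H + 1) + DIM('a))"
        using L by (intro mult_left_mono) auto
      then show ?thesis unfolding E_def by (simp add: mult.assoc)
    qed
    finally show ?thesis .
  qed
  with le M1 have "norm (conv \<eta> g x) \<le> M * (1 + E)"
    by (elim order_trans) (intro mult_left_mono, auto)
  then have "norm (conv \<eta> g x) powr p x \<le> (M * (1 + E)) powr p x"
    using p(3) by (intro powr_mono2) auto
  also have "\<dots> = I * (1 + E) powr p x" using M1 Mp by (simp add: powr_mult E_def)
  also have "\<dots> \<le> I * (1 + E) powr P" using I1 p(4) by (intro mult_left_mono powr_mono) (auto simp: E_def)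
  finally show ?thesis by (simp add: I_def E_def mult.commute)
qed

text \<open>The pointwise bound \<open>\<bar>F\<^sub>n - F\<bar> \<le> min \<bar>F\<^sub>n - F\<bar> (2 * G) + \<bar>G\<^sub>n - G\<bar>\<close> reduces the
  claim to the ordinary dominated convergence theorem.\<close>

lemma dominated_convergence_L1_bounds:
  fixes F :: "nat \<Rightarrow> 'a \<Rightarrow> real"
  assumes F: "\<And>n. integrable M (F n)" "integrable M F'" and G: "\<And>n. integrable M (G n)" "integrable M G'"
    and bound: "\<And>n. AE x in M. \<bar>F n x\<bar> \<le> G n x" "AE x in M. \<bar>F' x\<bar> \<le> G' x"
    and G_lim: "(\<lambda>n. \<integral>x. \<bar>G n x - G' x\<bar> \<partial>M) \<longlonglongrightarrow> 0"
    and F_lim: "AE x in M. (\<lambda>n. F n x) \<longlonglongrightarrow> F' x"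
  shows "(\<lambda>n. \<integral>x. F n x \<partial>M) \<longlonglongrightarrow> (\<integral>x. F' x \<partial>M)"
proof -
  define m where "m n x = min \<bar>F n x - F' x\<bar> (2 * \<bar>G' x\<bar>)" for n x
  note [measurable] = F[THEN borel_measurable_integrable] G[THEN borel_measurable_integrable]
  have m_meas[measurable]: "m n \<in> borel_measurable M" for n unfolding m_def by measurable
  have m_bound: "\<bar>m n x\<bar> \<le> 2 * \<bar>G' x\<bar>" for n x by (simp add: m_def)
  have m_int: "integrable M (m n)" for n
    by (rule Bochner_Integration.integrable_bound[where f="\<lambda>x. 2 * \<bar>G' x\<bar>"]) (use G m_bound in auto)
  have m_lim: "(\<lambda>n. \<integral>x. m n x \<partial>M) \<longlonglongrightarrow> (\<integral>x. 0 \<partial>M)"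
  proof (rule integral_dominated_convergence)
    show "integrable M (\<lambda>x. 2 * \<bar>G' x\<bar>)" using G by auto
    show "AE x in M. norm (m n x) \<le> 2 * \<bar>G' x\<bar>" for n using m_bound by simp
    show "AE x in M. (\<lambda>n. m n x) \<longlonglongrightarrow> 0"
      using F_lim
    proof eventually_elim
      case (elim x)
      then have "(\<lambda>n. min \<bar>F n x - F' x\<bar> (2 * \<bar>G' x\<bar>)) \<longlonglongrightarrow> min \<bar>F' x - F' x\<bar> (2 * \<bar>G' x\<bar>)"
        by (intro tendsto_intros)
      then show ?case by (simp add: m_def)
    qed
  qed auto
  have le: "\<bar>(\<integral>x. F n x \<partial>M) - (\<integral>x. F' x \<partial>M)\<bar> \<le> (\<integral>x. m n x \<partial>M) + (\<integral>x. \<bar>G n x - G' x\<bar> \<partial>M)" for n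
  proof -
    have "\<bar>(\<integral>x. F n x \<partial>M) - (\<integral>x. F' x \<partial>M)\<bar> = \<bar>\<integral>x. F n x - F' x \<partial>M\<bar>"
      using F by simp
    also have "\<dots> \<le> (\<integral>x. \<bar>F n x - F' x\<bar> \<partial>M)" by (rule integral_abs_bound)
    also have "\<dots> \<le> (\<integral>x. m n x + \<bar>G n x - G' x\<bar> \<partial>M)"
    proof (rule integral_mono_AE)
      \<comment> \<open>Because \<open>\<bar>F n - F'\<bar> \<le> G n + G' \<le> 2 * G' + \<bar>G n
        - G'\<bar>\<close>, whatever the truncation in \<open>m n\<close> cuts off is covered by the
        last term.\<close>
      show "AE x in M. \<bar>F n x - F' x\<bar> \<le> m n x + \<bar>G n x - G' x\<bar>"
        using bound(1)[of n] bound(2) by eventually_elim (auto simp: m_def)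
    qed (use F G m_int in auto)
    also have "\<dots> = (\<integral>x. m n x \<partial>M) + (\<integral>x. \<bar>G n x - G' x\<bar> \<partial>M)"
      using m_int G by simp
    finally show ?thesis .
  qed
  have "(\<lambda>n. (\<integral>x. F n x \<partial>M) - (\<integral>x. F' x \<partial>M)) \<longlonglongrightarrow> 0"
  proof (rule Lim_null_comparison)
    show "(\<lambda>n. (\<integral>x. m n x \<partial>M) + (\<integral>x. \<bar>G n x - G' x\<bar> \<partial>M)) \<longlonglongrightarrow> 0"
      using tendsto_add[OF m_lim G_lim] by simp
  qed (use le in auto)
  then show ?thesis by (rule LIM_zero_cancel)
qed

lemma mollifier_sequence:
  assumes "0 < s"
  obtains \<eta> :: "nat \<Rightarrow> 'a::euclidean_space \<Rightarrow> real" and r and C where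
    "\<And>n. mollifier (\<eta> n) (r n)" "r \<longlonglongrightarrow> 0" "\<And>n. r n \<le> s" "0 < C" "\<And>n x. \<eta> n x \<le> C / r n ^ DIM('a)"
proof -
  define r where "r n = s / real (Suc n)" for n
  obtain C where C: "C > 0" "\<And>r. r > 0 \<Longrightarrow> \<exists>\<eta>. mollifier (\<eta> :: 'a \<Rightarrow> real) r \<and> (\<forall>x. \<eta> x \<le> C / r ^ DIM('a))"
    using mollifier_exists by blast
  have "r n > 0" for n using assms by (simp add: r_def)
  then have "\<forall>n. \<exists>\<eta>. mollifier (\<eta> :: 'a \<Rightarrow> real) (r n) \<and> (\<forall>x. \<eta> x \<le> C / r n ^ DIM('a))"
    using C by blast
  then obtain \<eta> where "\<And>n. mollifier (\<eta> n :: 'a \<Rightarrow> real) (r n) \<and> (\<forall>x. \<eta> n x \<le> C / r n ^ DIM('a))"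
    by metis
  moreover have "r \<longlonglongrightarrow> 0"
    unfolding r_def using LIMSEQ_Suc[OF tendsto_divide_0[OF tendsto_const[of s] filterlim_at_top_imp_at_infinity[OF filterlim_real_sequentially]]]
    by simp
  moreover have "r n \<le> s" for n unfolding r_def using assms by (simp add: divide_le_eq)
  ultimately show thesis using that C(1) by blast
qed

text \<open>Mollify \<open>w\<close>; the gap \<open>R - \<rho>\<close> leaves room for the support
  to grow. The mollified \<open>w\<close> and \<open>W\<close> are uniformly bounded and, both being
  continuous, converge at every point, so dominated convergence works with merely integrable
  \<open>A\<close> and \<open>f\<close>.\<close>

lemma weak_form_C1_test:
  fixes A :: "'a::euclidean_space \<Rightarrow> 'a" and f w :: "'a \<Rightarrow> real"
  assumes A: "integrable lborel A" and f: "integrable lborel f"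
    and weak: "\<And>\<phi> N. smooth_fun \<phi> \<Longrightarrow> (\<And>x. R \<le> norm (x - x0) \<Longrightarrow> \<phi> x = 0) \<Longrightarrow>
      (\<And>x. (\<phi> has_derivative (\<lambda>h. N x \<bullet> h)) (at x)) \<Longrightarrow>
      (\<integral>x. A x \<bullet> N x \<partial>lborel) = - (\<integral>x. \<phi> x * f x \<partial>lborel)"
    and w: "\<And>x. (w has_derivative (\<lambda>h. W x \<bullet> h)) (at x)" "continuous_on UNIV W"
      "\<And>x. \<rho> \<le> norm (x - x0) \<Longrightarrow> w x = 0"
    and \<rho>: "\<rho> < R"
  shows "(\<integral>x. A x \<bullet> W x \<partial>lborel) = - (\<integral>x. w x * f x \<partial>lborel)"
proof -
  obtain \<eta> :: "nat \<Rightarrow> 'a \<Rightarrow> real" and r where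
    \<eta>: "\<And>n. mollifier (\<eta> n) (r n)" "r \<longlonglongrightarrow> 0" "\<And>n. r n \<le> R - \<rho>"
    using mollifier_sequence[of "R - \<rho>"] \<rho> by (metis diff_gt_0_iff_gt)
  have W0: "W x = 0" if "\<rho> \<le> norm (x - x0)" for x
    using gradient_zero_outside[OF w that] .
  have wc: "continuous_on UNIV w"
    using w(1) by (auto simp: continuous_on_eq_continuous_at intro: has_derivative_continuous)
  have wi: "integrable lborel w" and Wi: "integrable lborel W"
    using w(3) W0
    by (auto intro!: continuous_compact_support_integrable[of _ x0 \<rho>] wc w(2) simp: dist_norm norm_minus_commute)
  obtain b where b: "\<And>x. norm (w x) \<le> b" using compact_support_bounded[OF wc w(3)] by blast
  obtain B where B: "\<And>x. norm (W x) \<le> B" using compact_support_bounded[OF w(2) W0] by blast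
  have cb: "norm (conv (\<eta> n) w x) \<le> b" for n x
    using conv_close[OF \<eta>(1) wi, of x n 0 b] b by simp
  have cB: "norm (conv (\<eta> n) W x) \<le> B" for n x
    using conv_close[OF \<eta>(1) Wi, of x n 0 B] B by simp
  note [measurable] = borel_measurable_integrable[OF A] borel_measurable_integrable[OF f]
    conv_borel_measurable[OF \<eta>(1) borel_measurable_continuous_onI[OF wc]]
    conv_borel_measurable[OF \<eta>(1) borel_measurable_continuous_onI[OF w(2)]]
    borel_measurable_continuous_onI[OF wc] borel_measurable_continuous_onI[OF w(2)]
  have eq: "(\<integral>x. A x \<bullet> conv (\<eta> n) W x \<partial>lborel) = - (\<integral>x. conv (\<eta> n) w x * f x \<partial>lborel)" for n
  proof (rule weak)
    show "smooth_fun (conv (\<eta> n) w)"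
      by (rule smooth_fun_conv[OF mollifierD(2)[OF \<eta>(1)] mollifierD(4)[OF \<eta>(1)] wi])
    show "(conv (\<eta> n) w has_derivative (\<lambda>h. conv (\<eta> n) W x \<bullet> h)) (at x)" for x
      by (rule conv_has_gradient[OF \<eta>(1) w])
    fix x assume x: "R \<le> norm (x - x0)"
    show "conv (\<eta> n) w x = 0"
    proof (rule conv_zero[OF \<eta>(1)], rule w(3))
      fix y assume y: "norm (x - y) < r n"
      have "norm (x - x0) \<le> norm (x - y) + norm (y - x0)"
        using norm_triangle_ineq[of "x - y" "y - x0"] by simp
      then show "\<rho> \<le> norm (y - x0)" using x y \<eta>(3)[of n] by linarith
    qed
  qed
  have "(\<lambda>n. \<integral>x. A x \<bullet> conv (\<eta> n) W x \<partial>lborel) \<longlonglongrightarrow> (\<integral>x. A x \<bullet> W x \<partial>lborel)"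
  proof (rule integral_dominated_convergence)
    show "integrable lborel (\<lambda>x. norm (A x) * B)" using A by auto
    show "AE x in lborel. (\<lambda>n. A x \<bullet> conv (\<eta> n) W x) \<longlonglongrightarrow> A x \<bullet> W x"
      using w(2) by (intro always_eventually allI tendsto_intros conv_tendsto[OF \<eta>(1,2) Wi])
        (auto simp: continuous_on_eq_continuous_at)
    show "AE x in lborel. norm (A x \<bullet> conv (\<eta> n) W x) \<le> norm (A x) * B" for n
    proof (intro always_eventually allI)
      fix x
      show "norm (A x \<bullet> conv (\<eta> n) W x) \<le> norm (A x) * B"
        using order_trans[OF Cauchy_Schwarz_ineq2 mult_left_mono[OF cB norm_ge_zero]] by simp
    qed
  qed measurable
  moreover have "(\<lambda>n. - (\<integral>x. conv (\<eta> n) w x * f x \<partial>lborel)) \<longlonglongrightarrow> - (\<integral>x. w x * f x \<partial>lborel)"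
  proof (intro tendsto_minus integral_dominated_convergence)
    show "integrable lborel (\<lambda>x. b * \<bar>f x\<bar>)" using f by auto
    show "AE x in lborel. (\<lambda>n. conv (\<eta> n) w x * f x) \<longlonglongrightarrow> w x * f x"
      using wc by (intro always_eventually allI tendsto_intros conv_tendsto[OF \<eta>(1,2) wi])
        (auto simp: continuous_on_eq_continuous_at)
    show "AE x in lborel. norm (conv (\<eta> n) w x * f x) \<le> b * \<bar>f x\<bar>" for n
      using cb by (intro always_eventually allI) (simp add: abs_mult mult_right_mono)
  qed measurable
  ultimately show ?thesis unfolding eq using LIMSEQ_unique by blast
qed

lemma linear_Basis_expansion:
  fixes D :: "'a::euclidean_space \<Rightarrow> 'b::real_vector"
  assumes "linear D"
  shows "D h = (\<Sum>j\<in>Basis. (h \<bullet> j) *\<^sub>R D j)"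
proof -
  have "D h = D (\<Sum>j\<in>Basis. (h \<bullet> j) *\<^sub>R j)" by (simp add: euclidean_representation)
  also have "\<dots> = (\<Sum>j\<in>Basis. (h \<bullet> j) *\<^sub>R D j)"
    by (simp only: linear_sum[OF assms] linear_scale[OF assms])
  finally show ?thesis .
qed

lemma continuous_on_extend_zero:
  fixes F :: "'a::euclidean_space \<Rightarrow> 'b::topological_space"
  assumes "continuous_on (ball x0 R) F" "\<And>x. \<rho> \<le> norm (x - x0) \<Longrightarrow> F x = c" "\<rho> < R"
  shows "continuous_on UNIV F"
proof -
  have "open {x. \<rho> < norm (x - x0)}" by (intro open_Collect_less continuous_intros)
  moreover have "continuous_on {x. \<rho> < norm (x - x0)} F"
    using assms(2) by (intro continuous_on_eq[OF continuous_on_const[of _ c]]) auto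
  ultimately have "continuous_on (ball x0 R \<union> {x. \<rho> < norm (x - x0)}) F"
    using assms(1) by (intro continuous_on_open_Un) auto
  moreover have "ball x0 R \<union> {x. \<rho> < norm (x - x0)} = UNIV"
    using assms(3) by (auto simp: dist_norm norm_minus_commute)
  ultimately show ?thesis by simp
qed

lemma has_derivative_zero_outside:
  fixes F :: "'a::euclidean_space \<Rightarrow> real"
  assumes "\<And>x. \<rho> \<le> norm (x - x0) \<Longrightarrow> F x = 0" "\<rho> < norm (x - x0)"
  shows "(F has_derivative (\<lambda>h. 0)) (at x)"
proof -
  have "open {x. \<rho> < norm (x - x0)}" by (intro open_Collect_less continuous_intros)
  then show ?thesis
    by (rule has_derivative_transform_within_open[OF has_derivative_const[of 0]]) (use assms in auto)
qed

text \<open>For each basis vector \<open>i\<close>, the function \<open>w * (V \<bullet> i)\<close>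
  is C^1 with compact support, so its gradient \<open>\<Theta> i\<close> integrates to zero; sum the
  \<open>i\<close>-th components. \<open>V\<close> is controlled on the ball only, and the gap
  between \<open>\<rho>\<close> and \<open>R\<close> lets the products with \<open>w\<close> be
  extended by zero.\<close>

lemma integral_by_parts_divergence:
  fixes V :: "'a::euclidean_space \<Rightarrow> 'a" and w :: "'a \<Rightarrow> real"
  assumes w: "\<And>x. (w has_derivative (\<lambda>h. W x \<bullet> h)) (at x)" "continuous_on UNIV W"
      "\<And>x. \<rho> \<le> norm (x - x0) \<Longrightarrow> w x = 0"
    and \<rho>: "\<rho> < R"
    and V: "\<And>x. x \<in> ball x0 R \<Longrightarrow> (V has_derivative DV x) (at x)"
      "\<And>i. i \<in> Basis \<Longrightarrow> continuous_on (ball x0 R) (\<lambda>x. DV x i)"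
  shows "integrable lborel (\<lambda>x. V x \<bullet> W x)" "integrable lborel (\<lambda>x. w x * (\<Sum>i\<in>Basis. DV x i \<bullet> i))"
    "(\<integral>x. V x \<bullet> W x \<partial>lborel) = - (\<integral>x. w x * (\<Sum>i\<in>Basis. DV x i \<bullet> i) \<partial>lborel)"
proof -
  have W0: "W x = 0" if "\<rho> \<le> norm (x - x0)" for x
    using gradient_zero_outside[OF w that] .
  have wc: "continuous_on UNIV w"
    using w(1) by (auto simp: continuous_on_eq_continuous_at intro: has_derivative_continuous)
  have Vc: "continuous_on (ball x0 R) V"
    by (intro continuous_at_imp_continuous_on ballI has_derivative_continuous[OF V(1)])
  have integrable_ext: "integrable lborel F"
    if "continuous_on (ball x0 R) F" "\<And>x. \<rho> \<le> norm (x - x0) \<Longrightarrow> F x = 0" for F :: "'a \<Rightarrow> real"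
    using that by (intro continuous_compact_support_integrable[of _ x0 \<rho>] continuous_on_extend_zero[OF that \<rho>])
      (auto simp: dist_norm norm_minus_commute)
  show 1: "integrable lborel (\<lambda>x. V x \<bullet> W x)"
    by (rule integrable_ext) (auto intro!: continuous_intros Vc continuous_on_subset[OF w(2)] simp: W0)
  show 2: "integrable lborel (\<lambda>x. w x * (\<Sum>i\<in>Basis. DV x i \<bullet> i))"
    by (rule integrable_ext) (auto intro!: continuous_intros V(2) continuous_on_subset[OF wc] simp: w(3))
  define \<Theta> where "\<Theta> i x = (V x \<bullet> i) *\<^sub>R W x + w x *\<^sub>R (\<Sum>j\<in>Basis. (DV x j \<bullet> i) *\<^sub>R j)" for i x
  have \<Theta>0: "\<Theta> i x = 0" if "\<rho> \<le> norm (x - x0)" for i x using that by (simp add: \<Theta>_def W0 w(3))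
  have \<Theta>c: "continuous_on UNIV (\<Theta> i)" for i
  proof (rule continuous_on_extend_zero[OF _ \<Theta>0 \<rho>])
    show "continuous_on (ball x0 R) (\<Theta> i)"
      unfolding \<Theta>_def
      by (intro continuous_intros Vc V(2) continuous_on_subset[OF w(2)] continuous_on_subset[OF wc]) auto
  qed
  have der: "((\<lambda>x. w x * (V x \<bullet> i)) has_derivative (\<lambda>h. \<Theta> i x \<bullet> h)) (at x)" for i x
  proof (cases "x \<in> ball x0 R")
    case True
    have lin: "DV x h \<bullet> i = (\<Sum>j\<in>Basis. (DV x j \<bullet> i) *\<^sub>R j) \<bullet> h" for h
    proof -
      have "linear (DV x)" using V(1)[OF True] has_derivative_linear by blast
      then have "DV x h = (\<Sum>j\<in>Basis. (h \<bullet> j) *\<^sub>R DV x j)" by (rule linear_Basis_expansion)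
      then show ?thesis unfolding inner_sum_scaleR_eq by (simp add: inner_sum_left)
    qed
    have "((\<lambda>x. w x * (V x \<bullet> i)) has_derivative (\<lambda>h. w x * (DV x h \<bullet> i) + (W x \<bullet> h) * (V x \<bullet> i))) (at x)"
      by (intro has_derivative_mult w has_derivative_inner_left V True)
    moreover have "w x * (DV x h \<bullet> i) + (W x \<bullet> h) * (V x \<bullet> i) = \<Theta> i x \<bullet> h" for h
      unfolding \<Theta>_def inner_add_left inner_scaleR_left
      by (subst lin[of h]) (simp only: mult.commute add.commute)
    ultimately show ?thesis by (simp only:)
  next
    case False
    then have x: "\<rho> < norm (x - x0)" using \<rho> by (simp add: dist_norm norm_minus_commute)
    then have "\<Theta> i x = 0" by (intro \<Theta>0) simp
    then show ?thesis
      using has_derivative_zero_outside[of \<rho> x0 "\<lambda>x. w x * (V x \<bullet> i)", OF _ x] by (simp add: w(3))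
  qed
  have \<Theta>i: "integrable lborel (\<Theta> i)" for i
    using \<Theta>0 by (intro continuous_compact_support_integrable[of _ x0 \<rho>] \<Theta>c) (auto simp: dist_norm norm_minus_commute)
  have \<Theta>z: "(\<integral>x. \<Theta> i x \<partial>lborel) = 0" for i
    by (rule integral_gradient_zero[OF der \<Theta>c, of \<rho> x0]) (simp add: w(3))
  have "V x \<bullet> W x + w x * (\<Sum>i\<in>Basis. DV x i \<bullet> i) = (\<Sum>i\<in>Basis. \<Theta> i x \<bullet> i)" for x
    unfolding \<Theta>_def euclidean_inner[of "V x" "W x"]
    by (simp add: inner_add_left sum.distrib sum_distrib_left inner_sum_left_Basis)
  then have "(\<integral>x. V x \<bullet> W x + w x * (\<Sum>i\<in>Basis. DV x i \<bullet> i) \<partial>lborel) = (\<integral>x. (\<Sum>i\<in>Basis. \<Theta> i x \<bullet> i) \<partial>lborel)"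
    by simp
  also have "\<dots> = (\<Sum>i\<in>Basis. \<integral>x. \<Theta> i x \<bullet> i \<partial>lborel)"
    using \<Theta>i by (intro Bochner_Integration.integral_sum) auto
  also have "\<dots> = 0" using \<Theta>i by (simp add: \<Theta>z)
  finally show "(\<integral>x. V x \<bullet> W x \<partial>lborel) = - (\<integral>x. w x * (\<Sum>i\<in>Basis. DV x i \<bullet> i) \<partial>lborel)"
    using 1 2 by simp
qed

section \<open>Comparison with strict classical supersolutions\<close>

lemma has_real_derivative_square_pos_part:
  "((\<lambda>t. (max 0 t)\<^sup>2) has_real_derivative 2 * max 0 t) (at t)"
proof (cases t "0::real" rule: linorder_cases)
  case less
  have "((\<lambda>t. (max 0 t)\<^sup>2) has_real_derivative 0) (at t)"
  proof (rule DERIV_cong_ev[THEN iffD2, OF refl _ refl])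
    show "\<forall>\<^sub>F x in nhds t. (max 0 x)\<^sup>2 = 0"
      using eventually_nhds_in_open[of "{..<0}" t] less by (auto elim!: eventually_mono)
  qed auto
  then show ?thesis using less by simp
next
  case greater
  have "((\<lambda>t. (max 0 t)\<^sup>2) has_real_derivative 2 * t) (at t)"
  proof (rule DERIV_cong_ev[THEN iffD2, OF refl _ refl])
    show "\<forall>\<^sub>F x in nhds t. (max 0 x)\<^sup>2 = x\<^sup>2"
      using eventually_nhds_in_open[of "{0<..}" t] greater by (auto elim!: eventually_mono)
  qed (auto intro!: derivative_eq_intros)
  then show ?thesis using greater by simp
next
  case equal
  have "((\<lambda>y. (max 0 y)\<^sup>2 / y) \<longlongrightarrow> 0) (at (0::real))"
  proof (rule Lim_null_comparison)
    show "\<forall>\<^sub>F y in at 0. norm ((max 0 y)\<^sup>2 / y) \<le> \<bar>y :: real\<bar>"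
      by (intro always_eventually allI) (auto simp: max_def power2_eq_square)
    show "((\<lambda>y. \<bar>y :: real\<bar>) \<longlongrightarrow> 0) (at 0)" by (auto intro!: tendsto_eq_intros)
  qed
  then show ?thesis using equal by (simp add: DERIV_def)
qed

text \<open>The right-hand side is affine in \<open>S\<close>, the majorant of
  \<open>norm k powr q\<close>. Taking for \<open>S\<close> an affine function of the mollified
  energy, L^1 convergence of that energy carries over to the dominating functions.\<close>

lemma flux_bound:
  fixes a k G V :: "'a::euclidean_space"
  assumes q: "1 \<le> q" and V: "norm V \<le> cV" and G: "norm G \<le> cG" and S: "norm k powr q \<le> S"
  shows "\<bar>(norm a powr (q - 2) *\<^sub>R a - V) \<bullet> (k - G)\<bar> \<le>
    (norm a powr q + S) + cG * (1 + norm a powr q) + cV * (1 + S) + cV * cG"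
proof -
  define t where "t = norm a powr (q - 1)"
  have 1: "t * norm k \<le> norm a powr q + norm k powr q"
    unfolding t_def using q by (intro powr_minus_one_mult_le) auto
  have 2: "t \<le> 1 + norm a powr q" unfolding t_def using q by (intro powr_le_one_plus_powr) auto
  have 3: "norm k \<le> 1 + S" using powr_le_one_plus_powr[of "norm k" 1 q] q S by simp
  have t0: "0 \<le> t" unfolding t_def by simp
  have cV0: "0 \<le> cV" using V norm_ge_zero order_trans by blast
  have cG0: "0 \<le> cG" using G norm_ge_zero order_trans by blast
  have "\<bar>(norm a powr (q - 2) *\<^sub>R a - V) \<bullet> (k - G)\<bar> \<le> norm (norm a powr (q - 2) *\<^sub>R a - V) * norm (k - G)"
    by (rule Cauchy_Schwarz_ineq2)
  also have "\<dots> \<le> (t + cV) * (norm k + cG)"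
  proof (intro mult_mono)
    show "norm (norm a powr (q - 2) *\<^sub>R a - V) \<le> t + cV"
      using norm_triangle_ineq4[of "norm a powr (q - 2) *\<^sub>R a" V] V unfolding norm_powr_scaleR t_def by linarith
    show "norm (k - G) \<le> norm k + cG" using norm_triangle_ineq4[of k G] G by linarith
  qed (use t0 cV0 in auto)
  also have "\<dots> = t * norm k + cG * t + cV * norm k + cV * cG" by (simp add: algebra_simps)
  also have "\<dots> \<le> (norm a powr q + S) + cG * (1 + norm a powr q) + cV * (1 + S) + cV * cG"
    using 1 S by (intro add_mono mult_left_mono 2 3 cG0 cV0) auto
  finally show ?thesis .
qed

lemma AE_lborel_not_open:
  fixes U :: "'a::euclidean_space set"
  assumes "open U" "AE x in lborel. x \<notin> U"
  shows "U = {}"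
proof (rule ccontr)
  assume "U \<noteq> {}"
  then obtain x e where e: "0 < e" "ball x e \<subseteq> U" using assms(1) by (meson all_not_in_conv openE)
  have "AE y in lborel. y \<notin> ball x e" using assms(2) by eventually_elim (use e in auto)
  then have "ball x e \<in> null_sets lborel" by (subst AE_iff_null_sets) auto
  then have "measure lborel (ball x e) = 0" by (auto simp: null_sets_def measure_def)
  then show False using content_ball_gt_0_iff[of x e] e by simp
qed

lemma compact_bound_indicator:
  fixes F :: "'a::euclidean_space \<Rightarrow> 'b::euclidean_space"
  assumes "continuous_on K F" "compact K" "B \<subseteq> K"
  obtains c where "0 \<le> c" "\<And>x. norm (indicator B x *\<^sub>R F x) \<le> c"
proof -
  have "bounded (F ` K)" by (intro compact_imp_bounded compact_continuous_image assms)
  then obtain c where c: "0 < c" "\<And>x. x \<in> K \<Longrightarrow> norm (F x) \<le> c" by (auto simp: bounded_pos)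
  show thesis
    by (rule that[of c]) (use c assms(3) in \<open>auto simp: indicator_def\<close>)
qed

lemma borel_measurable_indicator_continuous:
  fixes F :: "'a::euclidean_space \<Rightarrow> 'b::euclidean_space"
  assumes "continuous_on K F" "B \<subseteq> K" "B \<in> sets borel"
  shows "(\<lambda>x. indicator B x *\<^sub>R F x) \<in> borel_measurable borel"
  using borel_measurable_continuous_on_indicator[OF assms(3) continuous_on_subset[OF assms(1,2)]] .

text \<open>Differentiation falls on the kernel, and the weak gradient is then tested with
  \<open>y \<mapsto> \<eta> (y - x)\<close>, which is supported in the ball of radius
  \<open>R + s\<close> because \<open>r \<le> s\<close>. Evenness of \<open>\<eta>\<close>, hence
  oddness of \<open>N\<close>, settles the signs.\<close>

lemma conv_has_weak_gradient:
  fixes u :: "'a::euclidean_space \<Rightarrow> real" and g :: "'a \<Rightarrow> 'a"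
  assumes \<eta>: "mollifier \<eta> r" and u: "integrable lborel u"
    and wg: "\<And>\<phi> N. smooth_fun \<phi> \<Longrightarrow> (\<And>y. R + s \<le> norm (y - x0) \<Longrightarrow> \<phi> y = 0) \<Longrightarrow>
      (\<And>y. (\<phi> has_derivative (\<lambda>h. N y \<bullet> h)) (at y)) \<Longrightarrow>
      (\<integral>y. u y *\<^sub>R N y \<partial>lborel) = - (\<integral>y. \<phi> y *\<^sub>R g y \<partial>lborel)"
    and r: "r \<le> s"
  shows "x \<in> ball x0 R \<Longrightarrow> (conv \<eta> u has_derivative (\<lambda>h. conv \<eta> g x \<bullet> h)) (at x)"
    and "continuous_on (ball x0 R) (conv \<eta> g)"
proof -
  obtain N where N: "\<And>x. (\<eta> has_derivative (\<lambda>h. N x \<bullet> h)) (at x)" "continuous_on UNIV N"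
    using smooth_fun_gradient[OF mollifierD(2)[OF \<eta>]] by blast
  have \<eta>0: "\<eta> z = 0" if "r \<le> norm (z - 0)" for z using mollifierD(4)[OF \<eta>, of z] that by simp
  have N0: "N z = 0" if "r \<le> norm (z - 0)" for z using gradient_zero_outside[OF N \<eta>0 that] .
  have odd: "N (- z) = - N z" for z
  proof -
    have "((\<lambda>z. \<eta> (- z)) has_derivative (\<lambda>h. N (- z) \<bullet> (- h))) (at z)"
      by (rule has_derivative_compose[OF _ N(1)]) (auto intro!: derivative_eq_intros)
    then have "(\<eta> has_derivative (\<lambda>h. N (- z) \<bullet> (- h))) (at z)"
      by (simp add: mollifierD(5)[OF \<eta>])
    then have "(\<lambda>h. N (- z) \<bullet> (- h)) = (\<lambda>h. N z \<bullet> h)"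
      by (rule has_derivative_unique[OF _ N(1)])
    then have "N (- z) \<bullet> (- h) = N z \<bullet> h" for h by (rule fun_cong)
    then have "(N (- z) + N z) \<bullet> h = 0" for h
      unfolding inner_add_left by (simp flip: \<open>\<And>h. N (- z) \<bullet> (- h) = N z \<bullet> h\<close>)
    from this[of "N (- z) + N z"] show ?thesis by (simp only: inner_eq_zero_iff eq_neg_iff_add_eq_0)
  qed
  have grad: "(\<integral>y. u y *\<^sub>R N (x - y) \<partial>lborel) = conv \<eta> g x" if x: "x \<in> ball x0 R" for x
  proof -
    have "(\<integral>y. u y *\<^sub>R N (y - x) \<partial>lborel) = - (\<integral>y. \<eta> (y - x) *\<^sub>R g y \<partial>lborel)"
    proof (rule wg)
      show "smooth_fun (\<lambda>y. \<eta> (y - x))" by (rule smooth_fun_shift[OF mollifierD(2)[OF \<eta>]])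
      show "((\<lambda>y. \<eta> (y - x)) has_derivative (\<lambda>h. N (y - x) \<bullet> h)) (at y)" for y
        by (rule has_derivative_compose[OF _ N(1), of "\<lambda>y. y - x", simplified]) (auto intro!: derivative_eq_intros)
      fix y assume y: "R + s \<le> norm (y - x0)"
      have "norm (y - x0) \<le> norm (y - x) + norm (x - x0)" using norm_triangle_ineq[of "y - x" "x - x0"] by simp
      then show "\<eta> (y - x) = 0"
        using x y r by (intro mollifierD(4)[OF \<eta>]) (simp add: dist_norm norm_minus_commute)
    qed
    moreover have "N (y - x) = - N (x - y)" "\<eta> (y - x) = \<eta> (x - y)" for y
      using odd[of "x - y"] mollifierD(5)[OF \<eta>, of "x - y"] by auto
    ultimately show ?thesis by (simp add: conv_def)
  qed
  have conv_eq: "conv \<eta> u = (\<lambda>x. \<integral>y. u y * \<eta> (x - y) \<partial>lborel)"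
    by (auto simp: conv_def mult.commute)
  show "(conv \<eta> u has_derivative (\<lambda>h. conv \<eta> g x \<bullet> h)) (at x)" if "x \<in> ball x0 R"
    unfolding grad[OF that, symmetric] conv_eq
    by (rule integral_translate_has_gradient[where r = r and a = 0, OF N \<eta>0 u])
  have "continuous_on (ball x0 R) (\<lambda>x. \<integral>y. u y *\<^sub>R N (x - y) \<partial>lborel)"
    by (rule continuous_on_subset[OF continuous_integral_translate[where r = r and a = 0, OF u N(2) N0]]) auto
  then show "continuous_on (ball x0 R) (conv \<eta> g)"
    using grad by (rule continuous_on_eq)
qed

text \<open>The heart of the proof. \<open>Q < f\<close> says that \<open>\<psi>\<close> is a strict
  classical supersolution in the inner ball. The margin \<open>\<delta>\<close> on the collar
  outside radius \<open>\<rho>\<close> survives mollification of \<open>u\<close>, so all test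
  functions have support in one fixed smaller ball. Cutting the data off to \<open>K\<close> and
  taking Borel versions places everything on the whole space, where convolution is defined.\<close>

lemma weak_solution_comparison:
  fixes u \<psi> p f Q :: "'a::euclidean_space \<Rightarrow> real" and g G V :: "'a \<Rightarrow> 'a"
  defines "A \<equiv> \<lambda>x. norm (g x) powr (p x - 2) *\<^sub>R g x"
  assumes R: "0 < R" and \<rho>: "\<rho> < R" and K: "K = cball x0 (2 * R)"
    and u: "continuous_on K u"
    and p: "p \<in> borel_measurable borel" "\<And>x. 1 \<le> p x" "\<And>x. p x \<le> P"
      "\<And>x y. x \<in> K \<Longrightarrow> y \<in> K \<Longrightarrow> p x - p y \<le> L * norm (x - y)" "0 \<le> L"
    and g: "g \<in> borel_measurable borel" "\<And>x. x \<notin> K \<Longrightarrow> g x = 0" "integrable lborel (\<lambda>x. norm (g x) powr p x)"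
    and f: "continuous_on K f"
    and wg: "\<And>\<phi> N. smooth_fun \<phi> \<Longrightarrow> (\<And>x. 2 * R \<le> norm (x - x0) \<Longrightarrow> \<phi> x = 0) \<Longrightarrow>
      (\<And>x. (\<phi> has_derivative (\<lambda>h. N x \<bullet> h)) (at x)) \<Longrightarrow>
      (\<integral>x. (indicator K x * u x) *\<^sub>R N x \<partial>lborel) = - (\<integral>x. \<phi> x *\<^sub>R g x \<partial>lborel)"
    and we: "\<And>\<phi> N. smooth_fun \<phi> \<Longrightarrow> (\<And>x. 2 * R \<le> norm (x - x0) \<Longrightarrow> \<phi> x = 0) \<Longrightarrow>
      (\<And>x. (\<phi> has_derivative (\<lambda>h. N x \<bullet> h)) (at x)) \<Longrightarrow>
      (\<integral>x. A x \<bullet> N x \<partial>lborel) = - (\<integral>x. \<phi> x * (indicator K x * f x) \<partial>lborel)"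
    and \<psi>: "\<And>x. x \<in> K \<Longrightarrow> (\<psi> has_derivative (\<lambda>h. G x \<bullet> h)) (at x)" "continuous_on K G"
    and V: "\<And>x. V x = norm (G x) powr (p x - 2) *\<^sub>R G x" "\<And>x. x \<in> K \<Longrightarrow> (V has_derivative DV x) (at x)"
      "\<And>i. i \<in> Basis \<Longrightarrow> continuous_on K (\<lambda>x. DV x i)"
    and Q: "\<And>x. Q x = (\<Sum>i\<in>Basis. DV x i \<bullet> i)"
    and strict: "\<And>x. x \<in> ball x0 R \<Longrightarrow> Q x < f x"
    and sep: "0 < \<delta>" "\<And>x. \<rho> \<le> norm (x - x0) \<Longrightarrow> x \<in> cball x0 R \<Longrightarrow> u x \<le> \<psi> x - \<delta>"
  shows "\<forall>x\<in>ball x0 R. u x \<le> \<psi> x"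
proof -
  define B where "B = ball x0 R"
  have compK: "compact K" and BK: "B \<subseteq> K" and B_meas[measurable]: "B \<in> sets borel" and K_meas[measurable]: "K \<in> sets borel"
    using R by (auto simp: K B_def)
  have B_fin: "integrable lborel (indicator B :: 'a \<Rightarrow> real)"
    unfolding B_def using emeasure_lborel_ball_finite[of x0 R] by (intro integrable_real_indicator) auto
  have K_fin: "integrable lborel (indicator K :: 'a \<Rightarrow> real)"
    unfolding K using emeasure_lborel_cball_finite[of x0 "2 * R"] by (intro integrable_real_indicator) auto
  define u' where "u' x = indicator K x * u x" for x
  define f' where "f' x = indicator K x * f x" for x
  define h where "h x = norm (g x) powr p x" for x
  define \<psi>' where "\<psi>' x = indicator B x *\<^sub>R \<psi> x" for x
  define G' where "G' x = indicator B x *\<^sub>R G x" for x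
  define V' where "V' x = indicator B x *\<^sub>R V x" for x
  define Q' where "Q' x = indicator B x *\<^sub>R Q x" for x
  have \<psi>c: "continuous_on K \<psi>"
    by (intro continuous_at_imp_continuous_on ballI has_derivative_continuous[OF \<psi>(1)])
  have Vc: "continuous_on K V"
    by (intro continuous_at_imp_continuous_on ballI has_derivative_continuous[OF V(2)])
  have Qc: "continuous_on K Q" unfolding Q by (intro continuous_intros V(3))
  have u'i: "integrable lborel u'" unfolding u'_def using borel_integrable_compact[OF compK u] by simp
  have f'i: "integrable lborel f'" unfolding f'_def using borel_integrable_compact[OF compK f] by simp
  have hi: "integrable lborel h" unfolding h_def by (rule g(3))
  have h0: "0 \<le> h x" for x by (simp add: h_def)
  note [measurable] = p(1) g(1) borel_measurable_integrable[OF u'i] borel_measurable_integrable[OF f'i]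
    borel_measurable_integrable[OF hi]
  have [measurable]: "\<psi>' \<in> borel_measurable borel" "G' \<in> borel_measurable borel"
      "V' \<in> borel_measurable borel" "Q' \<in> borel_measurable borel"
    unfolding \<psi>'_def G'_def V'_def Q'_def
    by (intro borel_measurable_indicator_continuous[OF _ BK B_meas] \<psi>c \<psi>(2) Vc Qc)+
  have A_meas[measurable]: "A \<in> borel_measurable borel" unfolding A_def by measurable
  obtain cu where cu: "0 \<le> cu" "\<And>x. norm (u' x) \<le> cu"
    using compact_bound_indicator[OF u compK order_refl] unfolding u'_def by (metis real_scaleR_def)
  obtain cf where cf: "0 \<le> cf" "\<And>x. norm (f' x) \<le> cf"
    using compact_bound_indicator[OF f compK order_refl] unfolding f'_def by (metis real_scaleR_def)
  obtain c\<psi> where c\<psi>: "0 \<le> c\<psi>" "\<And>x. norm (\<psi>' x) \<le> c\<psi>"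
    using compact_bound_indicator[OF \<psi>c compK BK] unfolding \<psi>'_def by metis
  obtain cG where cG: "0 \<le> cG" "\<And>x. norm (G' x) \<le> cG"
    using compact_bound_indicator[OF \<psi>(2) compK BK] unfolding G'_def by metis
  obtain cV where cV: "0 \<le> cV" "\<And>x. norm (V' x) \<le> cV"
    using compact_bound_indicator[OF Vc compK BK] unfolding V'_def by metis
  obtain cQ where cQ: "0 \<le> cQ" "\<And>x. norm (Q' x) \<le> cQ"
    using compact_bound_indicator[OF Qc compK BK] unfolding Q'_def by metis
  have gi: "integrable lborel g"
  proof (rule Bochner_Integration.integrable_bound)
    show "integrable lborel (\<lambda>x. indicator K x + h x)" using K_fin hi by simp
    show "AE x in lborel. norm (g x) \<le> norm (indicator K x + h x)"
    proof (intro always_eventually allI)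
      fix x
      show "norm (g x) \<le> norm (indicator K x + h x)"
        using powr_le_one_plus_powr[of "norm (g x)" 1 "p x"] p(2)[of x] g(2)[of x]
        by (cases "x \<in> K") (auto simp: h_def)
    qed
  qed measurable
  have Ai: "integrable lborel A"
  proof (rule Bochner_Integration.integrable_bound)
    show "integrable lborel (\<lambda>x. indicator K x + h x)" using K_fin hi by simp
    show "AE x in lborel. norm (A x) \<le> norm (indicator K x + h x)"
    proof (intro always_eventually allI)
      fix x
      show "norm (A x) \<le> norm (indicator K x + h x)"
        using powr_le_one_plus_powr[of "norm (g x)" "p x - 1" "p x"] p(2)[of x] g(2)[of x]
        unfolding A_def norm_powr_scaleR by (cases "x \<in> K") (auto simp: h_def)
    qed
  qed measurable

  \<comment> \<open>Mollifiers along a subsequence for which the gradients converge almost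
    everywhere\<close>
  obtain \<eta>0 :: "nat \<Rightarrow> 'a \<Rightarrow> real" and r0 C where
    \<eta>0: "\<And>n. mollifier (\<eta>0 n) (r0 n)" "r0 \<longlonglongrightarrow> 0" "\<And>n. r0 n \<le> min R 1" "0 < C"
      "\<And>n x. \<eta>0 n x \<le> C / r0 n ^ DIM('a)"
    using mollifier_sequence[where 'a='a and s="min R 1"] R by (metis min_less_iff_conj zero_less_one)
  have "\<exists>s::nat\<Rightarrow>nat. strict_mono s \<and> (AE x in lborel. (\<lambda>n. conv (\<eta>0 (s n)) g x - g x) \<longlonglongrightarrow> 0)"
    using conv_L1_contraction(1)[OF \<eta>0(1) gi] gi
    by (intro tendsto_L1_AE_subseq[of lborel "\<lambda>n x. conv (\<eta>0 n) g x - g x"] conv_L1_tendsto[OF \<eta>0(1,2) gi]) auto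
  then obtain s :: "nat \<Rightarrow> nat" where s: "strict_mono s" "AE x in lborel. (\<lambda>n. conv (\<eta>0 (s n)) g x - g x) \<longlonglongrightarrow> 0"
    by blast
  have "uniformly_continuous_on K u" by (rule compact_uniformly_continuous[OF u compK])
  \<comment> \<open>Averages over radii below \<open>d\<close> move \<open>u\<close> by at most
    \<open>\<delta> / 2\<close>, half of the margin. The shift by \<open>N0\<close> below ensures
    this for every \<open>n\<close>.\<close>
  then obtain d where d: "0 < d" "\<And>x y. x \<in> K \<Longrightarrow> y \<in> K \<Longrightarrow> dist y x < d \<Longrightarrow> dist (u y) (u x) < \<delta> / 2"
    unfolding uniformly_continuous_on_def using sep(1) by (metis half_gt_zero)
  have "(\<lambda>n. r0 (s n)) \<longlonglongrightarrow> 0" using LIMSEQ_subseq_LIMSEQ[OF \<eta>0(2) s(1)] by (simp add: o_def)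
  then have "\<forall>\<^sub>F n in sequentially. r0 (s n) < d" using d(1) by (rule order_tendstoD(2))
  then obtain N0 where N0: "\<And>n. n \<ge> N0 \<Longrightarrow> r0 (s n) < d" unfolding eventually_sequentially by blast
  define \<eta> where "\<eta> n = \<eta>0 (s (n + N0))" for n
  define r where "r n = r0 (s (n + N0))" for n
  have \<eta>: "mollifier (\<eta> n) (r n)" "r n \<le> R" "r n \<le> 1" "r n < d" "\<eta> n x \<le> C / r n ^ DIM('a)" for n x
    using \<eta>0(1,5) \<eta>0(3)[of "s (n + N0)"] N0[of "n + N0"] by (auto simp: \<eta>_def r_def)
  have r_lim: "r \<longlonglongrightarrow> 0"
    unfolding r_def using LIMSEQ_ignore_initial_segment[OF \<open>(\<lambda>n. r0 (s n)) \<longlonglongrightarrow> 0\<close>, of N0] .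

  \<comment> \<open>Mollified solution, gradient and energy\<close>
  define un where "un n = conv (\<eta> n) u'" for n
  define gn where "gn n = conv (\<eta> n) g" for n
  define hn where "hn n = conv (\<eta> n) h" for n
  have [measurable]: "un n \<in> borel_measurable borel" "gn n \<in> borel_measurable borel" "hn n \<in> borel_measurable borel" for n
    unfolding un_def gn_def hn_def by (intro conv_borel_measurable[OF \<eta>(1)]; measurable)+
  have gn_lim: "AE x in lborel. (\<lambda>n. gn n x) \<longlonglongrightarrow> g x"
    using s(2)
  proof eventually_elim
    case (elim x)
    from LIM_zero_cancel[OF elim] have "(\<lambda>n. conv (\<eta>0 (s n)) g x) \<longlonglongrightarrow> g x" .
    from LIMSEQ_ignore_initial_segment[OF this, of N0] show ?case by (simp add: gn_def \<eta>_def)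
  qed
  have hn_lim: "(\<lambda>n. \<integral>x. norm (hn n x - h x) \<partial>lborel) \<longlonglongrightarrow> 0"
    unfolding hn_def by (rule conv_L1_tendsto[OF \<eta>(1) r_lim hi])
  have hn_int: "integrable lborel (hn n)" for n
    unfolding hn_def by (rule conv_L1_contraction(1)[OF \<eta>(1) hi])
  have un_bound: "\<bar>un n x\<bar> \<le> cu" for n x
    using conv_close[OF \<eta>(1) u'i, of x n 0 cu] cu(2) by (simp add: un_def)
  have u'_eq: "u' x = u x" if "x \<in> K" for x using that by (simp add: u'_def)
  have near: "y \<in> K" if "x \<in> cball x0 R" "norm (x - y) < r n" for x y n
    using that \<eta>(2)[of n] norm_triangle_ineq[of "y - x" "x - x0"]
    by (simp add: K dist_norm norm_minus_commute)
  have un_close: "\<bar>un n x - u x\<bar> \<le> \<delta> / 2" if x: "x \<in> cball x0 R" for n x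
  proof -
    have "x \<in> K" using x R by (auto simp: K)
    have "norm (conv (\<eta> n) u' x - u x) \<le> \<delta> / 2"
    proof (rule conv_close[OF \<eta>(1) u'i])
      fix y assume y: "norm (x - y) < r n"
      then have "y \<in> K" using near[OF x] by blast
      then show "norm (u' y - u x) \<le> \<delta> / 2"
        using d(2)[OF \<open>x \<in> K\<close> \<open>y \<in> K\<close>] y \<eta>(4)[of n]
        by (simp add: u'_eq dist_norm norm_minus_commute)
    qed
    then show ?thesis by (simp add: un_def)
  qed
  have un_lim: "(\<lambda>n. un n x) \<longlonglongrightarrow> u x" if x: "x \<in> B" for x
  proof -
    have xb: "x \<in> ball x0 (2 * R)" using x R by (auto simp: B_def)
    have "continuous_on (ball x0 (2 * R)) u'"
      using continuous_on_subset[OF u] by (rule continuous_on_eq) (auto simp: K u'_def)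
    then have "isCont u' x" using xb continuous_on_eq_continuous_at open_ball by blast
    from conv_tendsto[OF \<eta>(1) r_lim u'i this] show ?thesis
      using u'_eq[of x] x BK by (auto simp: un_def)
  qed
  have wg': "(\<integral>y. u' y *\<^sub>R N y \<partial>lborel) = - (\<integral>y. \<phi> y *\<^sub>R g y \<partial>lborel)"
    if "smooth_fun \<phi>" "\<And>y. R + R \<le> norm (y - x0) \<Longrightarrow> \<phi> y = 0" "\<And>y. (\<phi> has_derivative (\<lambda>h. N y \<bullet> h)) (at y)" for \<phi> N
    unfolding u'_def using that by (intro wg) auto
  have un_deriv: "(un n has_derivative (\<lambda>h. gn n x \<bullet> h)) (at x)" if "x \<in> B" for n x
    unfolding un_def gn_def
    by (rule conv_has_weak_gradient(1)[OF \<eta>(1) u'i wg' \<eta>(2)]) (use that in \<open>auto simp: B_def\<close>)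
  have gn_cont: "continuous_on B (gn n)" for n
    unfolding gn_def B_def
    by (rule conv_has_weak_gradient(2)[OF \<eta>(1) u'i wg' \<eta>(2)])
  have un_cont: "continuous_on B (un n)" for n
    by (intro continuous_at_imp_continuous_on ballI has_derivative_continuous[OF un_deriv])

  \<comment> \<open>The C^1 test functions and their gradients\<close>
  define m where "m n x = max 0 (un n x - \<psi>' x)" for n x
  define w where "w n x = indicator B x * (m n x)\<^sup>2" for n x
  define W where "W n x = indicator B x *\<^sub>R ((2 * m n x) *\<^sub>R (gn n x - G' x))" for n x
  have [measurable]: "m n \<in> borel_measurable borel" "w n \<in> borel_measurable borel" "W n \<in> borel_measurable borel" for n
    unfolding m_def w_def W_def by measurable
  have m_bound: "0 \<le> m n x" "m n x \<le> cu + c\<psi>" for n x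
    using un_bound[of n x] c\<psi>(2)[of x] cu(1) c\<psi>(1) by (auto simp: m_def abs_if split: if_splits)
  \<comment> \<open>On the collar
    \<open>un n \<le> u + \<delta> / 2 \<le> \<psi> - \<delta> / 2\<close>, so the positive part
    vanishes there for all \<open>n\<close>.\<close>
  have m_zero: "m n x = 0" if "\<rho> \<le> norm (x - x0)" "x \<in> B" for n x
  proof -
    have "x \<in> cball x0 R" using that by (auto simp: B_def)
    then show ?thesis using un_close[of x n] sep(2)[of x] sep(1) that by (auto simp: m_def \<psi>'_def abs_if split: if_splits)
  qed
  have w_zero: "w n x = 0" and W_zero: "W n x = 0" if "\<rho> \<le> norm (x - x0)" for n x
    using m_zero[OF that, of n] by (auto simp: w_def W_def indicator_def)
  have W_cont: "continuous_on UNIV (W n)" for n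
  proof (rule continuous_on_extend_zero[OF _ W_zero \<rho>])
    have "continuous_on B (\<lambda>x. (2 * max 0 (un n x - \<psi> x)) *\<^sub>R (gn n x - G x))"
      by (intro continuous_intros un_cont gn_cont continuous_on_subset[OF \<psi>c BK] continuous_on_subset[OF \<psi>(2) BK])
    then show "continuous_on (ball x0 R) (W n)"
      unfolding B_def[symmetric] by (rule continuous_on_eq) (auto simp: W_def m_def \<psi>'_def G'_def)
  qed
  have w_deriv: "(w n has_derivative (\<lambda>h. W n x \<bullet> h)) (at x)" for n x
  proof (cases "x \<in> B")
    case True
    have 1: "((\<lambda>x. un n x - \<psi> x) has_derivative (\<lambda>h. gn n x \<bullet> h - G x \<bullet> h)) (at x)"
      using True BK by (intro has_derivative_diff un_deriv \<psi>(1)) auto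
    have "((\<lambda>t. (max 0 t)\<^sup>2) has_derivative (*) (2 * max 0 (un n x - \<psi> x))) (at (un n x - \<psi> x))"
      using has_real_derivative_square_pos_part by (simp add: has_field_derivative_def)
    from has_derivative_compose[OF 1 this]
    have "((\<lambda>x. (max 0 (un n x - \<psi> x))\<^sup>2) has_derivative (\<lambda>h. W n x \<bullet> h)) (at x)"
      using True by (simp add: W_def m_def \<psi>'_def G'_def inner_diff_left)
    moreover have "open B" by (simp add: B_def)
    ultimately show ?thesis
      using True by (rule has_derivative_transform_within_open) (auto simp: w_def m_def \<psi>'_def)
  next
    case False
    then have x: "\<rho> < norm (x - x0)" using \<rho> by (simp add: B_def dist_norm norm_minus_commute)
    then have "W n x = 0" by (intro W_zero) simp
    then show ?thesis using has_derivative_zero_outside[of \<rho> x0 "w n", OF w_zero x] by simp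
  qed

  \<comment> \<open>Both equations tested at stage \<open>n\<close>\<close>
  define F where "F n x = (A x - V' x) \<bullet> W n x" for n x
  define S where "S n x = w n x * (Q' x - f' x)" for n x
  have FS: "(\<integral>x. F n x \<partial>lborel) = (\<integral>x. S n x \<partial>lborel)" for n
  proof -
    have "\<rho> < 2 * R" using \<rho> R by simp
    have Aeq: "(\<integral>x. A x \<bullet> W n x \<partial>lborel) = - (\<integral>x. w n x * f' x \<partial>lborel)"
      by (rule weak_form_C1_test[OF Ai f'i _ w_deriv W_cont w_zero \<open>\<rho> < 2 * R\<close>]) (auto simp: f'_def intro: we)
    have VD: "\<And>x. x \<in> ball x0 R \<Longrightarrow> (V has_derivative DV x) (at x)"
      "\<And>i. i \<in> Basis \<Longrightarrow> continuous_on (ball x0 R) (\<lambda>x. DV x i)"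
      using V(2) continuous_on_subset[OF V(3) BK] BK by (auto simp: B_def)
    note by_parts = integral_by_parts_divergence[OF w_deriv[where n = n] W_cont[where n = n] w_zero[where n = n] \<rho> VD]
    have VW: "V x \<bullet> W n x = V' x \<bullet> W n x" for x by (cases "x \<in> B") (auto simp: V'_def W_def)
    have wQ: "w n x * (\<Sum>i\<in>Basis. DV x i \<bullet> i) = w n x * Q' x" for x
      by (cases "x \<in> B") (auto simp: Q'_def w_def Q)
    obtain b where b: "\<And>x. norm (W n x) \<le> b" using compact_support_bounded[OF W_cont W_zero] by blast
    have AW: "integrable lborel (\<lambda>x. A x \<bullet> W n x)"
    proof (rule Bochner_Integration.integrable_bound)
      show "integrable lborel (\<lambda>x. norm (A x) * b)" using Ai by auto
      show "AE x in lborel. norm (A x \<bullet> W n x) \<le> norm (norm (A x) * b)"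
      proof (intro always_eventually allI)
        fix x
        have "\<bar>A x \<bullet> W n x\<bar> \<le> norm (A x) * b"
          using order_trans[OF Cauchy_Schwarz_ineq2 mult_left_mono[OF b norm_ge_zero]] .
        then show "norm (A x \<bullet> W n x) \<le> norm (norm (A x) * b)" by simp
      qed
    qed measurable
    have wf: "integrable lborel (\<lambda>x. w n x * f' x)"
    proof (rule Bochner_Integration.integrable_bound)
      show "integrable lborel (\<lambda>x. (cu + c\<psi>)\<^sup>2 * norm (f' x))" using f'i by auto
      show "AE x in lborel. norm (w n x * f' x) \<le> norm ((cu + c\<psi>)\<^sup>2 * norm (f' x))"
      proof (intro always_eventually allI)
        fix x
        have "\<bar>w n x\<bar> \<le> (cu + c\<psi>)\<^sup>2"
          using m_bound[of n x] by (auto simp: w_def indicator_def intro: power_mono)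
        from mult_right_mono[OF this, of "\<bar>f' x\<bar>"]
        show "norm (w n x * f' x) \<le> norm ((cu + c\<psi>)\<^sup>2 * norm (f' x))" by (simp add: abs_mult)
      qed
    qed measurable
    have "(\<integral>x. F n x \<partial>lborel) = (\<integral>x. A x \<bullet> W n x \<partial>lborel) - (\<integral>x. V' x \<bullet> W n x \<partial>lborel)"
      unfolding F_def inner_diff_left using AW by_parts(1) by (simp add: VW)
    also have "\<dots> = (\<integral>x. w n x * Q' x \<partial>lborel) - (\<integral>x. w n x * f' x \<partial>lborel)"
      using by_parts(3) by (simp add: Aeq VW wQ)
    also have "\<dots> = (\<integral>x. S n x \<partial>lborel)"
      unfolding S_def right_diff_distrib using wf by_parts(2) by (simp add: wQ)
    finally show ?thesis .
  qed

  \<comment> \<open>Limit integrands\<close>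
  define m' where "m' x = max 0 (u' x - \<psi>' x)" for x
  \<comment> \<open>Formally \<open>2 * m' * (g - G')\<close> is the gradient of the square of
    \<open>m'\<close>, but it enters only as a pointwise limit.\<close>
  define F' where "F' x = (A x - V' x) \<bullet> (indicator B x *\<^sub>R ((2 * m' x) *\<^sub>R (g x - G' x)))" for x
  define S' where "S' x = (indicator B x * (m' x)\<^sup>2) * (Q' x - f' x)" for x
  have [measurable]: "m' \<in> borel_measurable borel" "F' \<in> borel_measurable borel" "S' \<in> borel_measurable borel"
      "F n \<in> borel_measurable borel" "S n \<in> borel_measurable borel" for n
    unfolding m'_def F'_def S'_def F_def S_def by measurable
  have m'_bound: "0 \<le> m' x" "m' x \<le> cu + c\<psi>" for x
    using cu(2)[of x] c\<psi>(2)[of x] cu(1) c\<psi>(1) by (auto simp: m'_def abs_if split: if_splits)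
  have m_lim: "(\<lambda>n. m n x) \<longlonglongrightarrow> m' x" if "x \<in> B" for x
    unfolding m_def m'_def using un_lim[OF that] u'_eq[of x] that BK
    by (intro tendsto_intros) auto

  \<comment> \<open>Dominating functions\<close>
  define c1 where "c1 = 2 * (cu + c\<psi>)"
  define Kc where "Kc = (1 + exp (L * (ln (C * (\<integral>y. h y \<partial>lborel) + 1) + DIM('a)))) powr P"
  have P1: "1 \<le> P" using p(2,3)[of x0] by linarith
  have Kc1: "1 \<le> Kc" unfolding Kc_def using P1 by (intro ge_one_powr_ge_zero) auto
  \<comment> \<open>The bound of \<open>flux_bound\<close> with \<open>S = Kc * (t + 1)\<close>,
    times the bound \<open>c1\<close> of the factor \<open>2 * m\<close>. Inserting
    \<open>t = hn n x\<close> dominates \<open>F n\<close>, and \<open>t = h x\<close> dominates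
    \<open>F'\<close>.\<close>
  define \<Gamma> where "\<Gamma> t x = indicator B x * (c1 * ((h x + Kc * (t + 1)) + cG * (1 + h x) + cV * (1 + Kc * (t + 1)) + cV * cG))" for t x
  have \<Gamma>_bound: "\<bar>(A x - V' x) \<bullet> (indicator B x *\<^sub>R ((2 * \<mu>) *\<^sub>R (k - G' x)))\<bar> \<le> \<Gamma> t x"
    if "x \<in> B \<Longrightarrow> norm k powr p x \<le> Kc * (t + 1)" "0 \<le> \<mu>" "\<mu> \<le> cu + c\<psi>" for k t \<mu> x
  proof (cases "x \<in> B")
    case True
    have *: "\<bar>(A x - V' x) \<bullet> (k - G' x)\<bar> \<le> (h x + Kc * (t + 1)) + cG * (1 + h x) + cV * (1 + Kc * (t + 1)) + cV * cG"
      unfolding A_def h_def by (rule flux_bound) (use p(2) cV(2) cG(2) that(1) True in auto)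
    have "(2 * \<mu>) * \<bar>(A x - V' x) \<bullet> (k - G' x)\<bar> \<le> c1 * ((h x + Kc * (t + 1)) + cG * (1 + h x) + cV * (1 + Kc * (t + 1)) + cV * cG)"
      using that(2,3) by (intro mult_mono *) (auto simp: c1_def)
    then show ?thesis using True that(2) by (simp add: \<Gamma>_def abs_mult)
  qed (simp add: \<Gamma>_def)
  have \<Gamma>_int: "integrable lborel (\<lambda>x. \<Gamma> (\<tau> x) x)" if [measurable]: "\<tau> \<in> borel_measurable borel" and \<tau>: "integrable lborel \<tau>" for \<tau>
  proof -
    have "integrable lborel (\<lambda>x. indicator B x *\<^sub>R h x)" "integrable lborel (\<lambda>x. indicator B x *\<^sub>R \<tau> x)"
      by (rule integrable_mult_indicator[OF _ hi], simp) (rule integrable_mult_indicator[OF _ \<tau>], simp)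
    moreover have "(\<lambda>x. \<Gamma> (\<tau> x) x) = (\<lambda>x. c1 * (1 + cG) * (indicator B x *\<^sub>R h x) + c1 * (Kc + cV * Kc) * (indicator B x *\<^sub>R \<tau> x)
        + c1 * (Kc + cG + cV * (1 + Kc) + cV * cG) * indicator B x)"
      by (rule ext) (simp add: \<Gamma>_def algebra_simps)
    ultimately show ?thesis using B_fin by auto
  qed
  have gn_powr: "norm (gn n x) powr p x \<le> Kc * (hn n x + 1)" if x: "x \<in> B" for n x
    unfolding gn_def hn_def Kc_def h_def
  proof (rule conv_variable_powr_bound[OF \<eta>(1,5,3)])
    have xc: "x \<in> cball x0 R" "x \<in> K" using x BK by (auto simp: B_def)
    show "p x - L * r n \<le> p y" if "norm (x - y) < r n" for y
    proof -
      have "p x - p y \<le> L * norm (x - y)" using p(4)[OF xc(2) near[OF xc(1) that]] .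
      also have "\<dots> \<le> L * r n" using that p(5) by (intro mult_left_mono) auto
      finally show ?thesis by simp
    qed
  qed (use \<eta>0(4) gi g(3) p in auto)

  \<comment> \<open>Passage to the limit in the flux term\<close>
  have lim_F: "(\<lambda>n. \<integral>x. F n x \<partial>lborel) \<longlonglongrightarrow> (\<integral>x. F' x \<partial>lborel)"
  proof (rule dominated_convergence_L1_bounds[where G = "\<lambda>n x. \<Gamma> (hn n x) x" and G' = "\<lambda>x. \<Gamma> (h x) x"])
    have bF: "\<bar>F n x\<bar> \<le> \<Gamma> (hn n x) x" for n x
      unfolding F_def W_def using m_bound gn_powr by (intro \<Gamma>_bound) auto
    have bF': "\<bar>F' x\<bar> \<le> \<Gamma> (h x) x" for x
    proof -
      have "h x \<le> Kc * (h x + 1)" using Kc1 h0[of x] mult_mono[of 1 Kc "h x" "h x + 1"] by simp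
      then show ?thesis unfolding F'_def using m'_bound by (intro \<Gamma>_bound) (auto simp: h_def)
    qed
    show iG: "integrable lborel (\<lambda>x. \<Gamma> (hn n x) x)" for n by (rule \<Gamma>_int[OF _ hn_int]) measurable
    show iG': "integrable lborel (\<lambda>x. \<Gamma> (h x) x)" by (rule \<Gamma>_int[OF _ hi]) measurable
    show "AE x in lborel. \<bar>F n x\<bar> \<le> \<Gamma> (hn n x) x" for n using bF by simp
    show "AE x in lborel. \<bar>F' x\<bar> \<le> \<Gamma> (h x) x" using bF' by simp
    show "integrable lborel (F n)" for n
      by (rule Bochner_Integration.integrable_bound[OF iG[of n]]) (use bF[of n] in \<open>auto intro!: always_eventually order_trans[OF _ abs_ge_self]\<close>)
    show "integrable lborel F'"
      by (rule Bochner_Integration.integrable_bound[OF iG']) (use bF' in \<open>auto intro!: always_eventually order_trans[OF _ abs_ge_self]\<close>)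
    show "AE x in lborel. (\<lambda>n. F n x) \<longlonglongrightarrow> F' x"
      using gn_lim
    proof eventually_elim
      case (elim x)
      show ?case
      proof (cases "x \<in> B")
        case True
        then show ?thesis unfolding F_def F'_def W_def by (intro tendsto_intros m_lim elim)
      qed (simp add: F_def F'_def W_def)
    qed
    \<comment> \<open>The slope of \<open>\<Gamma>\<close> in its first argument at points of
      \<open>B\<close>.\<close>
    define c where "c = c1 * (Kc + cV * Kc)"
    have c0: "0 \<le> c" unfolding c_def c1_def using cu(1) c\<psi>(1) cV(1) Kc1 by simp
    have diff: "\<bar>\<Gamma> (hn n x) x - \<Gamma> (h x) x\<bar> \<le> c * norm (hn n x - h x)" for n x
    proof (cases "x \<in> B")
      case True
      have "\<Gamma> (hn n x) x - \<Gamma> (h x) x = c * (hn n x - h x)"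
        using True by (simp add: \<Gamma>_def c_def algebra_simps)
      then show ?thesis using c0 by (simp add: abs_mult)
    qed (use c0 in \<open>simp add: \<Gamma>_def\<close>)
    show "(\<lambda>n. \<integral>x. \<bar>\<Gamma> (hn n x) x - \<Gamma> (h x) x\<bar> \<partial>lborel) \<longlonglongrightarrow> 0"
    proof (rule real_tendsto_sandwich[OF _ _ tendsto_const])
      show "\<forall>\<^sub>F n in sequentially. (\<integral>x. \<bar>\<Gamma> (hn n x) x - \<Gamma> (h x) x\<bar> \<partial>lborel) \<le> c * (\<integral>x. norm (hn n x - h x) \<partial>lborel)"
      proof (intro always_eventually allI)
        fix n
        have "(\<integral>x. \<bar>\<Gamma> (hn n x) x - \<Gamma> (h x) x\<bar> \<partial>lborel) \<le> (\<integral>x. c * norm (hn n x - h x) \<partial>lborel)"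
          using diff iG[of n] iG' hn_int[of n] hi by (intro integral_mono) auto
        then show "(\<integral>x. \<bar>\<Gamma> (hn n x) x - \<Gamma> (h x) x\<bar> \<partial>lborel) \<le> c * (\<integral>x. norm (hn n x - h x) \<partial>lborel)" by simp
      qed
      show "(\<lambda>n. c * (\<integral>x. norm (hn n x - h x) \<partial>lborel)) \<longlonglongrightarrow> 0"
        using tendsto_mult_left[OF hn_lim, of c] by simp
    qed (auto intro: integral_nonneg_AE)
  qed

  \<comment> \<open>Passage to the limit in the source term\<close>
  define cS where "cS = (cu + c\<psi>)\<^sup>2 * (cQ + cf)"
  have S_bound: "\<bar>(indicator B x * \<mu>\<^sup>2) * (Q' x - f' x)\<bar> \<le> cS * indicator B x" if "0 \<le> \<mu>" "\<mu> \<le> cu + c\<psi>" for \<mu> x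
  proof -
    have "\<bar>Q' x - f' x\<bar> \<le> cQ + cf" using cQ(2)[of x] cf(2)[of x] by simp
    moreover have "\<mu>\<^sup>2 \<le> (cu + c\<psi>)\<^sup>2" using that by (intro power_mono) auto
    ultimately have "\<mu>\<^sup>2 * \<bar>Q' x - f' x\<bar> \<le> cS" unfolding cS_def by (intro mult_mono) auto
    then show ?thesis by (cases "x \<in> B") (auto simp: abs_mult)
  qed
  have S_int_bound: "integrable lborel (\<lambda>x. cS * indicator B x)" using B_fin by auto
  have lim_S: "(\<lambda>n. \<integral>x. S n x \<partial>lborel) \<longlonglongrightarrow> (\<integral>x. S' x \<partial>lborel)"
  proof (rule integral_dominated_convergence[OF _ _ S_int_bound])
    show "AE x in lborel. norm (S n x) \<le> cS * indicator B x" for n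
      unfolding S_def w_def using S_bound[OF m_bound] by simp
    show "AE x in lborel. (\<lambda>n. S n x) \<longlonglongrightarrow> S' x"
    proof (intro always_eventually allI)
      fix x
      show "(\<lambda>n. S n x) \<longlonglongrightarrow> S' x"
      proof (cases "x \<in> B")
        case True
        then show ?thesis unfolding S_def S'_def w_def by (intro tendsto_intros m_lim)
      qed (simp add: S_def S'_def w_def)
    qed
  qed measurable

  \<comment> \<open>Opposite signs of the two sides\<close>
  have eq: "(\<integral>x. F' x \<partial>lborel) = (\<integral>x. S' x \<partial>lborel)"
    using lim_F lim_S unfolding FS by (rule LIMSEQ_unique)
  \<comment> \<open>Now \<open>g\<close> stands both in the flux and in the difference, so
    monotonicity applies pointwise. As \<open>S'\<close> is nonpositive, both integrals vanish and
    \<open>S'\<close> is zero almost everywhere.\<close>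
  have "0 \<le> (\<integral>x. F' x \<partial>lborel)"
  proof (rule integral_nonneg_AE, intro always_eventually allI)
    fix x
    show "0 \<le> F' x"
    proof (cases "x \<in> B")
      case True
      then show ?thesis
        using powr_monotone_operator[OF p(2), of "g x" x "G x"] m'_bound(1)[of x]
        by (simp add: F'_def A_def V'_def G'_def V(1))
    qed (simp add: F'_def)
  qed
  then have le: "(\<integral>x. - S' x \<partial>lborel) \<le> 0" using eq by simp
  have S'_nonneg: "0 \<le> - S' x" for x
  proof (cases "x \<in> B")
    case True
    then have "Q' x - f' x < 0" using strict[of x] BK by (auto simp: Q'_def f'_def B_def)
    then have "(m' x)\<^sup>2 * (Q' x - f' x) \<le> 0" by (simp add: mult_nonneg_nonpos)
    then show ?thesis using True by (simp add: S'_def)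
  qed (simp add: S'_def)
  have S'_int: "integrable lborel (\<lambda>x. - S' x)"
    by (rule Bochner_Integration.integrable_bound[OF S_int_bound])
       (use S_bound[OF m'_bound] in \<open>auto simp: S'_def intro!: always_eventually order_trans[OF _ abs_ge_self]\<close>)
  have "(\<integral>x. - S' x \<partial>lborel) = 0"
    using le S'_nonneg by (intro antisym integral_nonneg_AE) auto
  then have S'_zero: "AE x in lborel. - S' x = 0"
    using integral_nonneg_eq_0_iff_AE[OF S'_int] S'_nonneg by auto
  \<comment> \<open>On \<open>U\<close> the integrand \<open>S'\<close> is strictly negative, so
    \<open>U\<close> is null; being open, it is empty. This turns an almost everywhere statement
    into one at every point, in particular at the centre.\<close>
  define U where "U = {x \<in> B. \<psi> x < u x}"
  have "open U"
  proof -
    have "continuous_on B (\<lambda>x. u x - \<psi> x)"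
      by (intro continuous_intros continuous_on_subset[OF u BK] continuous_on_subset[OF \<psi>c BK])
    then have "open (B \<inter> (\<lambda>x. u x - \<psi> x) -` {0<..})"
      by (rule continuous_open_preimage) (auto simp: B_def)
    moreover have "B \<inter> (\<lambda>x. u x - \<psi> x) -` {0<..} = U" by (auto simp: U_def)
    ultimately show ?thesis by simp
  qed
  moreover have "AE x in lborel. x \<notin> U"
    using S'_zero
  proof eventually_elim
    case (elim x)
    show ?case
    proof
      assume x: "x \<in> U"
      then have xB: "x \<in> B" "x \<in> K" "\<psi> x < u x" using BK by (auto simp: U_def)
      then have "m' x > 0" by (simp add: m'_def u'_eq \<psi>'_def)
      moreover have "Q' x - f' x \<noteq> 0" using strict[of x] xB by (auto simp: Q'_def f'_def B_def)
      ultimately show False using elim xB by (simp add: S'_def)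
    qed
  qed
  ultimately have "U = {}" by (rule AE_lborel_not_open)
  show ?thesis
  proof (rule ballI, rule ccontr)
    fix x assume "x \<in> ball x0 R" "\<not> u x \<le> \<psi> x"
    then have "x \<in> U" by (simp add: U_def B_def)
    then show False using \<open>U = {}\<close> by simp
  qed
qed

section \<open>Touching test functions\<close>

lemma flux_has_derivative:
  fixes G :: "'a::euclidean_space \<Rightarrow> 'a" and p :: "'a \<Rightarrow> real"
  assumes G: "(G has_derivative H) (at x)" "G x \<noteq> 0" and p: "(p has_derivative (\<lambda>h. d \<bullet> h)) (at x)"
  shows "((\<lambda>x. norm (G x) powr (p x - 2) *\<^sub>R G x) has_derivative
    (\<lambda>h. norm (G x) powr (p x - 2) *\<^sub>R (H h +
      ((d \<bullet> h) * ln (norm (G x)) + (p x - 2) * (G x \<bullet> H h) / (norm (G x))\<^sup>2) *\<^sub>R G x))) (at x)"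
proof -
  have n: "((\<lambda>x. norm (G x)) has_derivative (\<lambda>h. H h \<bullet> sgn (G x))) (at x)"
    using has_derivative_compose[OF G(1) has_derivative_norm[OF G(2)]] by simp
  have q: "((\<lambda>x. p x - 2) has_derivative (\<lambda>h. d \<bullet> h)) (at x)"
    using has_derivative_diff[OF p has_derivative_const[of 2]] by simp
  have "((\<lambda>x. norm (G x) powr (p x - 2)) has_derivative
      (\<lambda>h. norm (G x) powr (p x - 2) * ((d \<bullet> h) * ln (norm (G x)) + (H h \<bullet> sgn (G x)) * (p x - 2) / norm (G x)))) (at x)"
    by (rule has_derivative_powr[OF n q]) (use G(2) in auto)
  from has_derivative_scaleR[OF this G(1)] show ?thesis
  proof (rule has_derivative_eq_rhs, intro ext)
    fix h
    have "(H h \<bullet> sgn (G x)) * (p x - 2) / norm (G x) = (p x - 2) * (G x \<bullet> H h) / (norm (G x))\<^sup>2"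
      by (simp add: sgn_div_norm power2_eq_square inner_commute divide_inverse mult_ac)
    then show "norm (G x) powr (p x - 2) *\<^sub>R H h +
        (norm (G x) powr (p x - 2) * ((d \<bullet> h) * ln (norm (G x)) + (H h \<bullet> sgn (G x)) * (p x - 2) / norm (G x))) *\<^sub>R G x =
      norm (G x) powr (p x - 2) *\<^sub>R (H h +
      ((d \<bullet> h) * ln (norm (G x)) + (p x - 2) * (G x \<bullet> H h) / (norm (G x))\<^sup>2) *\<^sub>R G x)"
      by (simp add: scaleR_add_right)
  qed
qed

text \<open>The right-hand side is the trace of the derivative in
  \<open>flux_has_derivative\<close>, that is, the divergence of the flux. This links the pointwise
  operator of the viscosity definition to integration by parts.\<close>

lemma plap_pt_eq_divergence:
  fixes G :: "'a::euclidean_space \<Rightarrow> 'a"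
  assumes "linear (H x)"
  shows "plap_pt p gp G H x = (\<Sum>i\<in>Basis. (norm (G x) powr (p x - 2) *\<^sub>R (H x i +
      ((gp x \<bullet> i) * ln (norm (G x)) + (p x - 2) * (G x \<bullet> H x i) / (norm (G x))\<^sup>2) *\<^sub>R G x)) \<bullet> i)"
proof -
  define n where "n = norm (G x)"
  have HG: "H x (G x) \<bullet> G x = (\<Sum>i\<in>Basis. (G x \<bullet> i) * (G x \<bullet> H x i))"
    by (subst linear_Basis_expansion[OF assms, of "G x"], unfold inner_sum_left inner_scaleR_left)
       (simp add: inner_commute)
  have \<nu>: "H x (G x /\<^sub>R n) \<bullet> (G x /\<^sub>R n) = (H x (G x) \<bullet> G x) / n\<^sup>2"
    by (simp add: linear_scale[OF assms] power2_eq_square divide_inverse mult_ac)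
  have "(\<Sum>i\<in>Basis. (n powr (p x - 2) *\<^sub>R (H x i +
      ((gp x \<bullet> i) * ln n + (p x - 2) * (G x \<bullet> H x i) / n\<^sup>2) *\<^sub>R G x)) \<bullet> i) =
    (\<Sum>i\<in>Basis. n powr (p x - 2) * ((H x i \<bullet> i) + ln n * ((gp x \<bullet> i) * (G x \<bullet> i)) + (p x - 2) / n\<^sup>2 * ((G x \<bullet> i) * (G x \<bullet> H x i))))"
    by (intro sum.cong refl) (simp add: inner_add_left algebra_simps)
  also have "\<dots> = n powr (p x - 2) * ((\<Sum>i\<in>Basis. H x i \<bullet> i) + ln n * (gp x \<bullet> G x) + (p x - 2) / n\<^sup>2 * (H x (G x) \<bullet> G x))"
    unfolding HG euclidean_inner[of "gp x" "G x"] by (simp only: sum_distrib_left sum.distrib distrib_left)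
  finally show ?thesis
    unfolding plap_pt_def Let_def n_def[symmetric] \<nu> by (simp add: algebra_simps)
qed

lemma continuous_on_plap_pt:
  fixes G :: "'a::euclidean_space \<Rightarrow> 'a"
  assumes "continuous_on T p" "continuous_on T gp" "continuous_on T G" "\<And>i. i \<in> Basis \<Longrightarrow> continuous_on T (\<lambda>x. H x i)"
    "\<And>x. x \<in> T \<Longrightarrow> linear (H x)" "\<And>x. x \<in> T \<Longrightarrow> G x \<noteq> 0"
  shows "continuous_on T (plap_pt p gp G H)"
proof (rule continuous_on_eq)
  show "continuous_on T (\<lambda>x. \<Sum>i\<in>Basis. (norm (G x) powr (p x - 2) *\<^sub>R (H x i +
      ((gp x \<bullet> i) * ln (norm (G x)) + (p x - 2) * (G x \<bullet> H x i) / (norm (G x))\<^sup>2) *\<^sub>R G x)) \<bullet> i)"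
    using assms(6) by (intro continuous_intros assms) auto
qed (simp add: plap_pt_eq_divergence assms(5))

section \<open>From Lebesgue integrals over the domain to Borel integrals over the whole
  space\<close>

lemma lebesgue_borel_version:
  fixes g :: "'a::euclidean_space \<Rightarrow> 'b::euclidean_space"
  assumes "g \<in> borel_measurable lebesgue"
  obtains g' where "g' \<in> borel_measurable borel" "AE x in lborel. g x = g' x"
proof -
  have "\<forall>i\<in>Basis. \<exists>k\<in>borel_measurable lborel. AE x in lborel. g x \<bullet> i = k x"
    using assms by (intro ballI completion_ex_borel_measurable_real) simp
  then obtain k where k: "\<And>i. i \<in> Basis \<Longrightarrow> k i \<in> borel_measurable lborel"
    "\<And>i. i \<in> Basis \<Longrightarrow> AE x in lborel. g x \<bullet> i = k i x"
    by metis
  show thesis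
  proof
    show "(\<lambda>x. \<Sum>i\<in>Basis. k i x *\<^sub>R i) \<in> borel_measurable borel"
      using k(1) by (intro borel_measurable_sum borel_measurable_scaleR) auto
    have "AE x in lborel. \<forall>i\<in>Basis. g x \<bullet> i = k i x"
      using k(2) by (intro AE_finite_allI) auto
    then show "AE x in lborel. g x = (\<Sum>i\<in>Basis. k i x *\<^sub>R i)"
    proof eventually_elim
      case (elim x)
      have "g x = (\<Sum>i\<in>Basis. (g x \<bullet> i) *\<^sub>R i)" by (simp add: euclidean_representation)
      also have "\<dots> = (\<Sum>i\<in>Basis. k i x *\<^sub>R i)" using elim by (intro sum.cong) auto
      finally show ?case .
    qed
  qed
qed

text \<open>The weak formulation is stated over \<open>lebesgue_on \<Omega>\<close>, whereas
  convolution and Fubini are used over \<open>lborel\<close>. Agreement almost everywhere with a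
  Borel function is enough to change sides.\<close>

lemma lebesgue_on_eq_lborel:
  fixes F F' :: "'a::euclidean_space \<Rightarrow> 'b::euclidean_space"
  assumes \<Omega>: "\<Omega> \<in> sets lebesgue" and F': "F' \<in> borel_measurable borel"
    and ae: "AE x in lborel. indicator \<Omega> x *\<^sub>R F x = F' x"
  shows "integral\<^sup>L (lebesgue_on \<Omega>) F = integral\<^sup>L lborel F'"
    and "integrable (lebesgue_on \<Omega>) F \<longleftrightarrow> integrable lborel F'"
proof -
  have F'l: "F' \<in> borel_measurable lebesgue" using F' by (simp add: measurable_completion)
  have ae': "AE x in lebesgue. F' x = indicator \<Omega> x *\<^sub>R F x"
    using AE_completion[OF ae] by eventually_elim simp
  have Fl: "(\<lambda>x. indicator \<Omega> x *\<^sub>R F x) \<in> borel_measurable lebesgue"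
    by (rule borel_measurable_AE[OF F'l ae'])
  have "integral\<^sup>L (lebesgue_on \<Omega>) F = (\<integral>x. indicator \<Omega> x *\<^sub>R F x \<partial>lebesgue)"
    using \<Omega> by (intro integral_restrict_space) simp
  also have "\<dots> = integral\<^sup>L lebesgue F'"
    using ae' by (intro integral_cong_AE Fl F'l) (auto elim: eventually_mono)
  also have "\<dots> = integral\<^sup>L lborel F'" using F' by (intro integral_completion) simp
  finally show "integral\<^sup>L (lebesgue_on \<Omega>) F = integral\<^sup>L lborel F'" .
  have "integrable (lebesgue_on \<Omega>) F \<longleftrightarrow> integrable lebesgue (\<lambda>x. indicator \<Omega> x *\<^sub>R F x)"
    using \<Omega> by (intro integrable_restrict_space) simp
  also have "\<dots> \<longleftrightarrow> integrable lebesgue F'"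
    using ae' by (intro integrable_cong_AE Fl F'l) (auto elim: eventually_mono)
  also have "\<dots> \<longleftrightarrow> integrable lborel F'" using F' by (intro integrable_completion) simp
  finally show "integrable (lebesgue_on \<Omega>) F \<longleftrightarrow> integrable lborel F'" .
qed

lemma test_fun_ball:
  assumes "smooth_fun \<phi>" "\<And>x. r \<le> norm (x - x0) \<Longrightarrow> \<phi> x = 0" "cball x0 r \<subseteq> \<Omega>"
  shows "test_fun \<Omega> \<phi>"
proof -
  have "x \<in> cball x0 r" if "\<phi> x \<noteq> 0" for x
    using assms(2)[of x] that by (cases "r \<le> norm (x - x0)") (auto simp: dist_norm norm_minus_commute)
  then have "tsupport \<phi> \<subseteq> cball x0 r"
    unfolding tsupport_def by (intro closure_minimal) auto
  moreover have "compact (tsupport \<phi>)"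
    using calculation bounded_subset[OF bounded_cball] unfolding tsupport_def
    by (simp add: compact_eq_bounded_closed)
  ultimately show ?thesis using assms unfolding test_fun_def by blast
qed

lemma weak_solution_touching_above:
  fixes \<Omega> :: "'a::euclidean_space set"
  assumes "open \<Omega>" and f: "continuous_on \<Omega> f"
    and p: "\<And>x. x \<in> \<Omega> \<Longrightarrow> (p has_derivative (\<lambda>h. gp x \<bullet> h)) (at x)" "continuous_on \<Omega> gp"
      "1 < pmin" "\<And>x. x \<in> \<Omega> \<Longrightarrow> pmin \<le> p x \<and> p x \<le> pmax"
    and u: "continuous_on \<Omega> u" "W1px_grad \<Omega> p u g"
    and weak: "\<And>\<phi>. test_fun \<Omega> \<phi> \<Longrightarrow>
           - integral\<^sup>L (lebesgue_on \<Omega>)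
               (\<lambda>x. norm (g x) powr (p x - 2) * frechet_derivative \<phi> (at x) (g x))
           = integral\<^sup>L (lebesgue_on \<Omega>) (\<lambda>x. \<phi> x * f x)"
    and \<phi>: "C2_on \<Omega> \<phi> G H" and x0: "x0 \<in> \<Omega>" "G x0 \<noteq> 0" "\<phi> x0 = u x0"
    and r: "0 < r" "\<And>x. x \<in> ball x0 r \<inter> \<Omega> \<Longrightarrow> u x \<le> \<phi> x"
  shows "f x0 \<le> plap_pt p gp G H x0"
proof (rule ccontr)
  assume "\<not> f x0 \<le> plap_pt p gp G H x0"
  then have lt: "plap_pt p gp G H x0 < f x0" by simp
  have \<phi>1: "\<And>x. x \<in> \<Omega> \<Longrightarrow> (\<phi> has_derivative (\<lambda>h. G x \<bullet> h)) (at x)"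
    and \<phi>2: "\<And>x. x \<in> \<Omega> \<Longrightarrow> (G has_derivative H x) (at x)"
    and Hc: "\<And>v. continuous_on \<Omega> (\<lambda>x. H x v)"
    using \<phi> unfolding C2_on_def by auto
  have pc: "continuous_on \<Omega> p"
    by (intro continuous_at_imp_continuous_on ballI has_derivative_continuous[OF p(1)])

  \<comment> \<open>Perturbation of the test function and choice of the ball\<close>
  define c where "c = norm (G x0) powr (p x0 - 2) * (2 * DIM('a) + 2 * (p x0 - 2))"
  \<comment> \<open>Adding \<open>\<kappa> * (norm (x - x0))\<^sup>2\<close> keeps the gradient at
    \<open>x0\<close> and adds \<open>2 * \<kappa>\<close> times the identity to the Hessian, so the
    operator changes there by exactly \<open>\<kappa> * c\<close>. This choice uses up less than
    half of the gap to \<open>f x0\<close>.\<close>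
  define \<kappa> where "\<kappa> = (f x0 - plap_pt p gp G H x0) / (2 * (\<bar>c\<bar> + 1))"
  have \<kappa>: "0 < \<kappa>" using lt by (simp add: \<kappa>_def add_nonneg_pos)
  define G\<kappa> where "G\<kappa> x = G x + (2 * \<kappa>) *\<^sub>R (x - x0)" for x
  define H\<kappa> where "H\<kappa> x v = H x v + (2 * \<kappa>) *\<^sub>R v" for x v
  have \<psi>0_deriv: "((\<lambda>x. \<phi> x + \<kappa> * (norm (x - x0))\<^sup>2 - b) has_derivative (\<lambda>h. G\<kappa> x \<bullet> h)) (at x)" if "x \<in> \<Omega>" for x b
  proof -
    have "((\<lambda>x. (x - x0) \<bullet> (x - x0)) has_derivative (\<lambda>h. 2 * ((x - x0) \<bullet> h))) (at x)"
      by (auto intro!: derivative_eq_intros simp: inner_commute)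
    then have "((\<lambda>x. \<phi> x + \<kappa> * ((x - x0) \<bullet> (x - x0)) - b) has_derivative (\<lambda>h. G x \<bullet> h + \<kappa> * (2 * ((x - x0) \<bullet> h)) - 0)) (at x)"
      by (intro has_derivative_diff has_derivative_add \<phi>1 that has_derivative_mult_right has_derivative_const)
    then show ?thesis
      by (simp add: power2_norm_eq_inner G\<kappa>_def inner_add_left mult.assoc mult.left_commute)
  qed
  have G\<kappa>_deriv: "(G\<kappa> has_derivative H\<kappa> x) (at x)" if "x \<in> \<Omega>" for x
  proof -
    have "((\<lambda>x. G x + (2 * \<kappa>) *\<^sub>R (x - x0)) has_derivative (\<lambda>h. H x h + (2 * \<kappa>) *\<^sub>R (h - 0))) (at x)"
      by (intro has_derivative_add \<phi>2 that has_derivative_scaleR_right has_derivative_diff has_derivative_ident has_derivative_const)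
    then show ?thesis by (simp add: G\<kappa>_def[abs_def] H\<kappa>_def[abs_def])
  qed
  have H\<kappa>_lin: "linear (H\<kappa> x)" if "x \<in> \<Omega>" for x using G\<kappa>_deriv[OF that] by (rule has_derivative_linear)
  have H\<kappa>c: "continuous_on \<Omega> (\<lambda>x. H\<kappa> x v)" for v unfolding H\<kappa>_def by (intro continuous_intros Hc)
  have G\<kappa>c: "continuous_on \<Omega> G\<kappa>"
    by (intro continuous_at_imp_continuous_on ballI has_derivative_continuous[OF G\<kappa>_deriv])
  have plap\<kappa>: "plap_pt p gp G\<kappa> H\<kappa> x0 < f x0"
  proof -
    define \<nu> where "\<nu> = G x0 /\<^sub>R norm (G x0)"
    have "\<nu> \<bullet> \<nu> = 1" using x0(2) by (simp add: \<nu>_def power2_norm_eq_inner[symmetric] power2_eq_square)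
    then have 1: "H\<kappa> x0 \<nu> \<bullet> \<nu> = H x0 \<nu> \<bullet> \<nu> + 2 * \<kappa>" by (simp add: H\<kappa>_def inner_add_left)
    have 2: "(\<Sum>i\<in>Basis. H\<kappa> x0 i \<bullet> i) = (\<Sum>i\<in>Basis. H x0 i \<bullet> i) + 2 * \<kappa> * DIM('a)"
      by (simp add: H\<kappa>_def inner_add_left sum.distrib)
    have "plap_pt p gp G\<kappa> H\<kappa> x0 = plap_pt p gp G H x0 + \<kappa> * c"
      unfolding plap_pt_def Let_def G\<kappa>_def diff_self scaleR_zero_right add_0_right \<nu>_def[symmetric] 1 2
      by (simp add: c_def algebra_simps)
    also have "\<kappa> * c \<le> \<kappa> * \<bar>c\<bar>" using \<kappa> by (intro mult_left_mono) auto
    also have "\<kappa> * \<bar>c\<bar> < \<kappa> * (2 * (\<bar>c\<bar> + 1))" using \<kappa> by (intro mult_strict_left_mono) auto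
    also have "\<kappa> * (2 * (\<bar>c\<bar> + 1)) = f x0 - plap_pt p gp G H x0"
      unfolding \<kappa>_def by (simp add: add_nonneg_pos less_imp_neq[symmetric])
    finally show ?thesis by simp
  qed
  \<comment> \<open>On \<open>T\<close> the perturbed gradient is nonzero, so the flux is
    differentiable and the operator continuous. Hence the strict inequality at \<open>x0\<close>
    persists in an open set \<open>T'\<close>.\<close>
  define T where "T = {x \<in> \<Omega>. G\<kappa> x \<noteq> 0}"
  have "open T"
  proof -
    have "open (\<Omega> \<inter> G\<kappa> -` (- {0}))"
      by (rule continuous_open_preimage[OF G\<kappa>c \<open>open \<Omega>\<close>]) auto
    moreover have "\<Omega> \<inter> G\<kappa> -` (- {0}) = T" by (auto simp: T_def)
    ultimately show ?thesis by simp
  qed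
  have T\<Omega>: "T \<subseteq> \<Omega>" by (auto simp: T_def)
  define T' where "T' = T \<inter> (\<lambda>x. f x - plap_pt p gp G\<kappa> H\<kappa> x) -` {0<..}"
  have "open T'"
    unfolding T'_def
  proof (rule continuous_open_preimage[OF _ \<open>open T\<close>])
    have "continuous_on T (plap_pt p gp G\<kappa> H\<kappa>)"
      by (intro continuous_on_plap_pt continuous_on_subset[OF pc T\<Omega>] continuous_on_subset[OF p(2) T\<Omega>]
          continuous_on_subset[OF G\<kappa>c T\<Omega>] continuous_on_subset[OF H\<kappa>c T\<Omega>] H\<kappa>_lin) (auto simp: T_def)
    then show "continuous_on T (\<lambda>x. f x - plap_pt p gp G\<kappa> H\<kappa> x)"
      by (intro continuous_intros continuous_on_subset[OF f T\<Omega>])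
  qed auto
  moreover have "x0 \<in> T'" using x0 plap\<kappa> by (simp add: T'_def T_def G\<kappa>_def)
  ultimately obtain e where e: "0 < e" "ball x0 e \<subseteq> T'" by (meson openE)
  \<comment> \<open>The factor 4 makes room for three balls: comparison on radius \<open>R\<close>,
    data on radius \<open>2 * R\<close>, and the true exponent kept up to radius
    \<open>3 * R\<close>.\<close>
  define R where "R = min e r / 4"
  have R: "0 < R" using e r by (simp add: R_def)
  have big: "cball x0 (3 * R) \<subseteq> T'" "cball x0 (3 * R) \<subseteq> ball x0 r"
    using e r R by (auto simp: R_def)
  define K where "K = cball x0 (2 * R)"
  have K3: "K \<subseteq> ball x0 (3 * R)" "ball x0 (3 * R) \<subseteq> T'" using R big by (auto simp: K_def)
  have KT: "K \<subseteq> T" "K \<subseteq> \<Omega>" "K \<subseteq> T'" using K3 T\<Omega> by (auto simp: T'_def)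
  have K_meas[measurable]: "K \<in> sets borel" by (simp add: K_def)
  have compK: "compact K" by (simp add: K_def)
  define K3 where "K3 = cball x0 (3 * R)"
  have K3\<Omega>: "K3 \<subseteq> \<Omega>" using big T\<Omega> by (auto simp: K3_def T'_def)
  have KK3: "K \<subseteq> K3" using R by (auto simp: K_def K3_def)
  have K3_meas[measurable]: "K3 \<in> sets borel" by (simp add: K3_def)
  \<comment> \<open>The cut-off of \<open>p\<close> happens outside a neighbourhood of \<open>K\<close>, so that \<open>p'\<close> is still differentiable on \<open>K\<close>.\<close>
  define p' where "p' x = (if x \<in> K3 then p x else 2)" for x
  have p'_eq: "p' x = p x" if "x \<in> K" for x using that KK3 by (auto simp: p'_def)
  have p'_meas[measurable]: "p' \<in> borel_measurable borel"
  proof -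
    have "(\<lambda>x. indicator K3 x *\<^sub>R p x) \<in> borel_measurable borel"
      by (rule borel_measurable_continuous_on_indicator[OF K3_meas continuous_on_subset[OF pc K3\<Omega>]])
    then have "(\<lambda>x. if x \<in> K3 then indicator K3 x *\<^sub>R p x else 2) \<in> borel_measurable borel"
      by measurable
    moreover have "(\<lambda>x. if x \<in> K3 then indicator K3 x *\<^sub>R p x else 2) = p'" by (auto simp: p'_def)
    ultimately show ?thesis by simp
  qed

  \<comment> \<open>Borel data on the compact ball\<close>
  have g: "in_Lpx \<Omega> p g" and wgrad: "weak_gradient \<Omega> u g" and uL: "in_Lpx \<Omega> p u"
    using u(2) unfolding W1px_grad_def by auto
  have \<Omega>l: "\<Omega> \<in> sets lebesgue" using \<open>open \<Omega>\<close> by auto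
  have "(\<lambda>x. indicator \<Omega> x *\<^sub>R g x) \<in> borel_measurable lebesgue"
    using g \<Omega>l unfolding in_Lpx_def by (subst borel_measurable_restrict_space_iff[symmetric]) auto
  then obtain g0 where g0: "g0 \<in> borel_measurable borel" "AE x in lborel. indicator \<Omega> x *\<^sub>R g x = g0 x"
    by (rule lebesgue_borel_version)
  define g' where "g' x = indicator K x *\<^sub>R g0 x" for x
  have g'_meas[measurable]: "g' \<in> borel_measurable borel" unfolding g'_def using g0(1) by measurable
  have g'_out: "g' x = 0" if "x \<notin> K" for x using that by (simp add: g'_def)
  have g'_eq: "AE x in lborel. x \<in> K \<longrightarrow> g' x = g x"
    using g0(2) by eventually_elim (use KT in \<open>auto simp: g'_def\<close>)
  have h_int: "integrable lborel (\<lambda>x. norm (g' x) powr p' x)"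
  proof -
    have "integrable (lebesgue_on \<Omega>) (\<lambda>x. indicator K x *\<^sub>R (norm (g x) powr p x))"
    proof (rule integrable_mult_indicator)
      show "K \<in> sets (lebesgue_on \<Omega>)" using KT \<Omega>l K_meas by (auto simp: sets_restrict_space_iff)
      show "integrable (lebesgue_on \<Omega>) (\<lambda>x. norm (g x) powr p x)" using g by (simp add: in_Lpx_def)
    qed
    moreover have "AE x in lborel. indicator \<Omega> x *\<^sub>R (indicator K x *\<^sub>R (norm (g x) powr p x)) = norm (g' x) powr p' x"
      using g'_eq
    proof eventually_elim
      case (elim x)
      then show ?case using KT p'_eq[of x] g'_out[of x] by (cases "x \<in> K") auto
    qed
    ultimately show ?thesis
      by (subst lebesgue_on_eq_lborel(2)[OF \<Omega>l, symmetric]) auto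
  qed
  have K_fin: "integrable lborel (indicator K :: 'a \<Rightarrow> real)"
    unfolding K_def using emeasure_lborel_cball_finite[of x0 "2 * R"] by (intro integrable_real_indicator) auto
  have p'_ge: "1 \<le> p' x" and p'_le: "p' x \<le> max pmax 2" for x
    using p(3) p(4)[of x] K3\<Omega> by (auto simp: p'_def le_max_iff_disj)
  have g'_int: "integrable lborel g'"
  proof (rule Bochner_Integration.integrable_bound)
    show "integrable lborel (\<lambda>x. indicator K x + norm (g' x) powr p' x)" using K_fin h_int by simp
    show "AE x in lborel. norm (g' x) \<le> norm (indicator K x + norm (g' x) powr p' x)"
    proof (intro always_eventually allI)
      fix x
      show "norm (g' x) \<le> norm (indicator K x + norm (g' x) powr p' x)"
        using powr_le_one_plus_powr[of "norm (g' x)" 1 "p' x"] p'_ge[of x] g'_out[of x]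
        by (cases "x \<in> K") auto
    qed
  qed measurable
  have u'_int: "integrable lborel (\<lambda>x. indicator K x * u x)"
    using borel_integrable_compact[OF compK continuous_on_subset[OF u(1) KT(2)]] by simp
  have f'_meas: "(\<lambda>x. indicator K x * f x) \<in> borel_measurable borel"
    using borel_measurable_continuous_on_indicator[OF K_meas continuous_on_subset[OF f KT(2)]] by simp
  have u'_meas: "(\<lambda>x. indicator K x * u x) \<in> borel_measurable borel"
    using borel_measurable_integrable[OF u'_int] by simp

  \<comment> \<open>Transfer of the weak gradient and of the weak equation\<close>
  have test: "(\<integral>x. (indicator K x * u x) *\<^sub>R N x \<partial>lborel) = - (\<integral>x. \<theta> x *\<^sub>R g' x \<partial>lborel)"
    "(\<integral>x. (norm (g' x) powr (p' x - 2) *\<^sub>R g' x) \<bullet> N x \<partial>lborel) = - (\<integral>x. \<theta> x * (indicator K x * f x) \<partial>lborel)"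
    if \<theta>: "smooth_fun \<theta>" "\<And>x. 2 * R \<le> norm (x - x0) \<Longrightarrow> \<theta> x = 0" "\<And>x. (\<theta> has_derivative (\<lambda>h. N x \<bullet> h)) (at x)" for \<theta> N
  proof -
    have tf: "test_fun \<Omega> \<theta>" using \<theta>(1,2) KT(2) unfolding K_def by (rule test_fun_ball)
    have fd: "frechet_derivative \<theta> (at x) h = N x \<bullet> h" for x h
      using fun_cong[OF frechet_derivative_at[OF \<theta>(3)[of x]], of h] by simp
    have Nc: "continuous_on UNIV N"
    proof -
      obtain M where M: "\<And>x. (\<theta> has_derivative (\<lambda>h. M x \<bullet> h)) (at x)" "continuous_on UNIV M"
        using smooth_fun_gradient[OF \<theta>(1)] by blast
      have "(\<lambda>h. M x \<bullet> h) = (\<lambda>h. N x \<bullet> h)" for x by (rule has_derivative_unique[OF M(1) \<theta>(3)])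
      then have "M x = N x" for x by (metis vector_eq_rdot)
      then show ?thesis using M(2) by (simp add: fun_eq_iff[symmetric])
    qed
    have N0: "N x = 0" if "2 * R \<le> norm (x - x0)" for x
      by (rule gradient_zero_outside[OF \<theta>(3) Nc \<theta>(2) that])
    have out: "\<theta> x = 0" "N x = 0" if "x \<notin> K" for x
      using that \<theta>(2)[of x] N0[of x] by (auto simp: K_def dist_norm norm_minus_commute)
    have \<theta>c: "continuous_on UNIV \<theta>" by (rule smooth_fun_continuous[OF \<theta>(1)])
    note [measurable] = borel_measurable_continuous_onI[OF Nc] borel_measurable_continuous_onI[OF \<theta>c]
      f'_meas u'_meas
    obtain b where b: "\<And>x. norm (N x) \<le> b" using compact_support_bounded[OF Nc N0] by blast
    obtain b' where b': "\<And>x. norm (\<theta> x) \<le> b'" using compact_support_bounded[OF \<theta>c \<theta>(2)] by blast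
    have i1: "integrable lborel (\<lambda>x. (indicator K x * u x) *\<^sub>R N x)"
    proof (rule Bochner_Integration.integrable_bound)
      show "integrable lborel (\<lambda>x. norm (indicator K x * u x) * b)" using u'_int by (intro integrable_mult_left integrable_norm)
      show "AE x in lborel. norm ((indicator K x * u x) *\<^sub>R N x) \<le> norm (norm (indicator K x * u x) * b)"
        by (intro always_eventually allI) (auto simp: abs_mult intro!: mult_left_mono order_trans[OF b abs_ge_self])
    qed measurable
    have i2: "integrable lborel (\<lambda>x. \<theta> x *\<^sub>R g' x)"
    proof (rule Bochner_Integration.integrable_bound)
      show "integrable lborel (\<lambda>x. b' * norm (g' x))" using g'_int by (intro integrable_mult_right integrable_norm)
      show "AE x in lborel. norm (\<theta> x *\<^sub>R g' x) \<le> norm (b' * norm (g' x))"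
        using mult_right_mono[OF order_trans[OF b' abs_ge_self] norm_ge_zero]
        by (intro always_eventually allI) (simp add: abs_mult)
    qed measurable
    show "(\<integral>x. (indicator K x * u x) *\<^sub>R N x \<partial>lborel) = - (\<integral>x. \<theta> x *\<^sub>R g' x \<partial>lborel)"
    proof (rule euclidean_eqI)
      fix i :: 'a assume i: "i \<in> Basis"
      have "(\<integral>x. (indicator K x * u x) *\<^sub>R N x \<partial>lborel) \<bullet> i = (\<integral>x. ((indicator K x * u x) *\<^sub>R N x) \<bullet> i \<partial>lborel)"
        by (rule integral_inner_left[OF i1, symmetric])
      also have "\<dots> = integral\<^sup>L (lebesgue_on \<Omega>) (\<lambda>x. u x * frechet_derivative \<theta> (at x) i)"
      proof (rule lebesgue_on_eq_lborel(1)[OF \<Omega>l, symmetric])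
        show "AE x in lborel. indicator \<Omega> x *\<^sub>R (u x * frechet_derivative \<theta> (at x) i) = ((indicator K x * u x) *\<^sub>R N x) \<bullet> i"
        proof (intro always_eventually allI)
          fix x
          show "indicator \<Omega> x *\<^sub>R (u x * frechet_derivative \<theta> (at x) i) = ((indicator K x * u x) *\<^sub>R N x) \<bullet> i"
            using KT out[of x] by (cases "x \<in> K") (auto simp: fd)
        qed
      qed measurable
      also have "\<dots> = - integral\<^sup>L (lebesgue_on \<Omega>) (\<lambda>x. (g x \<bullet> i) * \<theta> x)"
        using wgrad tf i unfolding weak_gradient_def by blast
      also have "integral\<^sup>L (lebesgue_on \<Omega>) (\<lambda>x. (g x \<bullet> i) * \<theta> x) = (\<integral>x. (\<theta> x *\<^sub>R g' x) \<bullet> i \<partial>lborel)"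
      proof (rule lebesgue_on_eq_lborel(1)[OF \<Omega>l])
        show "AE x in lborel. indicator \<Omega> x *\<^sub>R ((g x \<bullet> i) * \<theta> x) = (\<theta> x *\<^sub>R g' x) \<bullet> i"
          using g'_eq
        proof eventually_elim
          case (elim x)
          then show ?case using KT out[of x] by (cases "x \<in> K") auto
        qed
      qed measurable
      also have "\<dots> = (\<integral>x. \<theta> x *\<^sub>R g' x \<partial>lborel) \<bullet> i" by (rule integral_inner_left[OF i2])
      finally show "(\<integral>x. (indicator K x * u x) *\<^sub>R N x \<partial>lborel) \<bullet> i = (- (\<integral>x. \<theta> x *\<^sub>R g' x \<partial>lborel)) \<bullet> i" by simp
    qed
    have "(\<integral>x. (norm (g' x) powr (p' x - 2) *\<^sub>R g' x) \<bullet> N x \<partial>lborel) =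
        integral\<^sup>L (lebesgue_on \<Omega>) (\<lambda>x. norm (g x) powr (p x - 2) * frechet_derivative \<theta> (at x) (g x))"
    proof (rule lebesgue_on_eq_lborel(1)[OF \<Omega>l, symmetric])
      show "AE x in lborel. indicator \<Omega> x *\<^sub>R (norm (g x) powr (p x - 2) * frechet_derivative \<theta> (at x) (g x)) =
          (norm (g' x) powr (p' x - 2) *\<^sub>R g' x) \<bullet> N x"
        using g'_eq
      proof eventually_elim
        case (elim x)
        then show ?case using KT out[of x] p'_eq[of x] by (cases "x \<in> K") (auto simp: fd inner_commute)
      qed
    qed measurable
    also have "\<dots> = - integral\<^sup>L (lebesgue_on \<Omega>) (\<lambda>x. \<theta> x * f x)" using weak[OF tf] by simp
    also have "integral\<^sup>L (lebesgue_on \<Omega>) (\<lambda>x. \<theta> x * f x) = (\<integral>x. \<theta> x * (indicator K x * f x) \<partial>lborel)"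
    proof (rule lebesgue_on_eq_lborel(1)[OF \<Omega>l])
      show "AE x in lborel. indicator \<Omega> x *\<^sub>R (\<theta> x * f x) = \<theta> x * (indicator K x * f x)"
      proof (intro always_eventually allI)
        fix x
        show "indicator \<Omega> x *\<^sub>R (\<theta> x * f x) = \<theta> x * (indicator K x * f x)"
          using KT out[of x] by (cases "x \<in> K") auto
      qed
    qed measurable
    finally show "(\<integral>x. (norm (g' x) powr (p' x - 2) *\<^sub>R g' x) \<bullet> N x \<partial>lborel) = - (\<integral>x. \<theta> x * (indicator K x * f x) \<partial>lborel)" .
  qed

  \<comment> \<open>Lipschitz bound for the exponent\<close>
  obtain L where L: "0 \<le> L" "\<And>x. x \<in> K \<Longrightarrow> norm (gp x) \<le> L"
  proof -
    have "bounded (gp ` K)"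
      by (intro compact_imp_bounded compact_continuous_image continuous_on_subset[OF p(2) KT(2)] compK)
    then obtain L where "0 < L" "\<And>x. x \<in> K \<Longrightarrow> norm (gp x) \<le> L" by (auto simp: bounded_pos)
    then show thesis by (intro that[of L]) auto
  qed
  have Lip: "p' x - p' y \<le> L * norm (x - y)" if "x \<in> K" "y \<in> K" for x y
  proof -
    have "norm (p x - p y) \<le> L * norm (x - y)"
    proof (rule differentiable_bound[of K p "\<lambda>x h. gp x \<bullet> h"])
      show "convex K" by (simp add: K_def)
      show "(p has_derivative (\<lambda>h. gp z \<bullet> h)) (at z within K)" if "z \<in> K" for z
        by (rule has_derivative_at_withinI[OF p(1)]) (use that KT in auto)
      show "onorm (\<lambda>h. gp z \<bullet> h) \<le> L" if "z \<in> K" for z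
      proof (rule onorm_le)
        fix h
        have "\<bar>gp z \<bullet> h\<bar> \<le> norm (gp z) * norm h" by (rule Cauchy_Schwarz_ineq2)
        also have "\<dots> \<le> L * norm h" using L(2)[OF that] by (rule mult_right_mono) simp
        finally show "norm (gp z \<bullet> h) \<le> L * norm h" by simp
      qed
    qed (use that in auto)
    then show ?thesis using that by (simp add: p'_eq)
  qed

  \<comment> \<open>Application of the comparison\<close>
  \<comment> \<open>Beyond radius \<open>3 * R / 4\<close> the quadratic term is at least
    \<open>9 * \<kappa> * R\<^sup>2 / 16\<close>. Subtracting
    \<open>b = 4 * \<kappa> * R\<^sup>2 / 16\<close> leaves the margin
    \<open>\<delta> = 5 * \<kappa> * R\<^sup>2 / 16\<close>, while at \<open>x0\<close> the shifted
    function lies below \<open>u x0\<close> by \<open>b\<close>.\<close>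
  define b where "b = \<kappa> * R\<^sup>2 / 4"
  define DV where "DV x h = norm (G\<kappa> x) powr (p x - 2) *\<^sub>R (H\<kappa> x h +
      ((gp x \<bullet> h) * ln (norm (G\<kappa> x)) + (p x - 2) * (G\<kappa> x \<bullet> H\<kappa> x h) / (norm (G\<kappa> x))\<^sup>2) *\<^sub>R G\<kappa> x)" for x h
  have "\<forall>x\<in>ball x0 R. u x \<le> \<phi> x + \<kappa> * (norm (x - x0))\<^sup>2 - b"
  proof (rule weak_solution_comparison[where p = p' and g = g' and K = K and R = R and P = "max pmax 2" and L = L
        and f = f and G = G\<kappa> and V = "\<lambda>x. norm (G\<kappa> x) powr (p' x - 2) *\<^sub>R G\<kappa> x" and DV = DV
        and Q = "\<lambda>x. \<Sum>i\<in>Basis. DV x i \<bullet> i" and \<rho> = "3 * R / 4" and \<delta> = "5 * \<kappa> * R\<^sup>2 / 16"])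
    show "0 < R" "3 * R / 4 < R" using R by auto
    show "K = cball x0 (2 * R)" by (rule K_def)
    show "continuous_on K u" "continuous_on K f" "continuous_on K G\<kappa>"
      using KT(2) u(1) f G\<kappa>c continuous_on_subset by blast+
    show "integrable lborel (\<lambda>x. norm (g' x) powr p' x)" by (rule h_int)
    show "((\<lambda>x. \<phi> x + \<kappa> * (norm (x - x0))\<^sup>2 - b) has_derivative (\<lambda>h. G\<kappa> x \<bullet> h)) (at x)" if "x \<in> K" for x
      using \<psi>0_deriv that KT by blast
    show "((\<lambda>x. norm (G\<kappa> x) powr (p' x - 2) *\<^sub>R G\<kappa> x) has_derivative DV x) (at x)" if x: "x \<in> K" for x
    proof -
      have "((\<lambda>x. norm (G\<kappa> x) powr (p x - 2) *\<^sub>R G\<kappa> x) has_derivative DV x) (at x)"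
        unfolding DV_def[abs_def] using x KT
        by (intro flux_has_derivative G\<kappa>_deriv p(1)) (auto simp: T_def)
      then show ?thesis
        by (rule has_derivative_transform_within_open[of _ _ _ _ "ball x0 (3 * R)"])
           (use x K3(1) in \<open>auto simp: p'_def K3_def\<close>)
    qed
    show "continuous_on K (\<lambda>x. DV x i)" if "i \<in> Basis" for i
      unfolding DV_def using KT(1)
      by (intro continuous_intros continuous_on_subset[OF pc KT(2)] continuous_on_subset[OF p(2) KT(2)]
          continuous_on_subset[OF G\<kappa>c KT(2)] continuous_on_subset[OF H\<kappa>c KT(2)]) (auto simp: T_def)
    show "(\<Sum>i\<in>Basis. DV x i \<bullet> i) < f x" if x: "x \<in> ball x0 R" for x
    proof -
      have xT: "x \<in> T'" using x K3 R by auto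
      then have "plap_pt p gp G\<kappa> H\<kappa> x < f x" by (simp add: T'_def)
      moreover have "linear (H\<kappa> x)" using xT T\<Omega> by (intro H\<kappa>_lin) (auto simp: T'_def)
      ultimately show ?thesis unfolding DV_def by (simp add: plap_pt_eq_divergence)
    qed
    show "0 < 5 * \<kappa> * R\<^sup>2 / 16" using \<kappa> R by simp
    show "u x \<le> \<phi> x + \<kappa> * (norm (x - x0))\<^sup>2 - b - 5 * \<kappa> * R\<^sup>2 / 16" if x: "3 * R / 4 \<le> norm (x - x0)" "x \<in> cball x0 R" for x
    proof -
      have "x \<in> K" using x R by (auto simp: K_def)
      then have "x \<in> ball x0 r \<inter> \<Omega>" using KT(2) K3 big(2) by (auto simp: subset_eq)
      then have "u x \<le> \<phi> x" by (rule r(2))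
      moreover have "(3 * R / 4)\<^sup>2 \<le> (norm (x - x0))\<^sup>2" using x R by (intro power_mono) auto
      then have "\<kappa> * (9 * R\<^sup>2 / 16) \<le> \<kappa> * (norm (x - x0))\<^sup>2"
        using \<kappa> by (intro mult_left_mono) (auto simp: power_mult_distrib power_divide)
      ultimately show ?thesis by (simp add: b_def field_simps)
    qed
  qed (use test Lip L p'_ge p'_le p'_meas g'_meas g'_out in auto)
  then have "u x0 \<le> \<phi> x0 - b" using R by (auto dest: bspec[of _ _ x0])
  moreover have "0 < b" using \<kappa> R by (simp add: b_def)
  ultimately show False using x0(3) by simp
qed

text \<open>The unit vector and \<open>H x\<close> both change sign; linearity of \<open>H x\<close>
  brings out the sign of its argument, so the quadratic term is odd like the others.\<close>

lemma plap_pt_uminus: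
  assumes "linear (H x)"
  shows "plap_pt p gp (\<lambda>x. - G x) (\<lambda>x v. - H x v) x = - plap_pt p gp G H x"
proof -
  have "H x (- v) = - H x v" for v using linear_neg[OF assms] .
  then show ?thesis
    by (simp add: plap_pt_def Let_def sum_negf algebra_simps)
qed

lemma frechet_derivative_neg:
  assumes "\<phi> differentiable (at x)"
  shows "frechet_derivative \<phi> (at x) (- v) = - frechet_derivative \<phi> (at x) v"
  using linear_neg[OF linear_frechet_derivative[OF assms]] .

theorem theorem6p1:
  fixes \<Omega> :: "'a::euclidean_space set"
    and f p :: "'a \<Rightarrow> real"
    and gp :: "'a \<Rightarrow> 'a"
    and u :: "'a \<Rightarrow> real"
  assumes domain: "open \<Omega>" "connected \<Omega>" "\<Omega> \<noteq> {}"
    and f_cont: "continuous_on \<Omega> f"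
    and f_Linf: "f \<in> borel_measurable (lebesgue_on \<Omega>)" "\<exists>C. AE x in lebesgue_on \<Omega>. \<bar>f x\<bar> \<le> C"
    and p_C1: "\<forall>x\<in>\<Omega>. (p has_derivative (\<lambda>h. gp x \<bullet> h)) (at x)" "continuous_on \<Omega> gp"
    and p_bounds: "\<exists>pmin pmax. 1 < pmin \<and> (\<forall>x\<in>\<Omega>. pmin \<le> p x \<and> p x \<le> pmax)"
    and gp_Linf: "\<exists>C. AE x in lebesgue_on \<Omega>. norm (gp x) \<le> C"
    and u_W: "in_W1px \<Omega> p u"
    and u_cont: "continuous_on \<Omega> u"
    and u_weak: "weak_solution \<Omega> p f u"
  shows "viscosity_solution \<Omega> p gp f u"
proof -
  obtain pmin pmax where pb: "1 < pmin" "\<And>x. x \<in> \<Omega> \<Longrightarrow> pmin \<le> p x \<and> p x \<le> pmax"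
    using p_bounds by blast
  have p1: "\<And>x. x \<in> \<Omega> \<Longrightarrow> (p has_derivative (\<lambda>h. gp x \<bullet> h)) (at x)" using p_C1(1) by blast
  obtain g where g: "W1px_grad \<Omega> p u g"
    and weak: "\<And>\<phi>. test_fun \<Omega> \<phi> \<Longrightarrow>
           - integral\<^sup>L (lebesgue_on \<Omega>)
               (\<lambda>x. norm (g x) powr (p x - 2) * frechet_derivative \<phi> (at x) (g x))
           = integral\<^sup>L (lebesgue_on \<Omega>) (\<lambda>x. \<phi> x * f x)"
    using u_weak unfolding weak_solution_def by blast
  \<comment> \<open>The operator is odd, so \<open>- u\<close> is a weak solution with right-hand
    side \<open>- f\<close>. Touching from below by \<open>\<phi>\<close> becomes touching from
    above by \<open>- \<phi>\<close>.\<close>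
  have g_neg: "W1px_grad \<Omega> p (\<lambda>x. - u x) (\<lambda>x. - g x)"
    using g unfolding W1px_grad_def in_Lpx_def weak_gradient_def by auto
  have weak_neg: "- integral\<^sup>L (lebesgue_on \<Omega>)
        (\<lambda>x. norm (- g x) powr (p x - 2) * frechet_derivative \<phi> (at x) (- g x))
      = integral\<^sup>L (lebesgue_on \<Omega>) (\<lambda>x. \<phi> x * - f x)" if "test_fun \<Omega> \<phi>" for \<phi>
  proof -
    have "smooth_fun \<phi>" using that by (simp add: test_fun_def)
    then have "\<phi> differentiable (at x)" for x
      using smooth_fun_gradient differentiableI by metis
    then show ?thesis using weak[OF that] by (simp add: frechet_derivative_neg)
  qed
  show ?thesis
    unfolding viscosity_solution_def
  proof (intro conjI allI impI u_cont)
    fix \<phi> G H x0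
    assume C2: "C2_on \<Omega> \<phi> G H \<and> x0 \<in> \<Omega> \<and> G x0 \<noteq> 0"
    {
      assume "\<phi> x0 = u x0 \<and> (\<exists>r>0. \<forall>x\<in>ball x0 r \<inter> \<Omega>. u x \<le> \<phi> x)"
      then obtain r where r: "\<phi> x0 = u x0" "0 < r" "\<And>x. x \<in> ball x0 r \<inter> \<Omega> \<Longrightarrow> u x \<le> \<phi> x" by blast
      show "f x0 \<le> plap_pt p gp G H x0"
        by (rule weak_solution_touching_above[OF domain(1) f_cont p1 p_C1(2) pb u_cont g weak _ _ _ r]) (use C2 in auto)
    }
    {
      assume "\<phi> x0 = u x0 \<and> (\<exists>r>0. \<forall>x\<in>ball x0 r \<inter> \<Omega>. \<phi> x \<le> u x)"
      then obtain r where r: "- \<phi> x0 = - u x0" "0 < r" "\<And>x. x \<in> ball x0 r \<inter> \<Omega> \<Longrightarrow> - u x \<le> - \<phi> x" by auto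
      have C2_neg: "C2_on \<Omega> (\<lambda>x. - \<phi> x) (\<lambda>x. - G x) (\<lambda>x v. - H x v)"
        using C2 unfolding C2_on_def inner_minus_left by (simp add: has_derivative_minus continuous_on_minus)
      have "- f x0 \<le> plap_pt p gp (\<lambda>x. - G x) (\<lambda>x v. - H x v) x0"
        by (rule weak_solution_touching_above[OF domain(1) continuous_on_minus[OF f_cont] p1 p_C1(2) pb
              continuous_on_minus[OF u_cont] g_neg weak_neg C2_neg _ _ r]) (use C2 in auto)
      moreover have "linear (H x0)"
        using C2 has_derivative_linear unfolding C2_on_def by blast
      ultimately show "plap_pt p gp G H x0 \<le> f x0" by (simp add: plap_pt_uminus)
    }
  qed
qed

end
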